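(* Let $n\ge 2$ and let $A=\Bbbk_{\mathbf p}[x_1,\dots,x_n]$ be a skew polynomial ring over a field $\Bbbk$ such that each $p_{ij}$ is a root of unity. Let $Z$ be the center of $A$. Then an $\overline{\mathcal R}$-discriminant of $A$ over $Z$ exists; that is, there is a normal element $d\in A$ with $(\mathrm{MD}(A/Z)A)^{\vee\vee}=dA$.
   Context: Skew polynomial ring: for a matrix $\mathbf p=(p_{ij})\in M_n(\Bbbk^\times)$ with $p_{ii}=1$ and $p_{ij}=p_{ji}^{-1}$, $\Bbbk_{\mathbf p}[x_1,\dots,x_n]$ is the $\Bbbk$-algebra generated by $x_1,\dots,x_n$ with relations $x_jx_i=p_{ij}x_ix_j$ for $1\le i<j\le n$. Discriminant notions: let $R$ be a commutative domain that is a central subalgebra of a prime $\Bbbk$-algebra $B$ with $B$ a finitely generated $R$-module. Let $F$ be the fraction field of $R$, $B_F=B\otimes_R F$, and $w=\dim_F B_F$ (the rank of $B$ over $R$). The regular trace $\mathrm{tr}:B\to F$ sends $b$ to the trace of left multiplication by $b$ on $B_F$; it is required that $\mathrm{tr}(B)\subseteq R$. For $v\ge1$, $\mathrm{MD}_v(B/R)$ is the ideal of $R$ generated by all $\det\big(\mathrm{tr}(u_iu_j')\big)_{i,j=1}^v$, where $\{u_i\}_{i=1}^v$ and $\{u_i'\}_{i=1}^v$ range over all $v$-element subsets of $B$; $\mathrm{MD}(B/R):=\mathrm{MD}_w(B/R)$. For an $R$-module $M$ put $M^\vee=\mathrm{Hom}_R(M,R)$; the reflexive hull of $M$ is $M^{\vee\vee}$,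 and $M$ is reflexive if the natural map $M\to M^{\vee\vee}$ is an isomorphism. If $B$ is a reflexive $R$-module and $M$ is an ideal of $B$, then $M^{\vee\vee}$ is viewed as an ideal of $B=B^{\vee\vee}$ containing $M$. An element $d\in B$ is normal if $dB=Bd$. If $B$ is reflexive over $R$, a normal element $d\in B$ is an $\overline{\mathcal R}$-discriminant (extended reflexive hull discriminant) of $B$ over $R$ if $(\mathrm{MD}(B/R)B)^{\vee\vee}=dB$. Here these notions are applied to $B=A$, $R=Z$. *)

theory Defs
  imports
    "HOL-Combinatorics.Permutations"
    "HOL-Algebra.QuotRing"
    "HOL-Algebra.Subrings"
    "HOL-Algebra.Ideal_Product"
    "HOL-Algebra.Generated_Groups"
    "HOL-Algebra.Free_Abelian_Groups"
    "Jordan_Normal_Form.Missing_VectorSpace"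
begin

section \<open>Skew polynomial rings\<close>

text \<open>
  The free algebra on \<open>x\<^sub>1, \<dots>, x\<^sub>n\<close> is the monoid algebra of words: the word \<open>[i\<^sub>1, \<dots>, i\<^sub>m]\<close>
  stands for \<open>x\<^bsub>i\<^sub>1\<^esub> \<cdots> x\<^bsub>i\<^sub>m\<^esub>\<close>, and \<open>Poly_Mapping.single w c\<close> for \<open>c\<close> times the word \<open>w\<close>.
\<close>

definition free_algebra :: "nat \<Rightarrow> (nat list \<Rightarrow>\<^sub>0 'k::field) ring" where
  "free_algebra n =
    \<lparr>carrier = {f. \<forall>w \<in> Poly_Mapping.keys f. set w \<subseteq> {1..n}},
     mult = (\<lambda>f g. \<Sum>u \<in> Poly_Mapping.keys f. \<Sum>v \<in> Poly_Mapping.keys g.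
       Poly_Mapping.single (u @ v) (Poly_Mapping.lookup f u * Poly_Mapping.lookup g v)),
     one = Poly_Mapping.single [] 1,
     ring.zero = 0,
     ring.add = (+)\<rparr>"

definition skew_relations :: "nat \<Rightarrow> (nat \<Rightarrow> nat \<Rightarrow> 'k::field) \<Rightarrow> (nat list \<Rightarrow>\<^sub>0 'k) set" where
  "skew_relations n p =
    {Poly_Mapping.single [j, i] 1 - Poly_Mapping.single [i, j] (p i j) | i j. 1 \<le> i \<and> i < j \<and> j \<le> n}"

definition skew_polynomial_ring ::
    "nat \<Rightarrow> (nat \<Rightarrow> nat \<Rightarrow> 'k::field) \<Rightarrow> (nat list \<Rightarrow>\<^sub>0 'k) set ring" where
  "skew_polynomial_ring n p =
    free_algebra n Quot (Idl\<^bsub>free_algebra n\<^esub> (skew_relations n p))"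


section \<open>Rings\<close>

definition center :: "('a, 'm) ring_scheme \<Rightarrow> 'a set" where
  "center B = {z \<in> carrier B. \<forall>b \<in> carrier B. z \<otimes>\<^bsub>B\<^esub> b = b \<otimes>\<^bsub>B\<^esub> z}"

definition prime_ring :: "('a, 'm) ring_scheme \<Rightarrow> bool" where
  "prime_ring B \<longleftrightarrow> ring B \<and> \<one>\<^bsub>B\<^esub> \<noteq> \<zero>\<^bsub>B\<^esub> \<and>
    (\<forall>a \<in> carrier B. \<forall>b \<in> carrier B.
      (\<forall>x \<in> carrier B. a \<otimes>\<^bsub>B\<^esub> x \<otimes>\<^bsub>B\<^esub> b = \<zero>\<^bsub>B\<^esub>) \<longrightarrow> a = \<zero>\<^bsub>B\<^esub> \<or> b = \<zero>\<^bsub>B\<^esub>)"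

definition normal_element :: "('a, 'm) ring_scheme \<Rightarrow> 'a \<Rightarrow> bool" where
  "normal_element B d \<longleftrightarrow> d \<in> carrier B \<and> d <#\<^bsub>B\<^esub> carrier B = carrier B #>\<^bsub>B\<^esub> d"

definition determinant :: "('a, 'm) ring_scheme \<Rightarrow> nat \<Rightarrow> (nat \<Rightarrow> nat \<Rightarrow> 'a) \<Rightarrow> 'a" where
  "determinant R v M =
    (\<Oplus>\<^bsub>R\<^esub>\<sigma> \<in> {\<sigma>. \<sigma> permutes {1..v}}.
      if evenperm \<sigma> then (\<Otimes>\<^bsub>R\<^esub>i \<in> {1..v}. M i (\<sigma> i))
      else \<ominus>\<^bsub>R\<^esub> (\<Otimes>\<^bsub>R\<^esub>i \<in> {1..v}. M i (\<sigma> i)))"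


section \<open>The field of fractions of a domain\<close>

definition fracrel :: "('a, 'm) ring_scheme \<Rightarrow> (('a \<times> 'a) \<times> ('a \<times> 'a)) set" where
  "fracrel R = {((a, s), (b, t)).
    a \<in> carrier R \<and> b \<in> carrier R \<and> s \<in> carrier R - {\<zero>\<^bsub>R\<^esub>} \<and> t \<in> carrier R - {\<zero>\<^bsub>R\<^esub>} \<and>
    a \<otimes>\<^bsub>R\<^esub> t = b \<otimes>\<^bsub>R\<^esub> s}"

definition fraction_of :: "('a, 'm) ring_scheme \<Rightarrow> 'a \<Rightarrow> 'a \<Rightarrow> ('a \<times> 'a) set" where
  "fraction_of R a s = fracrel R `` {(a, s)}"

definition fraction_field :: "('a, 'm) ring_scheme \<Rightarrow> ('a \<times> 'a) set ring" where
  "fraction_field R =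
    \<lparr>carrier = (carrier R \<times> (carrier R - {\<zero>\<^bsub>R\<^esub>})) // fracrel R,
     mult = (\<lambda>X Y. \<Union>(a, s) \<in> X. \<Union>(b, t) \<in> Y. fraction_of R (a \<otimes>\<^bsub>R\<^esub> b) (s \<otimes>\<^bsub>R\<^esub> t)),
     one = fraction_of R \<one>\<^bsub>R\<^esub> \<one>\<^bsub>R\<^esub>,
     ring.zero = fraction_of R \<zero>\<^bsub>R\<^esub> \<one>\<^bsub>R\<^esub>,
     ring.add = (\<lambda>X Y. \<Union>(a, s) \<in> X. \<Union>(b, t) \<in> Y.
       fraction_of R (a \<otimes>\<^bsub>R\<^esub> t \<oplus>\<^bsub>R\<^esub> b \<otimes>\<^bsub>R\<^esub> s) (s \<otimes>\<^bsub>R\<^esub> t))\<rparr>"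

definition frac_embed :: "('a, 'm) ring_scheme \<Rightarrow> 'a \<Rightarrow> ('a \<times> 'a) set" where
  "frac_embed R r = fraction_of R r \<one>\<^bsub>R\<^esub>"


section \<open>Extension of scalars\<close>

text \<open>
  For a commutative ring \<open>F\<close> and a map \<open>\<iota> : R \<rightarrow> F\<close> from a central subring \<open>R\<close> of \<open>B\<close>, the
  \<open>F\<close>-algebra \<open>B \<otimes>\<^sub>R F\<close> is the free abelian group on the symbols \<open>(b, f)\<close> modulo the
  subgroup generated by the bilinearity and balancing relations.
\<close>

definition tensor_relations ::
    "('a, 'm) ring_scheme \<Rightarrow> 'a set \<Rightarrow> ('f, 'l) ring_scheme \<Rightarrow> ('a \<Rightarrow> 'f) \<Rightarrow> ('a \<times> 'f \<Rightarrow>\<^sub>0 int) set" where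
  "tensor_relations B R F \<iota> =
    {frag_of (b \<oplus>\<^bsub>B\<^esub> b', f) - frag_of (b, f) - frag_of (b', f) | b b' f.
      b \<in> carrier B \<and> b' \<in> carrier B \<and> f \<in> carrier F} \<union>
    {frag_of (b, f \<oplus>\<^bsub>F\<^esub> f') - frag_of (b, f) - frag_of (b, f') | b f f'.
      b \<in> carrier B \<and> f \<in> carrier F \<and> f' \<in> carrier F} \<union>
    {frag_of (r \<otimes>\<^bsub>B\<^esub> b, f) - frag_of (b, \<iota> r \<otimes>\<^bsub>F\<^esub> f) | r b f.
      r \<in> R \<and> b \<in> carrier B \<and> f \<in> carrier F}"

definition extension_of_scalars ::
    "('a, 'm) ring_scheme \<Rightarrow> 'a set \<Rightarrow> ('f, 'l) ring_scheme \<Rightarrow> ('a \<Rightarrow> 'f) \<Rightarrow>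
      ('f, ('a \<times> 'f \<Rightarrow>\<^sub>0 int) set) module" where
  "extension_of_scalars B R F \<iota> =
    (let G = free_Abelian_group (carrier B \<times> carrier F);
         N = generate G (tensor_relations B R F \<iota>)
     in \<lparr>carrier = carrier (G Mod N),
         mult = (\<lambda>X Y. \<Union>u \<in> X. \<Union>v \<in> Y. N #>\<^bsub>G\<^esub>
           frag_extend (\<lambda>(b, f). frag_extend (\<lambda>(b', f'). frag_of (b \<otimes>\<^bsub>B\<^esub> b', f \<otimes>\<^bsub>F\<^esub> f')) v) u),
         one = N #>\<^bsub>G\<^esub> frag_of (\<one>\<^bsub>B\<^esub>, \<one>\<^bsub>F\<^esub>),
         ring.zero = \<one>\<^bsub>G Mod N\<^esub>,
         ring.add = (\<lambda>X Y. X \<otimes>\<^bsub>G Mod N\<^esub> Y),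
         smult = (\<lambda>c X. \<Union>u \<in> X. N #>\<^bsub>G\<^esub> frag_extend (\<lambda>(b, f). frag_of (b, c \<otimes>\<^bsub>F\<^esub> f)) u)\<rparr>)"

definition pure_tensor ::
    "('a, 'm) ring_scheme \<Rightarrow> 'a set \<Rightarrow> ('f, 'l) ring_scheme \<Rightarrow> ('a \<Rightarrow> 'f) \<Rightarrow> 'a \<Rightarrow> 'f \<Rightarrow>
      ('a \<times> 'f \<Rightarrow>\<^sub>0 int) set" where
  "pure_tensor B R F \<iota> b f =
    (let G = free_Abelian_group (carrier B \<times> carrier F)
     in generate G (tensor_relations B R F \<iota>) #>\<^bsub>G\<^esub> frag_of (b, f))"


section \<open>The regular trace and discriminant ideals\<close>

text \<open>
  \<open>C e\<close> lists the coordinates of \<open>T e\<close> in the basis \<open>S\<close>; the trace does not depend on \<open>S\<close>.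
\<close>

definition linear_trace :: "('k, 'l) ring_scheme \<Rightarrow> ('k, 'v, 'm) module_scheme \<Rightarrow> ('v \<Rightarrow> 'v) \<Rightarrow> 'k" where
  "linear_trace K V T =
    (THE t. \<exists>S C. finite S \<and> vectorspace.basis K V S \<and>
      (\<forall>e \<in> S. C e \<in> S \<rightarrow> carrier K \<and> T e = module.lincomb V (C e) S) \<and>
      t = (\<Oplus>\<^bsub>K\<^esub>e \<in> S. C e e))"

text \<open>
  Below \<open>R\<close> is the carrier of a central subring of the ring \<open>B\<close>, and \<open>B\<lparr>carrier := R\<rparr>\<close> is that
  subring.
\<close>

definition generic_algebra ::
    "('a, 'm) ring_scheme \<Rightarrow> 'a set \<Rightarrow> (('a \<times> 'a) set, ('a \<times> ('a \<times> 'a) set \<Rightarrow>\<^sub>0 int) set) module" where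
  "generic_algebra B R =
    extension_of_scalars B R (fraction_field (B\<lparr>carrier := R\<rparr>)) (frac_embed (B\<lparr>carrier := R\<rparr>))"

definition rank_over :: "('a, 'm) ring_scheme \<Rightarrow> 'a set \<Rightarrow> nat" where
  "rank_over B R = vectorspace.dim (fraction_field (B\<lparr>carrier := R\<rparr>)) (generic_algebra B R)"

definition regular_trace :: "('a, 'm) ring_scheme \<Rightarrow> 'a set \<Rightarrow> 'a \<Rightarrow> ('a \<times> 'a) set" where
  "regular_trace B R b =
    (let F = fraction_field (B\<lparr>carrier := R\<rparr>);
         b\<^sub>F = pure_tensor B R F (frac_embed (B\<lparr>carrier := R\<rparr>)) b \<one>\<^bsub>F\<^esub>
     in linear_trace F (generic_algebra B R) (\<lambda>X. b\<^sub>F \<otimes>\<^bsub>generic_algebra B R\<^esub> X))"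

text \<open>
  The regular trace with values in \<open>R\<close>, meaningful when \<^const>\<open>regular_trace\<close> takes values in the
  image of \<open>R\<close> in its field of fractions.
\<close>

definition regular_trace_in :: "('a, 'm) ring_scheme \<Rightarrow> 'a set \<Rightarrow> 'a \<Rightarrow> 'a" where
  "regular_trace_in B R b =
    (THE r. r \<in> R \<and> frac_embed (B\<lparr>carrier := R\<rparr>) r = regular_trace B R b)"

text \<open>The \<open>v\<close>-element subsets of \<open>B\<close> are enumerated by injections on \<open>{1..v}\<close>.\<close>

definition MDv :: "nat \<Rightarrow> ('a, 'm) ring_scheme \<Rightarrow> 'a set \<Rightarrow> 'a set" where
  "MDv v B R = Idl\<^bsub>B\<lparr>carrier := R\<rparr>\<^esub>
    {determinant (B\<lparr>carrier := R\<rparr>) v (\<lambda>i j. regular_trace_in B R (u i \<otimes>\<^bsub>B\<^esub> u' j)) | u u'.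
      u \<in> {1..v} \<rightarrow> carrier B \<and> inj_on u {1..v} \<and> u' \<in> {1..v} \<rightarrow> carrier B \<and> inj_on u' {1..v}}"

definition MD :: "('a, 'm) ring_scheme \<Rightarrow> 'a set \<Rightarrow> 'a set" where
  "MD B R = MDv (rank_over B R) B R"


section \<open>Duals and reflexive hulls\<close>

definition as_module :: "('a, 'm) ring_scheme \<Rightarrow> 'a set \<Rightarrow> ('a, 'a) module" where
  "as_module B M =
    \<lparr>carrier = M, mult = monoid.mult B, one = \<one>\<^bsub>B\<^esub>,
     ring.zero = \<zero>\<^bsub>B\<^esub>, ring.add = ring.add B, smult = monoid.mult B\<rparr>"

text \<open>
  Homomorphisms are taken to be extensional, so that equal elements of the dual are equal as HOL
  functions. The ring multiplication and unit of the module record play no role.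
\<close>

definition dual_module ::
    "('a, 'l) ring_scheme \<Rightarrow> ('a, 'v, 'm) module_scheme \<Rightarrow> ('a, 'v \<Rightarrow> 'a) module" where
  "dual_module R M =
    \<lparr>carrier = module_hom R M (as_module R (carrier R)) \<inter> extensional (carrier M),
     mult = undefined, one = undefined,
     ring.zero = (\<lambda>x \<in> carrier M. \<zero>\<^bsub>R\<^esub>),
     ring.add = (\<lambda>\<phi> \<psi>. \<lambda>x \<in> carrier M. \<phi> x \<oplus>\<^bsub>R\<^esub> \<psi> x),
     smult = (\<lambda>r \<phi>. \<lambda>x \<in> carrier M. r \<otimes>\<^bsub>R\<^esub> \<phi> x)\<rparr>"

abbreviation bidual_module ::
    "('a, 'l) ring_scheme \<Rightarrow> ('a, 'v, 'm) module_scheme \<Rightarrow> ('a, ('v \<Rightarrow> 'a) \<Rightarrow> 'a) module" where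
  "bidual_module R M \<equiv> dual_module R (dual_module R M)"

definition bidual_map ::
    "('a, 'l) ring_scheme \<Rightarrow> ('a, 'v, 'm) module_scheme \<Rightarrow> 'v \<Rightarrow> ('v \<Rightarrow> 'a) \<Rightarrow> 'a" where
  "bidual_map R M x = (\<lambda>\<phi> \<in> carrier (dual_module R M). \<phi> x)"

definition reflexive_module :: "('a, 'l) ring_scheme \<Rightarrow> ('a, 'v, 'm) module_scheme \<Rightarrow> bool" where
  "reflexive_module R M \<longleftrightarrow>
    bij_betw (bidual_map R M) (carrier M) (carrier (bidual_module R M))"

text \<open>
  For \<open>M \<subseteq> B\<close>, the inclusion induces a map from the bidual of \<open>M\<close> to the bidual of \<open>B\<close>, and
  the hull of \<open>M\<close> in \<open>B\<close> is the preimage of its image under \<open>B \<rightarrow> B\<^sup>\<or>\<^sup>\<or>\<close>.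
\<close>

definition bidual_inclusion ::
    "('a, 'm) ring_scheme \<Rightarrow> 'a set \<Rightarrow> 'a set \<Rightarrow> (('a \<Rightarrow> 'a) \<Rightarrow> 'a) \<Rightarrow> ('a \<Rightarrow> 'a) \<Rightarrow> 'a" where
  "bidual_inclusion B R M \<Phi> =
    (\<lambda>\<phi> \<in> carrier (dual_module (B\<lparr>carrier := R\<rparr>) (as_module B (carrier B))). \<Phi> (restrict \<phi> M))"

definition reflexive_hull :: "('a, 'm) ring_scheme \<Rightarrow> 'a set \<Rightarrow> 'a set \<Rightarrow> 'a set" where
  "reflexive_hull B R M =
    {b \<in> carrier B. bidual_map (B\<lparr>carrier := R\<rparr>) (as_module B (carrier B)) b \<in>
      bidual_inclusion B R M ` carrier (bidual_module (B\<lparr>carrier := R\<rparr>) (as_module B M))}"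


section \<open>Extended reflexive hull discriminants\<close>

text \<open>The standing hypotheses under which the discriminants of \<open>B\<close> over \<open>R\<close> are considered.\<close>

definition discriminant_setting :: "('a, 'm) ring_scheme \<Rightarrow> 'a set \<Rightarrow> bool" where
  "discriminant_setting B R \<longleftrightarrow>
    prime_ring B \<and> subring R B \<and> R \<subseteq> center B \<and> domain (B\<lparr>carrier := R\<rparr>) \<and>
    (\<exists>S. finite S \<and> S \<subseteq> carrier B \<and>
      module.span (B\<lparr>carrier := R\<rparr>) (as_module B (carrier B)) S = carrier B) \<and>
    (\<forall>b \<in> carrier B. regular_trace B R b \<in> frac_embed (B\<lparr>carrier := R\<rparr>) ` R)"

text \<open>\<open>ideal_prod B (MD B R) (carrier B)\<close> is the set of finite sums of products, i.e.
  \<open>MD(B/R) B\<close>.\<close>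

definition ext_reflexive_hull_discriminant :: "('a, 'm) ring_scheme \<Rightarrow> 'a set \<Rightarrow> 'a \<Rightarrow> bool" where
  "ext_reflexive_hull_discriminant B R d \<longleftrightarrow>
    discriminant_setting B R \<and>
    reflexive_module (B\<lparr>carrier := R\<rparr>) (as_module B (carrier B)) \<and>
    normal_element B d \<and>
    reflexive_hull B R (ideal_prod B (MD B R) (carrier B)) = d <#\<^bsub>B\<^esub> carrier B"

end

theory Submission
  imports Defs
begin

text \<open>
  Let \<open>L\<close> be the lattice of exponents of the central Laurent monomials. Since the \<open>p\<^sub>i\<^sub>j\<close> are
  roots of unity, \<open>L\<close> has finite index \<open>w\<close> in \<open>\<int>\<^sup>n\<close>, the center \<open>Z\<close> is spanned by the monomials
  with exponent in \<open>L\<close>, and representatives of the cosets of \<open>L\<close> form a basis over the fraction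
  field of \<open>Z\<close>; hence the regular trace is \<open>w\<close> times the projection to \<open>Z\<close>. In the determinants
  defining \<open>MD\<close> one may expand the rows into components homogeneous for the grading by \<open>\<int>\<^sup>n / L\<close>.
  Two rows of equal degree make the determinant vanish, so only rows of pairwise distinct degrees
  contribute, and then the order in \<open>x\<^sub>k\<close> is at least the sum over all cosets \<open>g\<close> of the least
  order \<open>mu k g\<close> of a product pairing a monomial of class \<open>g\<close> with one of class \<open>-g\<close>. Monomials
  show that this bound is attained for every single \<open>k\<close>. If \<open>d\<close> is the monomial whose exponents
  are these bounds, then \<open>MD A\<close> is contained in \<open>dA\<close> and agrees with it in codimension one. As \<open>A\<close>
  is reflexive, the hull is \<open>dA\<close>. If \<open>w = 0\<close> in the field, the trace vanishes and \<open>d = 0\<close>.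
\<close>

section \<open>The field of fractions\<close>

text \<open>The ring need not be free over its center, so bases exist in general only over the
  fraction field. The substitute is a finite family with functionals dual to it up to one central
  factor \<open>z\<close>. It yields coordinates on the tensor product, hence rank and trace, and it
  reduces reflexivity to a question of divisibility by \<open>z\<close>. A coset of the lattice need
  not contain a polynomial exponent that is least in all variables at once. Therefore
  \<open>mu\<close>, the functionals that prove reflexivity and the elements exhibited in the
  discriminant ideal are all chosen for one variable at a time. The monomials found for the separate
  variables may generate less than \<open>dA\<close>, and the hull closes this gap: an element of
  \<open>dA\<close> times a monomial free of \<open>x_k\<close> lies in the submodule, so the value
  that a functional should take on the element is a fraction whose denominator avoids
  \<open>x_k\<close>; this holds for every \<open>k\<close>, hence the denominator is trivial.
  Exponents are integers throughout, which makes monomials invertible and turns polynomiality into a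
  condition on the support.\<close>

lemma UN2_constant:
  assumes "(a, s) \<in> X" "(b, t) \<in> Y"
    and "\<And>a s b t. (a, s) \<in> X \<Longrightarrow> (b, t) \<in> Y \<Longrightarrow> f a s b t = c"
  shows "(\<Union>(a, s) \<in> X. \<Union>(b, t) \<in> Y. f a s b t) = c"
proof -
  have "(\<Union>(a, s) \<in> X. \<Union>(b, t) \<in> Y. f a s b t) = (\<Union>(a, s) \<in> X. \<Union>(b, t) \<in> Y. c)"
    using assms(3) by (intro SUP_cong refl) auto
  also have "\<dots> = c"
    using assms(1,2) by auto
  finally show ?thesis .
qed

context domain
begin

lemma equiv_fracrel: "equiv (carrier R \<times> (carrier R - {\<zero>})) (fracrel R)"
proof (rule equivI)
  show "fracrel R \<subseteq> (carrier R \<times> (carrier R - {\<zero>})) \<times> (carrier R \<times> (carrier R - {\<zero>}))"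
    by (auto simp: fracrel_def)
  show "refl_on (carrier R \<times> (carrier R - {\<zero>})) (fracrel R)"
    by (auto simp: refl_on_def fracrel_def)
  show "sym (fracrel R)"
    by (auto simp: sym_def fracrel_def)
  show "trans (fracrel R)"
  proof (rule transI)
    fix x y z assume "(x, y) \<in> fracrel R" "(y, z) \<in> fracrel R"
    then obtain a s b t c u where [simp]: "x = (a, s)" "y = (b, t)" "z = (c, u)"
      and c: "a \<in> carrier R" "b \<in> carrier R" "c \<in> carrier R" "s \<in> carrier R" "t \<in> carrier R"
          "u \<in> carrier R"
      and nz: "s \<noteq> \<zero>" "t \<noteq> \<zero>" "u \<noteq> \<zero>" and eq: "a \<otimes> t = b \<otimes> s" "b \<otimes> u = c \<otimes> t"
      by (auto simp: fracrel_def)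
    \<comment> \<open>The middle denominator \<open>t\<close> is cancelled at the end; here the
      absence of zero divisors enters.\<close>
    have "t \<otimes> (a \<otimes> u) = (a \<otimes> t) \<otimes> u" using c by (simp add: m_ac)
    also have "\<dots> = s \<otimes> (b \<otimes> u)" using c by (simp add: eq(1) m_ac)
    also have "\<dots> = t \<otimes> (c \<otimes> s)" using c by (simp add: eq(2) m_ac)
    finally have "a \<otimes> u = c \<otimes> s" using c nz by (simp add: m_lcancel)
    then show "(x, z) \<in> fracrel R" using c nz by (auto simp: fracrel_def)
  qed
qed

lemma fraction_of_eq_iff:
  assumes "a \<in> carrier R" "b \<in> carrier R" "s \<in> carrier R - {\<zero>}" "t \<in> carrier R - {\<zero>}"
  shows "fraction_of R a s = fraction_of R b t \<longleftrightarrow> a \<otimes> t = b \<otimes> s"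
  unfolding fraction_of_def
  using assms by (subst eq_equiv_class_iff [OF equiv_fracrel]) (auto simp: fracrel_def)

lemma fraction_of_in_carrier:
  assumes "a \<in> carrier R" "s \<in> carrier R - {\<zero>}"
  shows "fraction_of R a s \<in> carrier (fraction_field R)"
  using assms by (auto simp: fraction_field_def fraction_of_def intro!: quotientI)

lemma fraction_fieldE:
  assumes "X \<in> carrier (fraction_field R)"
  obtains a s where "a \<in> carrier R" "s \<in> carrier R - {\<zero>}" "X = fraction_of R a s"
  using assms by (auto simp: fraction_field_def fraction_of_def elim!: quotientE)

lemma in_fraction_of_iff:
  assumes "a \<in> carrier R" "s \<in> carrier R - {\<zero>}"
  shows "(b, t) \<in> fraction_of R a s \<longleftrightarrow>
    b \<in> carrier R \<and> t \<in> carrier R - {\<zero>} \<and> a \<otimes> t = b \<otimes> s"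
  using assms by (auto simp: fraction_of_def fracrel_def)

text \<open>The product of classes is a union over all pairs of representatives. Since the resulting
  fraction does not depend on the pair, the union collapses to a single class.\<close>

lemma fraction_of_mult:
  assumes c: "a \<in> carrier R" "b \<in> carrier R" "s \<in> carrier R - {\<zero>}" "t \<in> carrier R - {\<zero>}"
  shows "fraction_of R a s \<otimes>\<^bsub>fraction_field R\<^esub> fraction_of R b t = fraction_of R (a \<otimes> b) (s \<otimes> t)"
proof -
  have nz: "s \<otimes> t \<in> carrier R - {\<zero>}" using c integral_iff by auto
  have key: "fraction_of R (a' \<otimes> b') (s' \<otimes> t') = fraction_of R (a \<otimes> b) (s \<otimes> t)"
    if "(a', s') \<in> fraction_of R a s" "(b', t') \<in> fraction_of R b t" for a' s' b' t'
  proof -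
    have c': "a' \<in> carrier R" "b' \<in> carrier R" "s' \<in> carrier R - {\<zero>}" "t' \<in> carrier R - {\<zero>}"
      and e: "a \<otimes> s' = a' \<otimes> s" "b \<otimes> t' = b' \<otimes> t"
      using that c by (auto simp: in_fraction_of_iff)
    have "(a' \<otimes> b') \<otimes> (s \<otimes> t) = (a' \<otimes> s) \<otimes> (b' \<otimes> t)" using c c' by (simp add: m_ac)
    also have "\<dots> = (a \<otimes> b) \<otimes> (s' \<otimes> t')" using c c' by (simp add: e [symmetric] m_ac)
    finally show ?thesis using c c' nz integral_iff by (subst fraction_of_eq_iff) auto
  qed
  have mem: "(a, s) \<in> fraction_of R a s" "(b, t) \<in> fraction_of R b t"
    using c by (auto simp: in_fraction_of_iff)
  have "(\<Union>(a', s') \<in> fraction_of R a s. \<Union>(b', t') \<in> fraction_of R b t. fraction_of R (a' \<otimes> b') (s' \<otimes>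
      t')) = fraction_of R (a \<otimes> b) (s \<otimes> t)"
    by (rule UN2_constant [OF mem key])
  then show ?thesis by (simp add: fraction_field_def)
qed

lemma fraction_of_add:
  assumes c: "a \<in> carrier R" "b \<in> carrier R" "s \<in> carrier R - {\<zero>}" "t \<in> carrier R - {\<zero>}"
  shows "fraction_of R a s \<oplus>\<^bsub>fraction_field R\<^esub> fraction_of R b t =
    fraction_of R (a \<otimes> t \<oplus> b \<otimes> s) (s \<otimes> t)"
proof -
  have nz: "s \<otimes> t \<in> carrier R - {\<zero>}" using c integral_iff by auto
  have key: "fraction_of R (a' \<otimes> t' \<oplus> b' \<otimes> s') (s' \<otimes> t') = fraction_of R (a \<otimes> t \<oplus> b \<otimes> s) (s \<otimes> t)"
    if "(a', s') \<in> fraction_of R a s" "(b', t') \<in> fraction_of R b t" for a' s' b' t'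
  proof -
    have c': "a' \<in> carrier R" "b' \<in> carrier R" "s' \<in> carrier R - {\<zero>}" "t' \<in> carrier R - {\<zero>}"
      and e: "a \<otimes> s' = a' \<otimes> s" "b \<otimes> t' = b' \<otimes> t"
      using that c by (auto simp: in_fraction_of_iff)
    have "(a' \<otimes> t' \<oplus> b' \<otimes> s') \<otimes> (s \<otimes> t) = (a' \<otimes> s) \<otimes> (t \<otimes> t') \<oplus> (b' \<otimes> t) \<otimes> (s \<otimes> s')"
      using c c' by (simp add: m_ac l_distr r_distr)
    also have "\<dots> = (a \<otimes> t \<oplus> b \<otimes> s) \<otimes> (s' \<otimes> t')"
      using c c' by (simp add: e [symmetric] m_ac l_distr r_distr)
    finally show ?thesis using c c' nz integral_iff by (subst fraction_of_eq_iff) auto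
  qed
  have mem: "(a, s) \<in> fraction_of R a s" "(b, t) \<in> fraction_of R b t"
    using c by (auto simp: in_fraction_of_iff)
  have "(\<Union>(a', s') \<in> fraction_of R a s. \<Union>(b', t') \<in> fraction_of R b t. fraction_of R (a' \<otimes> t' \<oplus> b' \<otimes>
      s') (s' \<otimes> t')) = fraction_of R (a \<otimes> t \<oplus> b \<otimes> s) (s \<otimes> t)"
    by (rule UN2_constant [OF mem key])
  then show ?thesis by (simp add: fraction_field_def)
qed

lemma fraction_field_zero: "\<zero>\<^bsub>fraction_field R\<^esub> = fraction_of R \<zero> \<one>"
  and fraction_field_one: "\<one>\<^bsub>fraction_field R\<^esub> = fraction_of R \<one> \<one>"
  by (simp_all add: fraction_field_def)

lemma one_nonzero: "\<one> \<in> carrier R - {\<zero>}"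
  by simp

lemma mult_nonzero:
  "\<lbrakk>s \<in> carrier R - {\<zero>}; t \<in> carrier R - {\<zero>}\<rbrakk> \<Longrightarrow> s \<otimes> t \<in> carrier R - {\<zero>}"
  using integral_iff by auto

lemma field_fraction_field: "field (fraction_field R)"
proof -
  let ?F = "fraction_field R"
  note fr = fraction_of_mult fraction_of_add fraction_of_in_carrier fraction_field_zero
    fraction_field_one
  have cr: "cring ?F"
  proof (intro cringI abelian_groupI comm_monoidI)
    fix x y z assume xyz: "x \<in> carrier ?F" "y \<in> carrier ?F" "z \<in> carrier ?F"
    obtain a s where [simp]: "x = fraction_of R a s" and 1: "a \<in> carrier R" "s \<in> carrier R - {\<zero>}"
      using xyz(1) by (elim fraction_fieldE)
    obtain b t where [simp]: "y = fraction_of R b t" and 2: "b \<in> carrier R" "t \<in> carrier R - {\<zero>}"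
      using xyz(2) by (elim fraction_fieldE)
    obtain c u where [simp]: "z = fraction_of R c u" and 3: "c \<in> carrier R" "u \<in> carrier R - {\<zero>}"
      using xyz(3) by (elim fraction_fieldE)
    note nz = mult_nonzero [OF 1(2) 2(2)] mult_nonzero [OF 2(2) 3(2)] mult_nonzero [OF 1(2) 3(2)]
    note nz3 = mult_nonzero [OF 1(2) nz(2)] mult_nonzero [OF nz(1) 3(2)]
      mult_nonzero [OF nz(3) nz(2)] mult_nonzero [OF nz(1) 1(2)]
    have c: "a \<in> carrier R" "b \<in> carrier R" "c \<in> carrier R" "s \<in> carrier R" "t \<in> carrier R"
      "u \<in> carrier R"
      using 1 2 3 by auto
    show "x \<oplus>\<^bsub>?F\<^esub> y \<in> carrier ?F" "x \<otimes>\<^bsub>?F\<^esub> y \<in> carrier ?F"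
      using 1 2 nz by (simp_all add: fr)
    show "x \<oplus>\<^bsub>?F\<^esub> y \<oplus>\<^bsub>?F\<^esub> z = x \<oplus>\<^bsub>?F\<^esub> (y \<oplus>\<^bsub>?F\<^esub> z)"
      using 1 2 3 nz nz3 by (simp add: fr fraction_of_eq_iff m_ac l_distr r_distr a_ac)
    show "x \<oplus>\<^bsub>?F\<^esub> y = y \<oplus>\<^bsub>?F\<^esub> x"
      using 1 2 nz by (simp add: fr m_ac a_ac)
    show "x \<otimes>\<^bsub>?F\<^esub> y \<otimes>\<^bsub>?F\<^esub> z = x \<otimes>\<^bsub>?F\<^esub> (y \<otimes>\<^bsub>?F\<^esub> z)"
      using 1 2 3 nz by (simp add: fr m_ac)
    show "x \<otimes>\<^bsub>?F\<^esub> y = y \<otimes>\<^bsub>?F\<^esub> x"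
      using 1 2 nz by (simp add: fr m_ac)
    show "(x \<oplus>\<^bsub>?F\<^esub> y) \<otimes>\<^bsub>?F\<^esub> z = x \<otimes>\<^bsub>?F\<^esub> z \<oplus>\<^bsub>?F\<^esub> y \<otimes>\<^bsub>?F\<^esub> z"
      using c 1 2 3 nz nz3 mult_nonzero [OF nz(1) 3(2)] mult_nonzero [OF nz(3) nz(2)]
      by (simp add: fr fraction_of_eq_iff m_ac l_distr r_distr a_ac)
    show "\<zero>\<^bsub>?F\<^esub> \<oplus>\<^bsub>?F\<^esub> x = x" "\<one>\<^bsub>?F\<^esub> \<otimes>\<^bsub>?F\<^esub> x = x"
      using 1 by (simp_all add: fr)
    have "(\<ominus> a \<otimes> s \<oplus> a \<otimes> s) = \<zero>" using c by (simp add: l_minus l_neg)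
    then have "fraction_of R (\<ominus> a) s \<oplus>\<^bsub>?F\<^esub> x = \<zero>\<^bsub>?F\<^esub>"
      using 1 mult_nonzero [OF 1(2) 1(2)] by (simp add: fr fraction_of_eq_iff)
    then show "\<exists>y\<in>carrier ?F. y \<oplus>\<^bsub>?F\<^esub> x = \<zero>\<^bsub>?F\<^esub>"
      using 1 by (intro bexI [of _ "fraction_of R (\<ominus> a) s"]) (simp_all add: fr)
  qed (simp_all add: fr)
  interpret F: cring ?F by (rule cr)
  show ?thesis
  proof (rule F.cring_fieldI2)
    show "\<zero>\<^bsub>?F\<^esub> \<noteq> \<one>\<^bsub>?F\<^esub>"
      by (simp add: fr fraction_of_eq_iff)
    fix x assume x: "x \<in> carrier ?F" "x \<noteq> \<zero>\<^bsub>?F\<^esub>"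
    obtain a s where [simp]: "x = fraction_of R a s" and 1: "a \<in> carrier R" "s \<in> carrier R - {\<zero>}"
      using x(1) by (elim fraction_fieldE)
    have a: "a \<in> carrier R - {\<zero>}"
      using x(2) 1 by (auto simp: fr fraction_of_eq_iff)
    have "x \<otimes>\<^bsub>?F\<^esub> fraction_of R s a = \<one>\<^bsub>?F\<^esub>"
      using 1 a mult_nonzero [OF 1(2) a] by (simp add: fr fraction_of_eq_iff m_ac)
    then show "\<exists>b\<in>carrier ?F. x \<otimes>\<^bsub>?F\<^esub> b = \<one>\<^bsub>?F\<^esub>"
      using 1 a by (intro bexI [of _ "fraction_of R s a"]) (simp_all add: fr)
  qed
qed

lemma frac_embed_closed: "a \<in> carrier R \<Longrightarrow> frac_embed R a \<in> carrier (fraction_field R)"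
  by (simp add: frac_embed_def fraction_of_in_carrier)

lemma frac_embed_eq_iff:
  "\<lbrakk>a \<in> carrier R; b \<in> carrier R\<rbrakk> \<Longrightarrow> frac_embed R a = frac_embed R b \<longleftrightarrow> a = b"
  by (simp add: frac_embed_def fraction_of_eq_iff)

end

section \<open>Vector spaces with coordinates\<close>

text \<open>No module axioms are assumed for \<open>E\<close>. The coordinates \<open>P i\<close>
  are linear and jointly injective, so every axiom is inherited from \<open>F\<close>; this spares a
  direct verification in a quotient of a free abelian group.\<close>

locale coordinate_space = F: field F
  for F :: "('f, 'l) ring_scheme" and E :: "('f, 'e, 'm) module_scheme"
    and I :: "'i set" and P :: "'i \<Rightarrow> 'e \<Rightarrow> 'f" and \<epsilon> :: "'i \<Rightarrow> 'e" +
  assumes finite_I: "finite I"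
    and P_closed: "\<And>i X. i \<in> I \<Longrightarrow> X \<in> carrier E \<Longrightarrow> P i X \<in> carrier F"
    and P_inj: "\<And>X Y. X \<in> carrier E \<Longrightarrow> Y \<in> carrier E \<Longrightarrow> (\<And>i. i \<in> I \<Longrightarrow> P i X = P i Y) \<Longrightarrow> X = Y"
    and add_closed: "\<And>X Y. X \<in> carrier E \<Longrightarrow> Y \<in> carrier E \<Longrightarrow> X \<oplus>\<^bsub>E\<^esub> Y \<in> carrier E"
    and zero_closed: "\<zero>\<^bsub>E\<^esub> \<in> carrier E"
    and smult_closed: "\<And>c X. c \<in> carrier F \<Longrightarrow> X \<in> carrier E \<Longrightarrow> c \<odot>\<^bsub>E\<^esub> X \<in> carrier E"
    and P_add: "\<And>i X Y. i \<in> I \<Longrightarrow> X \<in> carrier E \<Longrightarrow> Y \<in> carrier E \<Longrightarrow>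
      P i (X \<oplus>\<^bsub>E\<^esub> Y) = P i X \<oplus>\<^bsub>F\<^esub> P i Y"
    and P_zero: "\<And>i. i \<in> I \<Longrightarrow> P i \<zero>\<^bsub>E\<^esub> = \<zero>\<^bsub>F\<^esub>"
    and P_smult: "\<And>i c X. i \<in> I \<Longrightarrow> c \<in> carrier F \<Longrightarrow> X \<in> carrier E \<Longrightarrow>
      P i (c \<odot>\<^bsub>E\<^esub> X) = c \<otimes>\<^bsub>F\<^esub> P i X"
    and eps_closed: "\<And>i. i \<in> I \<Longrightarrow> \<epsilon> i \<in> carrier E"
    and P_eps: "\<And>i j. i \<in> I \<Longrightarrow> j \<in> I \<Longrightarrow> P i (\<epsilon> j) = (if i = j then \<one>\<^bsub>F\<^esub> else \<zero>\<^bsub>F\<^esub>)"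
begin

lemma abelian_group_E: "abelian_group E"
proof (intro abelian_groupI)
  fix X assume X: "X \<in> carrier E"
  have m: "\<ominus>\<^bsub>F\<^esub> \<one>\<^bsub>F\<^esub> \<in> carrier F" by simp
  have "(\<ominus>\<^bsub>F\<^esub> \<one>\<^bsub>F\<^esub> \<odot>\<^bsub>E\<^esub> X) \<oplus>\<^bsub>E\<^esub> X = \<zero>\<^bsub>E\<^esub>"
    using X m smult_closed by (intro P_inj) 
      (simp_all add: P_closed P_add P_zero P_smult add_closed zero_closed F.l_minus F.l_neg)
  then show "\<exists>Y\<in>carrier E. Y \<oplus>\<^bsub>E\<^esub> X = \<zero>\<^bsub>E\<^esub>"
    using smult_closed [OF m X] by blast
qed (auto intro!: P_inj simp: add_closed zero_closed P_add P_zero P_closed F.a_ac)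

lemma module_E: "Module.module F E"
  by (intro moduleI abelian_group_E F.is_cring)
    (auto intro!: P_inj simp: add_closed zero_closed smult_closed P_add P_smult P_closed
      F.l_distr F.r_distr F.m_assoc)

lemma vectorspace_E: "vectorspace F E"
  by (simp add: vectorspace_def module_E F.field_axioms)

sublocale vectorspace F E
  by (rule vectorspace_E)

lemma P_finsum:
  assumes "i \<in> I" "finite A" "\<And>a. a \<in> A \<Longrightarrow> f a \<in> carrier E"
  shows "P i (\<Oplus>\<^bsub>E\<^esub>a\<in>A. f a) = (\<Oplus>\<^bsub>F\<^esub>a\<in>A. P i (f a))"
  using assms(2,3)
proof (induction A)
  case empty
  then show ?case using assms(1) by (simp add: P_zero)
next
  case (insert x A)
  then show ?case using assms(1) 
    by (subst M.finsum_insert; (subst F.finsum_insert)?) 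
      (auto simp: P_add P_closed intro!: M.finsum_closed)
qed

lemma P_lincomb:
  assumes "i \<in> I" "finite A" "A \<subseteq> carrier E" "\<And>v. v \<in> A \<Longrightarrow> a v \<in> carrier F"
  shows "P i (lincomb a A) = (\<Oplus>\<^bsub>F\<^esub>v\<in>A. a v \<otimes>\<^bsub>F\<^esub> P i v)"
proof -
  have "P i (lincomb a A) = (\<Oplus>\<^bsub>F\<^esub>v\<in>A. P i (a v \<odot>\<^bsub>E\<^esub> v))"
    unfolding lincomb_def using assms by (intro P_finsum) (auto intro!: smult_closed)
  also have "\<dots> = (\<Oplus>\<^bsub>F\<^esub>v\<in>A. a v \<otimes>\<^bsub>F\<^esub> P i v)"
    using assms by (intro F.finsum_cong') (auto simp: P_smult P_closed subset_iff)
  finally show ?thesis .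
qed

lemma inj_eps: "inj_on \<epsilon> I"
  using P_eps by (auto simp: inj_on_def) (metis F.zero_not_one)

lemma P_lincomb_eps:
  assumes "i \<in> I" "\<And>v. v \<in> \<epsilon> ` I \<Longrightarrow> a v \<in> carrier F"
  shows "P i (lincomb a (\<epsilon> ` I)) = a (\<epsilon> i)"
proof -
  have "P i (lincomb a (\<epsilon> ` I)) = (\<Oplus>\<^bsub>F\<^esub>v\<in>\<epsilon> ` I. a v \<otimes>\<^bsub>F\<^esub> P i v)"
    using assms finite_I eps_closed by (intro P_lincomb) auto
  also have "\<dots> = (\<Oplus>\<^bsub>F\<^esub>j\<in>I. a (\<epsilon> j) \<otimes>\<^bsub>F\<^esub> P i (\<epsilon> j))"
    using assms eps_closed P_closed by (intro F.finsum_reindex inj_eps) auto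
  also have "\<dots> = (\<Oplus>\<^bsub>F\<^esub>j\<in>I. if i = j then a (\<epsilon> j) else \<zero>\<^bsub>F\<^esub>)"
    using assms by (intro F.finsum_cong') (auto simp: P_eps)
  also have "\<dots> = a (\<epsilon> i)"
    using assms finite_I by (intro F.finsum_singleton) auto
  finally show ?thesis .
qed

lemma basis_eps: "basis (\<epsilon> ` I)"
proof (subst basis_criterion)
  show "finite (\<epsilon> ` I)" "\<epsilon> ` I \<subseteq> carrier E"
    using finite_I eps_closed by auto
  show "\<forall>v. v \<in> carrier E \<longrightarrow> (\<exists>!a. a \<in> \<epsilon> ` I \<rightarrow>\<^sub>E carrier F \<and> lincomb a (\<epsilon> ` I) = v)"
  proof (intro allI impI ex1I conjI)
    fix v assume v: "v \<in> carrier E"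
    \<comment> \<open>The coefficient of the basis vector \<open>\<epsilon> i\<close> is forced to
      be \<open>P i v\<close>; injectivity of \<open>\<epsilon>\<close> recovers the index from the
      vector.\<close>
    let ?a = "\<lambda>x \<in> \<epsilon> ` I. P (the_inv_into I \<epsilon> x) v"
    have a: "?a (\<epsilon> i) = P i v" if "i \<in> I" for i
      using that by (simp add: the_inv_into_f_f [OF inj_eps])
    have a': "?a x \<in> carrier F" if "x \<in> \<epsilon> ` I" for x
      using that a v P_closed by fastforce
    show "?a \<in> \<epsilon> ` I \<rightarrow>\<^sub>E carrier F"
      using a' by auto
    show "lincomb ?a (\<epsilon> ` I) = v"
      using a a' v eps_closed finite_I
      by (intro P_inj lincomb_closed) (auto simp: P_lincomb_eps simp del: restrict_apply)
    fix b assume b: "b \<in> \<epsilon> ` I \<rightarrow>\<^sub>E carrier F \<and> lincomb b (\<epsilon> ` I) = v"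
    have "b x = ?a x" if "x \<in> \<epsilon> ` I" for x
    proof -
      from that obtain i where i: "i \<in> I" "x = \<epsilon> i" by blast
      have "P i (lincomb b (\<epsilon> ` I)) = b (\<epsilon> i)"
        using b i(1) by (intro P_lincomb_eps) auto
      then show ?thesis using a b i by auto
    qed
    then show "b = ?a"
      using b by (intro extensionalityI [of _ "\<epsilon> ` I"]) (auto simp: PiE_def)
  qed
qed

lemma dim_eq: "dim = card I"
  using dim_basis [OF _ basis_eps] finite_I by (simp add: card_image [OF inj_eps])

text \<open>\<open>linear_trace\<close> is a definite description over all finite bases, so
  independence of the basis is part of the claim. An arbitrary basis \<open>S\<close> is compared
  with the basis given by \<open>\<epsilon>\<close>.\<close>

lemma linear_trace_eq:
  assumes T: "\<And>X. X \<in> carrier E \<Longrightarrow> T X \<in> carrier E"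
    and t: "\<And>i j. i \<in> I \<Longrightarrow> j \<in> I \<Longrightarrow> t i j \<in> carrier F"
    and PT: "\<And>i X. i \<in> I \<Longrightarrow> X \<in> carrier E \<Longrightarrow> P i (T X) = (\<Oplus>\<^bsub>F\<^esub>j\<in>I. t i j \<otimes>\<^bsub>F\<^esub> P j X)"
  shows "linear_trace F E T = (\<Oplus>\<^bsub>F\<^esub>i\<in>I. t i i)"
proof -
  have PTe: "P i (T (\<epsilon> j)) = t i j" if "i \<in> I" "j \<in> I" for i j
  proof -
    have "P i (T (\<epsilon> j)) = (\<Oplus>\<^bsub>F\<^esub>l\<in>I. t i l \<otimes>\<^bsub>F\<^esub> P l (\<epsilon> j))"
      by (rule PT [OF that(1) eps_closed [OF that(2)]])
    also have "\<dots> = (\<Oplus>\<^bsub>F\<^esub>l\<in>I. if j = l then t i l else \<zero>\<^bsub>F\<^esub>)"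
    proof (intro F.finsum_cong' refl)
      fix l assume "l \<in> I"
      then show "t i l \<otimes>\<^bsub>F\<^esub> P l (\<epsilon> j) = (if j = l then t i l else \<zero>\<^bsub>F\<^esub>)"
        using t [OF that(1), of l] that by (simp add: P_eps)
    qed (use that t in \<open>auto simp: Pi_iff\<close>)
    also have "\<dots> = t i j"
      using that finite_I t by (intro F.finsum_singleton) (auto simp: Pi_iff)
    finally show ?thesis .
  qed
  have coords: "\<exists>a. a \<in> S \<rightarrow>\<^sub>E carrier F \<and> lincomb a S = v"
    and coords_unique: "\<And>a b. a \<in> S \<rightarrow> carrier F \<Longrightarrow> b \<in> S \<rightarrow> carrier F \<Longrightarrow> lincomb a S = lincomb b S \<Longrightarrow>
      lincomb b S = v \<Longrightarrow> \<forall>s\<in>S. a s = b s"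
    if S: "finite S" "basis S" and v: "v \<in> carrier E" for S v
  proof -
    have Sc: "S \<subseteq> carrier E" using S(2) by (simp add: basis_def)
    have ex1: "\<exists>!a. a \<in> S \<rightarrow>\<^sub>E carrier F \<and> lincomb a S = v"
      by (rule iffD1 [OF basis_criterion [OF S(1) Sc] S(2), rule_format, OF v])
    then show "\<exists>a. a \<in> S \<rightarrow>\<^sub>E carrier F \<and> lincomb a S = v" by (rule ex1_implies_ex)
    fix a b assume ab: "a \<in> S \<rightarrow> carrier F" "b \<in> S \<rightarrow> carrier F" "lincomb a S = lincomb b S"
        "lincomb b S = v"
    have r: "restrict c S \<in> S \<rightarrow>\<^sub>E carrier F \<and> lincomb (restrict c S) S = v"
      if "c \<in> S \<rightarrow> carrier F" "lincomb c S = v" for c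
    proof -
      have "lincomb (restrict c S) S = lincomb c S"
        using Sc that(1) unfolding lincomb_def by (intro M.finsum_cong') (auto simp: smult_closed)
      with that show ?thesis by simp
    qed
    have "restrict a S = restrict b S"
      using the1_equality [OF ex1, OF r [OF ab(1) trans [OF ab(3,4)]]]
        the1_equality [OF ex1, OF r [OF ab(2,4)]] by simp
    then show "\<forall>s\<in>S. a s = b s" by (metis restrict_apply')
  qed
  \<comment> \<open>\<open>D j\<close> lists the coordinates of \<open>T (\<epsilon> j)\<close> in
    \<open>S\<close>, and \<open>P j s\<close> is the coordinate of \<open>s\<close> along
    \<open>\<epsilon> j\<close>. The matrix of \<open>T\<close> in either basis is a product of
    these two, in opposite orders.\<close>
  have key: "(\<Oplus>\<^bsub>F\<^esub>e \<in> S. C e e) = (\<Oplus>\<^bsub>F\<^esub>i\<in>I. t i i)"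
    if S: "finite S" "basis S" and C: "\<forall>e\<in>S. C e \<in> S \<rightarrow> carrier F \<and> T e = lincomb (C e) S" for S C
  proof -
    have Sc: "S \<subseteq> carrier E" using S(2) by (simp add: basis_def)
    have "\<forall>j\<in>I. \<exists>a. a \<in> S \<rightarrow>\<^sub>E carrier F \<and> lincomb a S = T (\<epsilon> j)"
      using coords [OF S] T eps_closed by simp
    then obtain D where D: "\<And>j. j \<in> I \<Longrightarrow> D j \<in> S \<rightarrow>\<^sub>E carrier F \<and> lincomb (D j) S = T (\<epsilon> j)"
      by metis
    have Dc: "\<And>j s. j \<in> I \<Longrightarrow> s \<in> S \<Longrightarrow> D j s \<in> carrier F" using D by blast
    have Pc: "\<And>j s. j \<in> I \<Longrightarrow> s \<in> S \<Longrightarrow> P j s \<in> carrier F" using Sc P_closed by blast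
    have PD: "(\<Oplus>\<^bsub>F\<^esub>s\<in>S. D j s \<otimes>\<^bsub>F\<^esub> P i s) = t i j" if "i \<in> I" "j \<in> I" for i j
      using P_lincomb [of i S "D j"] that S Sc Dc D PTe by auto
    \<comment> \<open>Both sides are coordinates of \<open>T s\<close> in the basis
      \<open>S\<close>, so they agree by uniqueness. The right-hand side is checked by applying all
      \<open>P i\<close>.\<close>
    have Cs: "C s s' = (\<Oplus>\<^bsub>F\<^esub>j\<in>I. P j s \<otimes>\<^bsub>F\<^esub> D j s')" if s: "s \<in> S" "s' \<in> S" for s s'
    proof -
      let ?c = "\<lambda>s'. (\<Oplus>\<^bsub>F\<^esub>j\<in>I. P j s \<otimes>\<^bsub>F\<^esub> D j s')"
      have cc: "?c x \<in> carrier F" if "x \<in> S" for x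
        using s that by (auto intro!: F.finsum_closed simp: Pc Dc)
      have eq: "lincomb ?c S = T s"
      proof (rule P_inj)
        show "lincomb ?c S \<in> carrier E" using Sc cc by (intro lincomb_closed) auto
        show "T s \<in> carrier E" using T Sc s by blast
        fix i assume i: "i \<in> I"
        have "P i (lincomb ?c S) = (\<Oplus>\<^bsub>F\<^esub>x\<in>S. ?c x \<otimes>\<^bsub>F\<^esub> P i x)"
          using i S Sc cc by (intro P_lincomb) auto
        also have "\<dots> = (\<Oplus>\<^bsub>F\<^esub>x\<in>S. \<Oplus>\<^bsub>F\<^esub>j\<in>I. P j s \<otimes>\<^bsub>F\<^esub> (D j x \<otimes>\<^bsub>F\<^esub> P i x))"
        proof (intro F.finsum_cong' refl)
          fix x assume x: "x \<in> S"
          have "?c x \<otimes>\<^bsub>F\<^esub> P i x = (\<Oplus>\<^bsub>F\<^esub>j\<in>I. (P j s \<otimes>\<^bsub>F\<^esub> D j x) \<otimes>\<^bsub>F\<^esub> P i x)"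
            using x i s finite_I by (intro F.finsum_ldistr) (auto simp: Pc Dc)
          also have "\<dots> = (\<Oplus>\<^bsub>F\<^esub>j\<in>I. P j s \<otimes>\<^bsub>F\<^esub> (D j x \<otimes>\<^bsub>F\<^esub> P i x))"
            using x i s by (intro F.finsum_cong') (auto simp: Pc Dc F.m_assoc)
          finally show "?c x \<otimes>\<^bsub>F\<^esub> P i x = (\<Oplus>\<^bsub>F\<^esub>j\<in>I. P j s \<otimes>\<^bsub>F\<^esub> (D j x \<otimes>\<^bsub>F\<^esub> P i x))" .
        qed (use i s in \<open>auto intro!: F.finsum_closed simp: Pc Dc\<close>)
        also have "\<dots> = (\<Oplus>\<^bsub>F\<^esub>j\<in>I. \<Oplus>\<^bsub>F\<^esub>x\<in>S. P j s \<otimes>\<^bsub>F\<^esub> (D j x \<otimes>\<^bsub>F\<^esub> P i x))"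
          using i s S finite_I by (intro F.finsum_finsum_swap) (auto simp: Pc Dc)
        also have "\<dots> = (\<Oplus>\<^bsub>F\<^esub>j\<in>I. t i j \<otimes>\<^bsub>F\<^esub> P j s)"
        proof (intro F.finsum_cong' refl)
          fix j assume j: "j \<in> I"
          have "(\<Oplus>\<^bsub>F\<^esub>x\<in>S. P j s \<otimes>\<^bsub>F\<^esub> (D j x \<otimes>\<^bsub>F\<^esub> P i x)) = P j s \<otimes>\<^bsub>F\<^esub> (\<Oplus>\<^bsub>F\<^esub>x\<in>S. D j x \<otimes>\<^bsub>F\<^esub> P i x)"
            using i j s S by (intro F.finsum_rdistr [symmetric]) (auto simp: Pc Dc)
          then show "(\<Oplus>\<^bsub>F\<^esub>x\<in>S. P j s \<otimes>\<^bsub>F\<^esub> (D j x \<otimes>\<^bsub>F\<^esub> P i x)) = t i j \<otimes>\<^bsub>F\<^esub> P j s"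
            using i j s by (simp add: PD Pc t F.m_comm)
        qed (use i s in \<open>auto simp: Pc t\<close>)
        also have "\<dots> = P i (T s)" using PT i s Sc by auto
        finally show "P i (lincomb ?c S) = P i (T s)" .
      qed
      have "T s \<in> carrier E" "C s \<in> S \<rightarrow> carrier F" "lincomb (C s) S = lincomb ?c S"
        using C s T Sc eq by auto
      then have "\<forall>x\<in>S. C s x = ?c x"
        using cc by (intro coords_unique [OF S _ _ _ _ eq]) auto
      then show ?thesis using s by blast
    qed
    \<comment> \<open>The identity tr(XY) = tr(YX), by exchanging the two sums.\<close>
    have "(\<Oplus>\<^bsub>F\<^esub>s\<in>S. C s s) = (\<Oplus>\<^bsub>F\<^esub>s\<in>S. \<Oplus>\<^bsub>F\<^esub>j\<in>I. D j s \<otimes>\<^bsub>F\<^esub> P j s)"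
      using S by (intro F.finsum_cong')
        (auto simp: Cs Pc Dc F.m_comm intro!: F.finsum_closed F.finsum_cong')
    also have "\<dots> = (\<Oplus>\<^bsub>F\<^esub>j\<in>I. \<Oplus>\<^bsub>F\<^esub>s\<in>S. D j s \<otimes>\<^bsub>F\<^esub> P j s)"
      using S finite_I by (intro F.finsum_finsum_swap) (auto simp: Pc Dc)
    also have "\<dots> = (\<Oplus>\<^bsub>F\<^esub>j\<in>I. t j j)"
      by (intro F.finsum_cong') (auto simp: PD t)
    finally show ?thesis .
  qed
  have fin: "finite (\<epsilon> ` I)" using finite_I by simp
  have "\<forall>e\<in>\<epsilon> ` I. \<exists>a. a \<in> \<epsilon> ` I \<rightarrow>\<^sub>E carrier F \<and> lincomb a (\<epsilon> ` I) = T e"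
    using coords [OF fin basis_eps] T eps_closed by (metis imageE)
  then obtain C where C': "\<forall>e\<in>\<epsilon> ` I. C e \<in> \<epsilon> ` I \<rightarrow>\<^sub>E carrier F \<and> lincomb (C e) (\<epsilon> ` I) = T e"
    by metis
  have C: "\<forall>e\<in>\<epsilon> ` I. C e \<in> \<epsilon> ` I \<rightarrow> carrier F \<and> T e = lincomb (C e) (\<epsilon> ` I)"
  proof
    fix e assume "e \<in> \<epsilon> ` I"
    with C' show "C e \<in> \<epsilon> ` I \<rightarrow> carrier F \<and> T e = lincomb (C e) (\<epsilon> ` I)"
      by (metis PiE_iff Pi_I)
  qed
  show ?thesis
    unfolding linear_trace_def
  proof (rule the_equality)
    show "\<exists>S C. finite S \<and> basis S \<and> (\<forall>e\<in>S. C e \<in> S \<rightarrow> carrier F \<and> T e = lincomb (C e) S) \<and>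
      (\<Oplus>\<^bsub>F\<^esub>i\<in>I. t i i) = (\<Oplus>\<^bsub>F\<^esub>e\<in>S. C e e)"
      by (rule exI [of _ "\<epsilon> ` I"], rule exI [of _ C])
        (intro conjI fin basis_eps C key [OF fin basis_eps C, symmetric])
    fix u assume "\<exists>S C. finite S \<and> basis S \<and> (\<forall>e\<in>S. C e \<in> S \<rightarrow> carrier F \<and> T e = lincomb (C e) S) \<and>
      u = (\<Oplus>\<^bsub>F\<^esub>e\<in>S. C e e)"
    then show "u = (\<Oplus>\<^bsub>F\<^esub>i\<in>I. t i i)"
      by (elim exE conjE) (simp only: key)
  qed
qed

end

section \<open>Determinants\<close>

context cring
begin

text \<open>Keeps the simplifier from turning the lower bound of \<open>{1..v}\<close> into
  \<open>Suc 0\<close>.\<close>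

context
  notes One_nat_def [simp del]
begin

definition entries_closed :: "nat \<Rightarrow> (nat \<Rightarrow> nat \<Rightarrow> 'a) \<Rightarrow> bool" where
  "entries_closed v M \<longleftrightarrow> (\<forall>i\<in>{1..v}. \<forall>j\<in>{1..v}. M i j \<in> carrier R)"

definition diagonal_product :: "nat \<Rightarrow> (nat \<Rightarrow> nat \<Rightarrow> 'a) \<Rightarrow> (nat \<Rightarrow> nat) \<Rightarrow> 'a" where
  "diagonal_product v M \<sigma> = (\<Otimes>i \<in> {1..v}. M i (\<sigma> i))"

lemma determinant_eq:
  "determinant R v M = (\<Oplus>\<sigma> \<in> {\<sigma>. \<sigma> permutes {1..v}}.
      if evenperm \<sigma> then diagonal_product v M \<sigma> else \<ominus> diagonal_product v M \<sigma>)"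
  unfolding determinant_def diagonal_product_def by (rule refl)

lemma diagonal_product_closed:
  assumes "entries_closed v M" "\<sigma> permutes {1..v}"
  shows "diagonal_product v M \<sigma> \<in> carrier R"
  unfolding diagonal_product_def
  using assms permutes_in_image [OF assms(2)]
      by (intro finprod_closed) (auto simp: entries_closed_def)

lemma diagonal_product_remove:
  assumes "entries_closed v M" "\<sigma> permutes {1..v}" "k \<in> {1..v}"
  shows "diagonal_product v M \<sigma> = M k (\<sigma> k) \<otimes> (\<Otimes>i \<in> {1..v} - {k}. M i (\<sigma> i))"
proof -
  have "(\<Otimes>i \<in> insert k ({1..v} - {k}). M i (\<sigma> i)) = M k (\<sigma> k) \<otimes> (\<Otimes>i \<in> {1..v} - {k}. M i (\<sigma> i))"
    using assms permutes_in_image [OF assms(2)]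
        by (intro finprod_insert) (auto simp: entries_closed_def)
  moreover have "insert k ({1..v} - {k}) = {1..v}" using assms(3) by auto
  ultimately show ?thesis by (simp add: diagonal_product_def)
qed

text \<open>Stated for any additively closed set with negatives, so that it serves both for closure
  in \<open>R\<close> and for membership in the ideal of multiples of the discriminant
  monomial.\<close>

lemma determinant_mem:
  assumes "V \<subseteq> carrier R" "\<zero> \<in> V" "\<And>x y. x \<in> V \<Longrightarrow> y \<in> V \<Longrightarrow> x \<oplus> y \<in> V" "\<And>x. x \<in> V \<Longrightarrow> \<ominus> x \<in> V"
    and "\<And>\<sigma>. \<sigma> permutes {1..v} \<Longrightarrow> diagonal_product v M \<sigma> \<in> V"
  shows "determinant R v M \<in> V"
proof -
  have sum: "(\<Oplus>\<sigma> \<in> A. f \<sigma>) \<in> V" if "finite A" "\<And>\<sigma>. \<sigma> \<in> A \<Longrightarrow> f \<sigma> \<in> V" for A f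
    using that
  proof (induction A)
    case (insert x A)
    then have "(\<Oplus>\<sigma> \<in> insert x A. f \<sigma>) = f x \<oplus> (\<Oplus>\<sigma> \<in> A. f \<sigma>)"
      using assms(1) by (intro finsum_insert) auto
    with insert show ?case using assms(3) by simp
  qed (simp add: assms(2))
  show ?thesis
    unfolding determinant_eq
    by (rule sum) (auto simp: finite_permutations intro: assms(4,5))
qed

lemma determinant_closed: "entries_closed v M \<Longrightarrow> determinant R v M \<in> carrier R"
  using diagonal_product_closed by (intro determinant_mem) auto

lemma determinant_cong:
  assumes "entries_closed v M'" "\<And>i j. i \<in> {1..v} \<Longrightarrow> j \<in> {1..v} \<Longrightarrow> M i j = M' i j"
  shows "determinant R v M = determinant R v M'"
proof -
  have "diagonal_product v M \<sigma> = diagonal_product v M' \<sigma>" if "\<sigma> permutes {1..v}" for \<sigma>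
    unfolding diagonal_product_def
    using assms permutes_in_image [OF that] by (intro finprod_cong') (auto simp: entries_closed_def)
  then show ?thesis
    unfolding determinant_eq using diagonal_product_closed [OF assms(1)]
    by (intro finsum_cong') auto
qed

lemma determinant_row_add:
  assumes M: "entries_closed v M1" "entries_closed v M2" and k: "k \<in> {1..v}"
    and row: "\<And>j. j \<in> {1..v} \<Longrightarrow> M k j = M1 k j \<oplus> M2 k j"
    and rest: "\<And>i j. i \<in> {1..v} \<Longrightarrow> i \<noteq> k \<Longrightarrow> j \<in> {1..v} \<Longrightarrow> M1 i j = M i j \<and> M2 i j = M i j"
  shows "determinant R v M = determinant R v M1 \<oplus> determinant R v M2"
proof -
  have Mc: "entries_closed v M"
    unfolding entries_closed_def
  proof (intro ballI)
    fix i j assume ij: "i \<in> {1..v}" "j \<in> {1..v}"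
    then have c: "M1 i j \<in> carrier R" "M2 i j \<in> carrier R"
      using M unfolding entries_closed_def by blast+
    show "M i j \<in> carrier R"
    proof (cases "i = k")
      case True
      then show ?thesis using row [OF ij(2)] c by simp
    next
      case False
      then show ?thesis using rest [OF ij(1) False ij(2)] c by simp
    qed
  qed
  have dp: "diagonal_product v M \<sigma> = diagonal_product v M1 \<sigma> \<oplus> diagonal_product v M2 \<sigma>"
    if s: "\<sigma> permutes {1..v}" for \<sigma>
  proof -
    let ?r = "\<lambda>M. \<Otimes>i \<in> {1..v} - {k}. M i (\<sigma> i)"
    have sj: "\<sigma> i \<in> {1..v} \<longleftrightarrow> i \<in> {1..v}" for i by (rule permutes_in_image [OF s])
    have c: "M k (\<sigma> k) \<in> carrier R" "M1 k (\<sigma> k) \<in> carrier R" "M2 k (\<sigma> k) \<in> carrier R"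
      using M Mc k sj unfolding entries_closed_def by blast+
    have rest': "M1 i (\<sigma> i) = M i (\<sigma> i)" "M2 i (\<sigma> i) = M i (\<sigma> i)" if "i \<in> {1..v} - {k}" for i
      using rest [of i "\<sigma> i"] that sj [of i] by blast+
    have Mi: "M i (\<sigma> i) \<in> carrier R" if "i \<in> {1..v} - {k}" for i
      using Mc that sj [of i] by (auto simp: entries_closed_def)
    have r: "?r M \<in> carrier R" "?r M1 = ?r M" "?r M2 = ?r M"
      by (intro finprod_closed Pi_I Mi, assumption)
        (intro finprod_cong' Pi_I Mi rest' refl, assumption+)+
    show ?thesis
      unfolding diagonal_product_remove [OF M(1) s k] diagonal_product_remove [OF M(2) s k]
        diagonal_product_remove [OF Mc s k] r(2,3)
      using c r(1) row [of "\<sigma> k"] sj [of k] k by (simp add: l_distr)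
  qed
  let ?t = "\<lambda>M \<sigma>. if evenperm \<sigma> then diagonal_product v M \<sigma> else \<ominus> diagonal_product v M \<sigma>"
  have "determinant R v M = (\<Oplus>\<sigma> \<in> {\<sigma>. \<sigma> permutes {1..v}}. ?t M1 \<sigma> \<oplus> ?t M2 \<sigma>)"
    unfolding determinant_eq using diagonal_product_closed M
    by (intro finsum_cong') (auto simp: dp minus_add)
  also have "\<dots> = determinant R v M1 \<oplus> determinant R v M2"
    unfolding determinant_eq using diagonal_product_closed M by (intro finsum_addf) auto
  finally show ?thesis .
qed

lemma determinant_zero_row:
  assumes "entries_closed v M" "k \<in> {1..v}" "\<And>j. j \<in> {1..v} \<Longrightarrow> M k j = \<zero>"
  shows "determinant R v M = \<zero>"
proof -
  \<comment> \<open>A zero row is the sum of two zero rows, so the determinant equals its own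
    double.\<close>
  have "determinant R v M = determinant R v M \<oplus> determinant R v M"
    using assms by (intro determinant_row_add [where k = k]) auto
  then show ?thesis
    using determinant_closed [OF assms(1)] by (metis add.r_cancel_one')
qed

lemma determinant_mem_row_sum:
  assumes V: "\<zero> \<in> V" "\<And>x y. x \<in> V \<Longrightarrow> y \<in> V \<Longrightarrow> x \<oplus> y \<in> V"
    and M: "entries_closed v M" and k: "k \<in> {1..v}" and A: "finite A"
    and c: "\<And>s j. s \<in> A \<Longrightarrow> j \<in> {1..v} \<Longrightarrow> c s j \<in> carrier R"
    and mem: "\<And>s. s \<in> A \<Longrightarrow> determinant R v (\<lambda>i j. if i = k then c s j else M i j) \<in> V"
  shows "determinant R v (\<lambda>i j. if i = k then (\<Oplus>s\<in>A. c s j) else M i j) \<in> V"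
  using A c mem
proof (induction A)
  case empty
  have "determinant R v (\<lambda>i j. if i = k then (\<Oplus>s\<in>{}. c s j) else M i j) = \<zero>"
    using M k by (intro determinant_zero_row [of v _ k]) (auto simp: entries_closed_def)
  then show ?case using V by simp
next
  case (insert x A)
  let ?d = "\<lambda>r. determinant R v (\<lambda>i j. if i = k then r j else M i j)"
  have s: "(\<Oplus>s\<in>A. c s j) \<in> carrier R" "(\<Oplus>s\<in>insert x A. c s j) = c x j \<oplus> (\<Oplus>s\<in>A. c s j)"
    if "j \<in> {1..v}" for j
    using insert.hyps insert.prems(1) [OF _ that] by (auto intro!: finsum_closed finsum_insert)
  have "?d (\<lambda>j. \<Oplus>s\<in>insert x A. c s j) = ?d (c x) \<oplus> ?d (\<lambda>j. \<Oplus>s\<in>A. c s j)"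
    using M k s insert.prems(1) by (intro determinant_row_add [where k =
        k]) (auto simp: entries_closed_def)
  moreover have "?d (\<lambda>j. \<Oplus>s\<in>A. c s j) \<in> V"
    by (rule insert.IH) (simp_all add: insert.prems)
  ultimately show ?case using V(2) insert.prems(2) [of x] by simp
qed

text \<open>Multilinear expansion of all rows. Membership in an additively closed set replaces an
  explicit formula, which would be a sum over all choice functions \<open>f\<close>.\<close>

lemma determinant_mem_expand:
  assumes V: "\<zero> \<in> V" "\<And>x y. x \<in> V \<Longrightarrow> y \<in> V \<Longrightarrow> x \<oplus> y \<in> V" and A: "finite A"
    and c: "\<And>i s j. i \<in> {1..v} \<Longrightarrow> s \<in> A \<Longrightarrow> j \<in> {1..v} \<Longrightarrow> c i s j \<in> carrier R"
    and mem: "\<And>f. f \<in> {1..v} \<rightarrow> A \<Longrightarrow> determinant R v (\<lambda>i j. c i (f i) j) \<in> V"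
  shows "determinant R v (\<lambda>i j. \<Oplus>s\<in>A. c i s j) \<in> V"
proof -
  have sc: "(\<Oplus>s\<in>A. c i s j) \<in> carrier R" if "i \<in> {1..v}" "j \<in> {1..v}" for i j
    using c that by (intro finsum_closed) auto
  have fc: "c i (f i) j \<in> carrier R" if "f \<in> {1..v} \<rightarrow> A" "i \<in> {1..v}" "j \<in> {1..v}" for f i j
    by (rule c [OF that(2) Pi_mem [OF that(1,2)] that(3)])
  \<comment> \<open>Hybrid matrices: the first \<open>t\<close> rows are full sums, the others are
    single summands chosen by \<open>f\<close>. Row \<open>Suc t\<close> is expanded by updating
    \<open>f\<close> at that place.\<close>
  have "determinant R v (\<lambda>i j. if i \<le> t then (\<Oplus>s\<in>A. c i s j) else c i (f i) j) \<in> V"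
    if "f \<in> {1..v} \<rightarrow> A" "t \<le> v" for t f
    using that
  proof (induction t arbitrary: f)
    case 0
    have "determinant R v (\<lambda>i j. if i \<le> 0 then (\<Oplus>s\<in>A. c i s j) else c i (f i) j) =
        determinant R v (\<lambda>i j. c i (f i) j)"
      using fc [OF 0(1)] by (intro determinant_cong) (auto simp: entries_closed_def)
    then show ?case using mem [OF 0(1)] by simp
  next
    case (Suc t)
    let ?M = "\<lambda>i j. if i \<le> t then (\<Oplus>s\<in>A. c i s j) else c i (f i) j"
    have M: "entries_closed v ?M"
      using sc fc [OF Suc.prems(1)] by (auto simp: entries_closed_def)
    have k: "Suc t \<in> {1..v}" using Suc.prems by simp
    have "determinant R v (\<lambda>i j. if i = Suc t then (\<Oplus>s\<in>A. c (Suc t) s j) else ?M i j) \<in> V"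
    proof (rule determinant_mem_row_sum [OF V M k A])
      fix s assume s: "s \<in> A"
      let ?g = "f(Suc t := s)"
      have g: "?g \<in> {1..v} \<rightarrow> A" using s Suc.prems by auto
      have "determinant R v (\<lambda>i j. if i = Suc t then c (Suc t) s j else ?M i j) =
        determinant R v (\<lambda>i j. if i \<le> t then (\<Oplus>s\<in>A. c i s j) else c i (?g i) j)"
        using sc fc [OF g] by (intro determinant_cong) (auto simp: entries_closed_def split:
            if_splits)
      then show "determinant R v (\<lambda>i j. if i = Suc t then c (Suc t) s j else ?M i j) \<in> V"
        using Suc.IH [OF g] Suc.prems by simp
    qed (use c k in auto)
    moreover have "(\<lambda>i j. if i = Suc t then (\<Oplus>s\<in>A. c (Suc t) s j) else ?M i j) =
        (\<lambda>i j. if i \<le> Suc t then (\<Oplus>s\<in>A. c i s j) else c i (f i) j)"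
      by (auto simp: fun_eq_iff le_Suc_eq)
    ultimately show ?case by simp
  qed
  note step = this
  show ?thesis
  \<comment> \<open>For empty \<open>A\<close> and positive \<open>v\<close> there is no choice
    function at all; then every row is an empty sum.\<close>
  proof (cases "v = 0 \<or> A \<noteq> {}")
    case True
    then obtain f where "f \<in> {1..v} \<rightarrow> A" by fastforce
    from step [OF this order_refl]
    have "determinant R v (\<lambda>i j. if i \<le> v then (\<Oplus>s\<in>A. c i s j) else c i (f i) j) \<in> V" .
    moreover have "determinant R v (\<lambda>i j. if i \<le> v then (\<Oplus>s\<in>A. c i s j) else c i (f i) j) =
        determinant R v (\<lambda>i j. \<Oplus>s\<in>A. c i s j)"
      using sc by (intro determinant_cong) (auto simp: entries_closed_def)
    ultimately show ?thesis by simp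
  next
    case False
    then have "determinant R v (\<lambda>i j. \<Oplus>s\<in>A. c i s j) = \<zero>"
      by (intro determinant_zero_row [of v _ 1]) (auto simp: entries_closed_def)
    then show ?thesis using V(1) by simp
  qed
qed

text \<open>Rows of equal degree need not be equal, but their 2 by 2 minors vanish. The terms of a
  permutation and of its composite with the transposition of \<open>k\<close> and \<open>l\<close>
  then cancel. Pairing even with odd permutations avoids a division by two, so the argument holds in
  every characteristic.\<close>

lemma determinant_eq_zero:
  assumes M: "entries_closed v M" and kl: "k \<in> {1..v}" "l \<in> {1..v}" "k \<noteq> l"
    and minors: "\<And>i j. i \<in> {1..v} \<Longrightarrow> j \<in> {1..v} \<Longrightarrow> M k i \<otimes> M l j = M k j \<otimes> M l i"
  shows "determinant R v M = \<zero>"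
proof -
  let ?P = "{\<sigma>. \<sigma> permutes {1..v}}"
  let ?Ev = "{\<sigma>\<in>?P. evenperm \<sigma>}" and ?Od = "{\<sigma>\<in>?P. \<not> evenperm \<sigma>}"
  let ?\<tau> = "transpose k l"
  let ?d = "diagonal_product v M"
  have fin: "finite ?P" by (simp add: finite_permutations)
  have dc: "?d \<sigma> \<in> carrier R" if "\<sigma> \<in> ?P" for \<sigma> using that diagonal_product_closed [OF M] by simp
  have \<tau>: "?\<tau> permutes {1..v}" using kl by (intro permutes_swap_id)
  have comp: "\<sigma> \<circ> ?\<tau> permutes {1..v}" "evenperm (\<sigma> \<circ> ?\<tau>) \<longleftrightarrow> \<not> evenperm \<sigma>" if "\<sigma> permutes {1..v}"
    for \<sigma>
  proof -
    show "\<sigma> \<circ> ?\<tau> permutes {1..v}" by (rule permutes_compose [OF \<tau> that])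
    have "permutation \<sigma>" using that by (auto simp: permutation_permutes)
    moreover have "permutation ?\<tau>" by (rule permutation_swap_id)
    ultimately show "evenperm (\<sigma> \<circ> ?\<tau>) \<longleftrightarrow> \<not> evenperm \<sigma>"
      using kl(3) by (simp add: evenperm_comp evenperm_swap)
  qed
  have inv: "(\<sigma> \<circ> ?\<tau>) \<circ> ?\<tau> = \<sigma>" for \<sigma> :: "nat \<Rightarrow> nat" by (simp add: comp_assoc)
  \<comment> \<open>Composing with the transposition changes only the factors of rows
    \<open>k\<close> and \<open>l\<close>, and the vanishing minor exchanges them.\<close>
  have d\<tau>: "?d (\<sigma> \<circ> ?\<tau>) = ?d \<sigma>" if s: "\<sigma> permutes {1..v}" for \<sigma>
  proof -
    let ?I = "{1..v} - {k} - {l}"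
    have sj: "\<sigma> i \<in> {1..v} \<longleftrightarrow> i \<in> {1..v}" for i by (rule permutes_in_image [OF s])
    have split: "?d \<rho> = M k (\<rho> k) \<otimes> (M l (\<rho> l) \<otimes> (\<Otimes>i\<in>?I. M i (\<rho> i)))" if r: "\<rho> permutes {1..v}"
      for \<rho>
    proof -
      have rj: "\<rho> i \<in> {1..v} \<longleftrightarrow> i \<in> {1..v}" for i by (rule permutes_in_image [OF r])
      have "(\<Otimes>i\<in>insert l ?I. M i (\<rho> i)) = M l (\<rho> l) \<otimes> (\<Otimes>i\<in>?I. M i (\<rho> i))"
        using M rj kl by (intro finprod_insert) (auto simp: entries_closed_def)
      moreover have "insert l ?I = {1..v} - {k}" using kl by auto
      ultimately show ?thesis using diagonal_product_remove [OF M r kl(1)] by simp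
    qed
    have "(\<Otimes>i\<in>?I. M i ((\<sigma> \<circ> ?\<tau>) i)) = (\<Otimes>i\<in>?I. M i (\<sigma> i))"
      using M sj by (intro finprod_cong') (auto simp: entries_closed_def transpose_def)
    moreover have rc: "(\<Otimes>i\<in>?I. M i (\<sigma> i)) \<in> carrier R"
      using M sj by (intro finprod_closed) (auto simp: entries_closed_def)
    moreover have "M k (\<sigma> l) \<in> carrier R" "M l (\<sigma> k) \<in> carrier R" "M k (\<sigma> k) \<in> carrier R"
      "M l (\<sigma> l) \<in> carrier R"
      using M kl sj unfolding entries_closed_def by blast+
    moreover have "M k (\<sigma> l) \<otimes> M l (\<sigma> k) = M k (\<sigma> k) \<otimes> M l (\<sigma> l)"
      using minors kl sj by simp
    ultimately show ?thesis
      unfolding split [OF s] split [OF comp(1) [OF s]] by (simp add: m_assoc [symmetric])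
  qed
  have P: "?Ev \<union> ?Od = ?P" by auto
  have "determinant R v M = (\<Oplus>\<sigma>\<in>?Ev \<union> ?Od. if evenperm \<sigma> then ?d \<sigma> else \<ominus> ?d \<sigma>)"
    unfolding P determinant_eq by (rule refl)
  also have "\<dots> = (\<Oplus>\<sigma>\<in>?Ev. if evenperm \<sigma> then ?d \<sigma> else \<ominus> ?d \<sigma>) \<oplus> (\<Oplus>\<sigma>\<in>?Od.
      if evenperm \<sigma> then ?d \<sigma> else \<ominus> ?d \<sigma>)"
    using fin dc by (intro finsum_Un_disjoint) auto
  also have "(\<Oplus>\<sigma>\<in>?Ev. if evenperm \<sigma> then ?d \<sigma> else \<ominus> ?d \<sigma>) = (\<Oplus>\<sigma>\<in>?Ev. ?d \<sigma>)"
    using dc by (intro finsum_cong') auto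
  also have "(\<Oplus>\<sigma>\<in>?Od. if evenperm \<sigma> then ?d \<sigma> else \<ominus> ?d \<sigma>) = (\<Oplus>\<sigma>\<in>?Od. \<ominus> ?d \<sigma>)"
    using dc by (intro finsum_cong') auto
  also have "?Od = (\<lambda>\<sigma>. \<sigma> \<circ> ?\<tau>) ` ?Ev"
  proof (intro subset_antisym subsetI)
    fix \<sigma> assume "\<sigma> \<in> ?Od"
    then have "\<sigma> \<circ> ?\<tau> \<in> ?Ev" using comp [of \<sigma>] by simp
    then show "\<sigma> \<in> (\<lambda>\<sigma>. \<sigma> \<circ> ?\<tau>) ` ?Ev" by (rule rev_image_eqI) (rule inv [symmetric])
  qed (use comp in auto)
  also have "(\<Oplus>\<sigma>\<in>(\<lambda>\<sigma>. \<sigma> \<circ> ?\<tau>) ` ?Ev. \<ominus> ?d \<sigma>) = (\<Oplus>\<sigma>\<in>?Ev. \<ominus> ?d (\<sigma> \<circ> ?\<tau>))"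
  proof (rule finsum_reindex)
    show "inj_on (\<lambda>\<sigma>. \<sigma> \<circ> ?\<tau>) ?Ev"
      by (rule inj_on_inverseI [of _ "\<lambda>\<sigma>. \<sigma> \<circ> ?\<tau>"]) (rule inv)
  qed (use dc comp(1) in auto)
  also have "\<dots> = (\<Oplus>\<sigma>\<in>?Ev. \<ominus> ?d \<sigma>)"
    using dc by (intro finsum_cong') (auto simp: d\<tau>)
  also have "(\<Oplus>\<sigma>\<in>?Ev. ?d \<sigma>) \<oplus> (\<Oplus>\<sigma>\<in>?Ev. \<ominus> ?d \<sigma>) = (\<Oplus>\<sigma>\<in>?Ev. ?d \<sigma> \<oplus> \<ominus> ?d \<sigma>)"
    using dc by (intro finsum_addf [symmetric]) auto
  also have "\<dots> = (\<Oplus>\<sigma>\<in>?Ev. \<zero>)"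
    using dc by (intro finsum_cong') (auto simp: r_neg)
  finally show ?thesis by simp
qed

lemma determinant_diagonal:
  assumes M: "entries_closed v M" and off: "\<And>i j. i \<in> {1..v} \<Longrightarrow> j \<in> {1..v} \<Longrightarrow> i \<noteq> j \<Longrightarrow> M i j = \<zero>"
  shows "determinant R v M = (\<Otimes>i\<in>{1..v}. M i i)"
proof -
  have "(if evenperm \<sigma> then diagonal_product v M \<sigma> else \<ominus> diagonal_product v M \<sigma>) =
    (if id = \<sigma> then diagonal_product v M \<sigma> else \<zero>)" if s: "\<sigma> permutes {1..v}" for \<sigma>
  proof (cases "\<sigma> = id")
    case False
    then obtain k where k: "\<sigma> k \<noteq> k" by (auto simp: fun_eq_iff)
    then have kv: "k \<in> {1..v}" using s by (auto simp: permutes_def)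
    have sj: "\<sigma> i \<in> {1..v} \<longleftrightarrow> i \<in> {1..v}" for i by (rule permutes_in_image [OF s])
    have "M k (\<sigma> k) = \<zero>" using off [of k "\<sigma> k"] k kv sj by simp
    moreover have "(\<Otimes>i \<in> {1..v} - {k}. M i (\<sigma> i)) \<in> carrier R"
      using M sj by (intro finprod_closed) (auto simp: entries_closed_def)
    ultimately have "diagonal_product v M \<sigma> = \<zero>"
      using diagonal_product_remove [OF M s kv] by simp
    then show ?thesis using False by auto
  qed (simp add: evenperm_id)
  then have "determinant R v M =
      (\<Oplus>\<sigma> \<in> {\<sigma>. \<sigma> permutes {1..v}}. if id = \<sigma> then diagonal_product v M \<sigma> else \<zero>)"
    unfolding determinant_eq using diagonal_product_closed [OF M] by (intro finsum_cong') auto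
  also have "\<dots> = diagonal_product v M id"
    using diagonal_product_closed [OF M]
    by (intro finsum_singleton) (auto simp: finite_permutations permutes_id)
  finally show ?thesis by (simp add: diagonal_product_def)
qed

end

end

section \<open>Central subrings with a dual frame\<close>

lemma frag_extend_minus_fun:
  "frag_extend (\<lambda>x. f x - g x) u = frag_extend f u - frag_extend g u"
  unfolding frag_extend_def sum_subtractf [symmetric]
  by (intro sum.cong refl poly_mapping_eqI) (simp add: lookup_minus right_diff_distrib)

lemma frag_extend_zero_fun: "frag_extend (\<lambda>x. 0) u = 0"
  by (simp add: frag_extend_def)

locale central_subring = ring B for B (structure) +
  fixes R :: "'a set"
  assumes R_subring: "subring R B" and R_central: "R \<subseteq> center B"
    and R_domain: "domain (B\<lparr>carrier := R\<rparr>)"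
begin

abbreviation "S \<equiv> B\<lparr>carrier := R\<rparr>"
abbreviation "F \<equiv> fraction_field S"

sublocale S: domain S
  rewrites "carrier S = R" and "monoid.mult S = monoid.mult B" and "one S = \<one>"
    and "ring.zero S = \<zero>" and "ring.add S = ring.add B"
  by (rule R_domain) simp_all

sublocale F: field F
  by (rule S.field_fraction_field)

lemma R_carrier: "r \<in> R \<Longrightarrow> r \<in> carrier B"
  using subringE(1) [OF R_subring] by blast

lemma R_comm: "r \<in> R \<Longrightarrow> b \<in> carrier B \<Longrightarrow> b \<otimes> r = r \<otimes> b"
  using R_central by (auto simp: center_def)

text \<open>\<open>finsum\<close> refers to the carrier of its record, so sums over the subring and
  over \<open>B\<close> are different terms and have to be identified.\<close>

lemma finsum_S:
  assumes "finite A" "\<And>i. i \<in> A \<Longrightarrow> f i \<in> R"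
  shows "finsum S f A = finsum B f A \<and> finsum B f A \<in> R"
  using assms
proof (induction A)
  case empty
  then show ?case by simp
next
  case (insert x A)
  then have "finsum S f (insert x A) = f x \<oplus> finsum S f A"
    by (subst S.finsum_insert) auto
  moreover have "finsum B f (insert x A) = f x \<oplus> finsum B f A"
    using insert R_carrier by (subst finsum_insert) auto
  ultimately show ?case using insert by auto
qed

lemma fraction_of_add_same:
  assumes "a \<in> R" "b \<in> R" "s \<in> R" "s \<noteq> \<zero>"
  shows "fraction_of S (a \<oplus> b) s = fraction_of S a s \<oplus>\<^bsub>F\<^esub> fraction_of S b s"
proof -
  have "s \<in> R - {\<zero>}" using assms by simp
  note nz = this S.mult_nonzero [OF this this]
  show ?thesis
    using assms nz by (simp add: S.fraction_of_add S.fraction_of_eq_iff S.l_distr S.r_distr S.m_ac)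
qed

lemma fraction_of_finsum:
  assumes "finite A" "\<And>i. i \<in> A \<Longrightarrow> f i \<in> R" "s \<in> R" "s \<noteq> \<zero>"
  shows "fraction_of S (finsum B f A) s = (\<Oplus>\<^bsub>F\<^esub>i\<in>A. fraction_of S (f i) s)"
  using assms(1,2)
proof (induction A)
  case empty
  show ?case using assms(3,4)
    by (simp add: S.fraction_field_zero S.fraction_of_eq_iff)
next
  case (insert x A)
  have c: "fraction_of S (f i) s \<in> carrier F" if "i \<in> insert x A" for i
    using insert.prems [OF that] assms(3,4) by (intro S.fraction_of_in_carrier) auto
  have f: "f i \<in> carrier B" if "i \<in> insert x A" for i
    using insert.prems [OF that] R_carrier by blast
  have s: "finsum B f A \<in> R"
    using insert finsum_S [of A f] by auto
  have "finsum B f (insert x A) = f x \<oplus> finsum B f A"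
    using insert.hyps f by (intro finsum_insert) auto
  moreover have "(\<Oplus>\<^bsub>F\<^esub>i\<in>insert x A. fraction_of S (f i) s) =
    fraction_of S (f x) s \<oplus>\<^bsub>F\<^esub> (\<Oplus>\<^bsub>F\<^esub>i\<in>A. fraction_of S (f i) s)"
    using insert.hyps c by (intro F.finsum_insert) auto
  ultimately show ?case
    using insert s assms(3,4) by (simp add: fraction_of_add_same)
qed

end

text \<open>A replacement for a basis when \<open>B\<close> is not free over \<open>R\<close>: the
  \<open>e i\<close> expand every element after multiplication by \<open>z\<close>, with
  coefficients given by the \<open>\<kappa> i\<close>. Over the fraction field they become a basis
  with coordinate functions \<open>\<kappa> i\<close> divided by \<open>z\<close>.\<close>

locale dual_frame = central_subring B R for B (structure) and R +
  fixes I :: "'i set" and e :: "'i \<Rightarrow> 'a" and \<kappa> :: "'i \<Rightarrow> 'a \<Rightarrow> 'a" and z :: 'a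
  assumes finite_I: "finite I"
    and z: "z \<in> R" "z \<noteq> \<zero>"
    and e_closed: "\<And>i. i \<in> I \<Longrightarrow> e i \<in> carrier B"
    and \<kappa>_closed: "\<And>i b. i \<in> I \<Longrightarrow> b \<in> carrier B \<Longrightarrow> \<kappa> i b \<in> R"
    and \<kappa>_add: "\<And>i b c. i \<in> I \<Longrightarrow> b \<in> carrier B \<Longrightarrow> c \<in> carrier B \<Longrightarrow> \<kappa> i (b \<oplus> c) = \<kappa> i b \<oplus> \<kappa> i c"
    and \<kappa>_mult: "\<And>i r b. i \<in> I \<Longrightarrow> r \<in> R \<Longrightarrow> b \<in> carrier B \<Longrightarrow> \<kappa> i (r \<otimes> b) = r \<otimes> \<kappa> i b"
    and \<kappa>_e: "\<And>i j. i \<in> I \<Longrightarrow> j \<in> I \<Longrightarrow> \<kappa> i (e j) = (if i = j then z else \<zero>)"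
    and expand: "\<And>b. b \<in> carrier B \<Longrightarrow> z \<otimes> b = (\<Oplus>i\<in>I. \<kappa> i b \<otimes> e i)"
begin

section \<open>Extension of scalars in coordinates\<close>

abbreviation "W \<equiv> carrier B \<times> carrier F"
abbreviation "G \<equiv> free_Abelian_group W"
abbreviation "rel \<equiv> tensor_relations B R F (frac_embed S)"
abbreviation "N \<equiv> generate G rel"
abbreviation "E \<equiv> generic_algebra B R"

definition coef :: "'i \<Rightarrow> 'a \<Rightarrow> ('a \<times> 'a) set" where
  "coef i b = fraction_of S (\<kappa> i b) z"

lemma coef_closed: "i \<in> I \<Longrightarrow> b \<in> carrier B \<Longrightarrow> coef i b \<in> carrier F"
  unfolding coef_def using \<kappa>_closed z by (intro S.fraction_of_in_carrier) auto

lemma coef_add: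
  "i \<in> I \<Longrightarrow> b \<in> carrier B \<Longrightarrow> c \<in> carrier B \<Longrightarrow> coef i (b \<oplus> c) = coef i b \<oplus>\<^bsub>F\<^esub> coef i c"
  unfolding coef_def using \<kappa>_closed z by (simp add: \<kappa>_add fraction_of_add_same)

lemma coef_mult:
  assumes "i \<in> I" "r \<in> R" "b \<in> carrier B"
  shows "coef i (r \<otimes> b) = frac_embed S r \<otimes>\<^bsub>F\<^esub> coef i b"
proof -
  have "z \<in> R - {\<zero>}" using z by simp
  then show ?thesis
    unfolding coef_def frac_embed_def
    using assms \<kappa>_closed z S.one_nonzero by (simp add: \<kappa>_mult S.fraction_of_mult R_carrier)
qed

lemma coef_e: "i \<in> I \<Longrightarrow> j \<in> I \<Longrightarrow> coef i (e j) = (if i = j then \<one>\<^bsub>F\<^esub> else \<zero>\<^bsub>F\<^esub>)"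
  unfolding coef_def S.fraction_field_zero S.fraction_field_one
  using z S.one_nonzero by (simp add: \<kappa>_e S.fraction_of_eq_iff)

lemma coef_finsum:
  assumes "i \<in> I" "finite A" "\<And>j. j \<in> A \<Longrightarrow> f j \<in> carrier B"
  shows "coef i (\<Oplus>j\<in>A. f j) = (\<Oplus>\<^bsub>F\<^esub>j\<in>A. coef i (f j))"
  using assms(2,3)
proof (induction A)
  case empty
  have "coef i (\<zero> \<otimes> \<zero>) = frac_embed S \<zero> \<otimes>\<^bsub>F\<^esub> coef i \<zero>"
    by (rule coef_mult [OF assms(1)]) auto
  moreover have "frac_embed S \<zero> = \<zero>\<^bsub>F\<^esub>"
    by (simp add: frac_embed_def S.fraction_field_zero)
  ultimately show ?case using coef_closed [OF assms(1), of \<zero>] by simp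
next
  case (insert x A)
  have "finsum B f (insert x A) = f x \<oplus> finsum B f A"
    using insert by (intro finsum_insert) auto
  moreover have "(\<Oplus>\<^bsub>F\<^esub>j\<in>insert x A. coef i (f j)) = coef i (f x) \<oplus>\<^bsub>F\<^esub> (\<Oplus>\<^bsub>F\<^esub>j\<in>A. coef i (f j))"
    using insert assms(1) by (intro F.finsum_insert) (auto intro!: coef_closed)
  ultimately show ?case
    using insert assms(1) by (simp add: coef_add)
qed

lemma embed_z: "frac_embed S z \<in> carrier F" "frac_embed S z \<noteq> \<zero>\<^bsub>F\<^esub>"
proof -
  show "frac_embed S z \<in> carrier F"
    using S.frac_embed_closed z by simp
  show "frac_embed S z \<noteq> \<zero>\<^bsub>F\<^esub>"
    using z S.one_nonzero
    by (simp add: frac_embed_def S.fraction_field_zero S.fraction_of_eq_iff)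
qed

lemma embed_\<kappa>: 
  assumes "i \<in> I" "b \<in> carrier B"
  shows "frac_embed S (\<kappa> i b) = frac_embed S z \<otimes>\<^bsub>F\<^esub> coef i b"
proof -
  have "z \<in> R - {\<zero>}" using z by simp
  then show ?thesis
    unfolding coef_def frac_embed_def
    using assms \<kappa>_closed z S.one_nonzero by (simp add: S.fraction_of_mult S.fraction_of_eq_iff
        S.m_comm)
qed

lemma coef_prod:
  assumes i: "i \<in> I" and b: "b \<in> carrier B" "c \<in> carrier B"
  shows "coef i (b \<otimes> c) = (\<Oplus>\<^bsub>F\<^esub>j\<in>I. coef i (b \<otimes> e j) \<otimes>\<^bsub>F\<^esub> coef j c)"
proof -
  have zR: "z \<in> carrier B" using z R_carrier by blast
  have \<kappa>R: "\<kappa> j c \<in> carrier B" if "j \<in> I" for j using that b \<kappa>_closed R_carrier by blast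
  have cl: "coef i (b \<otimes> e j) \<in> carrier F" "coef j c \<in> carrier F" if "j \<in> I" for j
    using that i b e_closed coef_closed by auto
  \<comment> \<open>Only \<open>z \<otimes> c\<close> can be expanded inside \<open>B\<close>, so
    the identity is proved after multiplication by \<open>z\<close>, which is then cancelled in the
    field.\<close>
  have "frac_embed S z \<otimes>\<^bsub>F\<^esub> coef i (b \<otimes> c) = coef i (z \<otimes> (b \<otimes> c))"
    using i b z by (simp add: coef_mult)
  also have "z \<otimes> (b \<otimes> c) = b \<otimes> (z \<otimes> c)"
    using b zR R_comm [OF z(1) b(1)] by (simp add: m_assoc [symmetric])
  also have "\<dots> = (\<Oplus>j\<in>I. b \<otimes> (\<kappa> j c \<otimes> e j))"
    unfolding expand [OF b(2)] using b \<kappa>R e_closed finite_I by (intro finsum_rdistr) auto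
  also have "\<dots> = (\<Oplus>j\<in>I. \<kappa> j c \<otimes> (b \<otimes> e j))"
    using b \<kappa>R e_closed R_comm [OF \<kappa>_closed b(1)]
    by (intro finsum_cong') (auto simp: m_assoc [symmetric])
  also have "coef i \<dots> = (\<Oplus>\<^bsub>F\<^esub>j\<in>I. coef i (\<kappa> j c \<otimes> (b \<otimes> e j)))"
    using i b \<kappa>R e_closed finite_I by (intro coef_finsum) auto
  also have "\<dots> = (\<Oplus>\<^bsub>F\<^esub>j\<in>I. frac_embed S z \<otimes>\<^bsub>F\<^esub> (coef i (b \<otimes> e j) \<otimes>\<^bsub>F\<^esub> coef j c))"
  proof (intro F.finsum_cong' refl)
    fix j assume j: "j \<in> I"
    have "coef i (\<kappa> j c \<otimes> (b \<otimes> e j)) = frac_embed S (\<kappa> j c) \<otimes>\<^bsub>F\<^esub> coef i (b \<otimes> e j)"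
      using i j b e_closed \<kappa>_closed by (intro coef_mult) auto
    then show "coef i (\<kappa> j c \<otimes> (b \<otimes> e j)) = frac_embed S z \<otimes>\<^bsub>F\<^esub> (coef i (b \<otimes> e j) \<otimes>\<^bsub>F\<^esub> coef j c)"
      using cl [OF j] embed_z(1) by (simp add: embed_\<kappa> j b F.m_ac)
  qed (use cl embed_z(1) in auto)
  also have "\<dots> = frac_embed S z \<otimes>\<^bsub>F\<^esub> (\<Oplus>\<^bsub>F\<^esub>j\<in>I. coef i (b \<otimes> e j) \<otimes>\<^bsub>F\<^esub> coef j c)"
    using cl embed_z(1) finite_I by (intro F.finsum_rdistr [symmetric]) auto
  finally have eq: "frac_embed S z \<otimes>\<^bsub>F\<^esub> coef i (b \<otimes> c) = \<dots>" .
  have "(\<Oplus>\<^bsub>F\<^esub>j\<in>I. coef i (b \<otimes> e j) \<otimes>\<^bsub>F\<^esub> coef j c) \<in> carrier F"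
    using cl by (intro F.finsum_closed) auto
  then show ?thesis
    using eq embed_z coef_closed [OF i, of "b \<otimes> c"] b by (simp add: F.m_lcancel)
qed

text \<open>The universal property of the free abelian group extends the value prescribed on symbols
  \<open>(b, f)\<close>; that the result respects the tensor relations is shown in
  \<open>ev_N\<close>.\<close>

lemma coordinate_map:
  "\<exists>h. h \<in> hom G (add_monoid F) \<and> (\<forall>b\<in>carrier B. \<forall>f\<in>carrier F. h (frag_of (b, f)) =
      coef i b \<otimes>\<^bsub>F\<^esub> f)"
  if "i \<in> I"
proof -
  have cg: "comm_group (add_monoid F)"
    by (rule F.a_comm_group)
  have "(\<lambda>(b, f). coef i b \<otimes>\<^bsub>F\<^esub> f) ` W \<subseteq> carrier (add_monoid F)"
    using coef_closed [OF that] by auto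
  from comm_group.free_Abelian_group_universal [OF cg this]
  obtain h where "h \<in> hom G (add_monoid F)"
    "\<And>x. x \<in> W \<Longrightarrow> h (frag_of x) = (case x of (b, f) \<Rightarrow> coef i b \<otimes>\<^bsub>F\<^esub> f)"
    by blast
  then show ?thesis by auto
qed

definition ev :: "'i \<Rightarrow> ('a \<times> ('a \<times> 'a) set \<Rightarrow>\<^sub>0 int) \<Rightarrow> ('a \<times> 'a) set" where
  "ev i = (SOME h. h \<in> hom G (add_monoid F) \<and>
    (\<forall>b\<in>carrier B. \<forall>f\<in>carrier F. h (frag_of (b, f)) = coef i b \<otimes>\<^bsub>F\<^esub> f))"

lemma ev_hom: "i \<in> I \<Longrightarrow> ev i \<in> hom G (add_monoid F)"
  and ev_of: "i \<in> I \<Longrightarrow> b \<in> carrier B \<Longrightarrow> f \<in> carrier F \<Longrightarrow> ev i (frag_of (b, f)) = coef i b \<otimes>\<^bsub>F\<^esub> f"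
  using someI_ex [OF coordinate_map] unfolding ev_def [symmetric] by blast+

abbreviation tensors :: "('a \<times> ('a \<times> 'a) set \<Rightarrow>\<^sub>0 int) set"
  where "tensors \<equiv> {u. Poly_Mapping.keys u \<subseteq> W}"

lemma tensors_add: "u \<in> tensors \<Longrightarrow> v \<in> tensors \<Longrightarrow> u + v \<in> tensors"
  and tensors_diff: "u \<in> tensors \<Longrightarrow> v \<in> tensors \<Longrightarrow> u - v \<in> tensors"
  and tensors_minus: "u \<in> tensors \<Longrightarrow> - u \<in> tensors"
  and tensors_of: "b \<in> carrier B \<Longrightarrow> f \<in> carrier F \<Longrightarrow> frag_of (b, f) \<in> tensors"
  and tensors_zero: "0 \<in> tensors"
  using keys_add [of u v] keys_diff [of u v] by auto

lemma ev_closed: "i \<in> I \<Longrightarrow> u \<in> tensors \<Longrightarrow> ev i u \<in> carrier F"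
  using hom_in_carrier [OF ev_hom] by fastforce

lemma ev_add: "i \<in> I \<Longrightarrow> u \<in> tensors \<Longrightarrow> v \<in> tensors \<Longrightarrow> ev i (u + v) = ev i u \<oplus>\<^bsub>F\<^esub> ev i v"
  using hom_mult [OF ev_hom, of i u v] by simp

lemma ev_zero: assumes "i \<in> I" shows "ev i 0 = \<zero>\<^bsub>F\<^esub>"
  using ev_add [OF assms, of 0 0] ev_closed [OF assms, of 0] by simp

lemma ev_minus: assumes "i \<in> I" "u \<in> tensors" shows "ev i (- u) = \<ominus>\<^bsub>F\<^esub> ev i u"
proof -
  have "ev i (- u) \<oplus>\<^bsub>F\<^esub> ev i u = \<zero>\<^bsub>F\<^esub>"
    using ev_add [OF assms(1) tensors_minus [OF assms(2)] assms(2)] ev_zero [OF assms(1)] by simp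
  then show ?thesis
    using ev_closed [OF assms] ev_closed [OF assms(1) tensors_minus [OF assms(2)]]
    by (simp add: F.minus_equality)
qed

lemma ev_diff: 
  assumes "i \<in> I" "u \<in> tensors" "v \<in> tensors" 
  shows "ev i (u - v) = ev i u \<ominus>\<^bsub>F\<^esub> ev i v"
  using ev_add [OF assms(1,2) tensors_minus [OF assms(3)]] ev_minus [OF assms(1,3)]
  by (simp add: F.minus_eq)

lemma tensors_induct [consumes 1, case_names zero diff of]:
  assumes "u \<in> tensors" "Q 0"
    "\<And>u v. u \<in> tensors \<Longrightarrow> v \<in> tensors \<Longrightarrow> Q u \<Longrightarrow> Q v \<Longrightarrow> Q (u - v)"
    "\<And>b f. b \<in> carrier B \<Longrightarrow> f \<in> carrier F \<Longrightarrow> Q (frag_of (b, f))"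
  shows "Q u"
  using assms by (intro free_Abelian_group_induct [of u W Q]) auto

lemma relE:
  assumes "u \<in> rel"
  obtains (left) b b' f where "u = frag_of (b \<oplus> b', f) - frag_of (b, f) - frag_of (b', f)"
      "b \<in> carrier B" "b' \<in> carrier B" "f \<in> carrier F"
  | (right) b f f' where "u = frag_of (b, f \<oplus>\<^bsub>F\<^esub> f') - frag_of (b, f) - frag_of (b, f')"
      "b \<in> carrier B" "f \<in> carrier F" "f' \<in> carrier F"
  | (balance) r b f where "u = frag_of (r \<otimes> b, f) - frag_of (b, frac_embed S r \<otimes>\<^bsub>F\<^esub> f)"
      "r \<in> R" "b \<in> carrier B" "f \<in> carrier F"
  using assms unfolding tensor_relations_def by blast

lemma rel_tensors: "rel \<subseteq> tensors"
proof
  fix u assume "u \<in> rel"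
  then show "u \<in> tensors"
  proof (cases rule: relE)
    case (left b b' f)
    then show ?thesis by (metis tensors_of tensors_diff a_closed)
  next
    case (right b f f')
    then show ?thesis by (metis tensors_of tensors_diff F.a_closed)
  next
    case (balance r b f)
    have "frac_embed S r \<in> carrier F" using balance S.frac_embed_closed by simp
    with balance show ?thesis by (metis tensors_of tensors_diff m_closed F.m_closed R_carrier)
  qed
qed

lemma N_subgroup: "subgroup N G"
  using rel_tensors by (intro group.generate_is_subgroup) auto

lemma N_tensors: "u \<in> N \<Longrightarrow> u \<in> tensors"
  using subgroup.mem_carrier [OF N_subgroup] by auto

lemma N_zero: "0 \<in> N"
  using subgroup.one_closed [OF N_subgroup] by simp

lemma N_add: "u \<in> N \<Longrightarrow> v \<in> N \<Longrightarrow> u + v \<in> N"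
  using subgroup.m_closed [OF N_subgroup, of u v] by simp

lemma N_minus: "u \<in> N \<Longrightarrow> - u \<in> N"
  using subgroup.m_inv_closed [OF N_subgroup, of u] N_tensors [of u] by simp

lemma N_diff: "u \<in> N \<Longrightarrow> v \<in> N \<Longrightarrow> u - v \<in> N"
  using N_add [OF _ N_minus, of u v] by simp

lemma N_sum: "(\<And>a. a \<in> A \<Longrightarrow> f a \<in> N) \<Longrightarrow> sum f A \<in> N"
  by (induction A rule: infinite_finite_induct) (auto intro: N_zero N_add)

lemma N_add_left:
  "b \<in> carrier B \<Longrightarrow> b' \<in> carrier B \<Longrightarrow> f \<in> carrier F \<Longrightarrow>
    frag_of (b \<oplus> b', f) - frag_of (b, f) - frag_of (b', f) \<in> N"
  by (rule generate.incl) (auto simp: tensor_relations_def)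

lemma N_add_right:
  "b \<in> carrier B \<Longrightarrow> f \<in> carrier F \<Longrightarrow> f' \<in> carrier F \<Longrightarrow>
    frag_of (b, f \<oplus>\<^bsub>F\<^esub> f') - frag_of (b, f) - frag_of (b, f') \<in> N"
  by (rule generate.incl) (auto simp: tensor_relations_def)

lemma N_balance:
  "r \<in> R \<Longrightarrow> b \<in> carrier B \<Longrightarrow> f \<in> carrier F \<Longrightarrow>
    frag_of (r \<otimes> b, f) - frag_of (b, frac_embed S r \<otimes>\<^bsub>F\<^esub> f) \<in> N"
  by (rule generate.incl) (auto simp: tensor_relations_def)

text \<open>The relation for zero plus zero reduces to minus the symbol itself.\<close>

lemma N_zero_left: "f \<in> carrier F \<Longrightarrow> frag_of (\<zero>, f) \<in> N"
  using N_minus [OF N_add_left [of \<zero> \<zero> f]] by simp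

lemma N_zero_right: "b \<in> carrier B \<Longrightarrow> frag_of (b, \<zero>\<^bsub>F\<^esub>) \<in> N"
  using N_minus [OF N_add_right [of b "\<zero>\<^bsub>F\<^esub>" "\<zero>\<^bsub>F\<^esub>"]] by simp

lemma N_induct [consumes 1, case_names zero add minus left right balance]:
  assumes "u \<in> N" "Q 0"
    "\<And>u v. Q u \<Longrightarrow> Q v \<Longrightarrow> Q (u + v)" "\<And>u. Q u \<Longrightarrow> Q (- u)"
    "\<And>b b' f. b \<in> carrier B \<Longrightarrow> b' \<in> carrier B \<Longrightarrow> f \<in> carrier F \<Longrightarrow>
      Q (frag_of (b \<oplus> b', f) - frag_of (b, f) - frag_of (b', f))"
    "\<And>b f f'. b \<in> carrier B \<Longrightarrow> f \<in> carrier F \<Longrightarrow> f' \<in> carrier F \<Longrightarrow>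
      Q (frag_of (b, f \<oplus>\<^bsub>F\<^esub> f') - frag_of (b, f) - frag_of (b, f'))"
    "\<And>r b f. r \<in> R \<Longrightarrow> b \<in> carrier B \<Longrightarrow> f \<in> carrier F \<Longrightarrow>
      Q (frag_of (r \<otimes> b, f) - frag_of (b, frac_embed S r \<otimes>\<^bsub>F\<^esub> f))"
  shows "Q u"
proof -
  have rel: "Q u" if "u \<in> rel" for u
    using that by (cases rule: relE) (simp_all only: assms(5-7))
  show ?thesis
    using assms(1)
  proof (induction u rule: generate.induct)
    case one
    then show ?case using assms(2) by simp
  next
    case (incl h)
    then show ?case using rel by simp
  next
    case (inv h)
    then have "inv\<^bsub>G\<^esub> h = - h" using rel_tensors by (intro inv_free_Abelian_group) auto
    then show ?case using inv rel assms(4) by metis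
  next
    case (eng h1 h2)
    then show ?case using assms(3) by simp
  qed
qed

text \<open>Additivity and \<open>R\<close>-linearity of \<open>coef i\<close> make the coordinates
  vanish on each kind of relation, so they descend to the tensor product.\<close>

lemma ev_N:
  assumes "i \<in> I" "u \<in> N"
  shows "ev i u = \<zero>\<^bsub>F\<^esub>"
proof -
  have "u \<in> tensors \<and> ev i u = \<zero>\<^bsub>F\<^esub>"
    using assms(2)
  proof (induction u rule: N_induct)
    case zero
    then show ?case using ev_zero [OF assms(1)] by simp
  next
    case (add u v)
    then show ?case using ev_add [OF assms(1)] tensors_add by (metis F.l_zero F.zero_closed)
  next
    case (minus u)
    then show ?case using ev_minus [OF assms(1), of u] tensors_minus by (metis F.minus_zero)
  next
    case (left b b' f)
    note t = tensors_of [OF a_closed [OF left(1,2)] left(3)] tensors_of [OF left(1,3)] tensors_of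
        [OF left(2,3)]
    show ?case
      using left assms(1) coef_closed [OF assms(1)] tensors_diff [OF tensors_diff [OF t(1,2)] t(3)]
      unfolding ev_diff [OF assms(1) tensors_diff [OF t(1,2)] t(3)] ev_diff [OF assms(1) t(1,2)]
      by (simp add: ev_of coef_add F.minus_eq F.l_distr F.minus_add F.a_ac F.r_neg F.r_neg1)
  next
    case (right b f f')
    note t = tensors_of [OF right(1) F.a_closed [OF right(2,3)]] tensors_of [OF right(1,2)]
        tensors_of [OF right(1,3)]
    show ?case
      using right assms(1) coef_closed [OF assms(1)] tensors_diff [OF tensors_diff [OF t(1,2)] t(3)]
      unfolding ev_diff [OF assms(1) tensors_diff [OF t(1,2)] t(3)] ev_diff [OF assms(1) t(1,2)]
      by (simp add: ev_of F.minus_eq F.r_distr F.a_ac F.r_neg F.r_neg1)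
  next
    case (balance r b f)
    have r: "frac_embed S r \<in> carrier F" using balance S.frac_embed_closed by blast
    note t = tensors_of [OF m_closed [OF R_carrier [OF balance(1)] balance(2)] balance(3)]
      tensors_of [OF balance(2) F.m_closed [OF r balance(3)]]
    show ?case
      using balance r R_carrier assms(1) coef_closed [OF assms(1)] tensors_diff [OF t]
      unfolding ev_diff [OF assms(1) t]
      by (simp add: ev_of coef_mult F.minus_eq F.m_ac F.r_neg)
  qed
  then show ?thesis ..
qed

lemma N_finsum:
  assumes "finite A" "\<And>a. a \<in> A \<Longrightarrow> x a \<in> carrier B" "f \<in> carrier F"
  shows "frag_of (\<Oplus>a\<in>A. x a, f) - (\<Sum>a\<in>A. frag_of (x a, f)) \<in> N"
  using assms(1,2)
proof (induction A)
  case empty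
  then show ?case using N_zero_left [OF assms(3)] by simp
next
  case (insert y A)
  have s: "(\<Oplus>a\<in>insert y A. x a) = x y \<oplus> (\<Oplus>a\<in>A. x a)" "(\<Oplus>a\<in>A. x a) \<in> carrier B"
    using insert by (auto intro!: finsum_insert finsum_closed)
  have "(frag_of (x y \<oplus> (\<Oplus>a\<in>A. x a), f) - frag_of (x y, f) - frag_of (\<Oplus>a\<in>A. x a, f)) +
    (frag_of (\<Oplus>a\<in>A. x a, f) - (\<Sum>a\<in>A. frag_of (x a, f))) \<in> N"
    using insert s assms(3) by (intro N_add N_add_left) auto
  then show ?case
    using insert s by (simp add: algebra_simps)
qed

text \<open>Normal form of a tensor: modulo relations it is the sum of the \<open>e i\<close>
  tensored with its coordinates. For a symbol \<open>(b, f)\<close> one writes \<open>f\<close> as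
  \<open>z\<close> times \<open>g\<close>, moves \<open>z\<close> across to \<open>b\<close> and
  expands \<open>z \<otimes> b\<close>.\<close>

lemma tensor_reduce:
  assumes "u \<in> tensors"
  shows "u - (\<Sum>i\<in>I. frag_of (e i, ev i u)) \<in> N"
  using assms
proof (induction u rule: tensors_induct)
  case zero
  have "(\<Sum>i\<in>I. frag_of (e i, \<zero>\<^bsub>F\<^esub>)) \<in> N"
    using N_zero_right e_closed by (intro N_sum) blast
  then show ?case using N_minus by (simp add: ev_zero)
next
  case (diff u v)
  have 1: "frag_of (e i, ev i u) - frag_of (e i, ev i v) - frag_of (e i, ev i (u - v)) \<in> N"
    if i: "i \<in> I" for i
  proof -
    have c: "ev i u \<in> carrier F" "ev i v \<in> carrier F" "ev i (u - v) \<in> carrier F"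
      using i diff ev_closed tensors_diff [of u v] by simp_all
    have "ev i (u - v) \<oplus>\<^bsub>F\<^esub> ev i v = ev i u"
      using c i diff by (simp add: ev_diff F.minus_eq F.a_assoc F.l_neg)
    then show ?thesis
      using N_add_right [OF e_closed [OF i] c(3,2)] by (simp add: algebra_simps)
  qed
  have "(u - (\<Sum>i\<in>I. frag_of (e i, ev i u))) - (v - (\<Sum>i\<in>I. frag_of (e i, ev i v))) +
    (\<Sum>i\<in>I. frag_of (e i, ev i u) - frag_of (e i, ev i v) - frag_of (e i, ev i (u - v))) \<in> N"
    by (rule N_add [OF N_diff [OF diff(3,4)] N_sum [OF 1]])
  then show ?case by (simp add: sum_subtractf sum.distrib algebra_simps)
next
  case (of b f)
  \<comment> \<open>The inverse of \<open>z\<close> in the fraction field, which makes the second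
    factor divisible by \<open>z\<close>.\<close>
  obtain y where y: "y \<in> carrier F" "frac_embed S z \<otimes>\<^bsub>F\<^esub> y = \<one>\<^bsub>F\<^esub>"
    using embed_z F.field_Units F.Units_r_inv F.Units_inv_closed by (metis DiffI singletonD)
  define g where "g = y \<otimes>\<^bsub>F\<^esub> f"
  have g: "g \<in> carrier F" "frac_embed S z \<otimes>\<^bsub>F\<^esub> g = f"
    using y of embed_z(1) unfolding g_def by (auto simp: F.m_assoc [symmetric])
  have \<kappa>: "\<kappa> i b \<in> R" "\<kappa> i b \<in> carrier B" if "i \<in> I" for i
    using \<kappa>_closed [OF that of(1)] R_carrier by auto
  have 1: "frag_of (z \<otimes> b, g) - frag_of (b, f) \<in> N"
    using N_balance [OF z(1) of(1) g(1)] g(2) by simp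
  have 2: "frag_of (z \<otimes> b, g) - (\<Sum>i\<in>I. frag_of (\<kappa> i b \<otimes> e i, g)) \<in> N"
    unfolding expand [OF of(1)] using \<kappa> e_closed finite_I g by (intro N_finsum) auto
  have 3: "frag_of (\<kappa> i b \<otimes> e i, g) - frag_of (e i, ev i (frag_of (b, f))) \<in> N" if i: "i \<in> I" for i
  proof -
    have "frac_embed S (\<kappa> i b) \<otimes>\<^bsub>F\<^esub> g = coef i b \<otimes>\<^bsub>F\<^esub> (frac_embed S z \<otimes>\<^bsub>F\<^esub> g)"
      using embed_z(1) coef_closed [OF i of(1)] g(1) by (simp add: embed_\<kappa> i of F.m_ac)
    then have "ev i (frag_of (b, f)) = frac_embed S (\<kappa> i b) \<otimes>\<^bsub>F\<^esub> g"
      using i of g(2) by (simp add: ev_of)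
    then show ?thesis
      using N_balance [OF \<kappa>(1) [OF i] e_closed [OF i] g(1)] by simp
  qed
  have "(frag_of (z \<otimes> b, g) - (\<Sum>i\<in>I. frag_of (\<kappa> i b \<otimes> e i, g))) - (frag_of (z \<otimes> b, g) - frag_of (b,
      f)) +
     (\<Sum>i\<in>I. frag_of (\<kappa> i b \<otimes> e i, g) - frag_of (e i, ev i (frag_of (b, f)))) \<in> N"
    by (rule N_add [OF N_diff [OF 2 1] N_sum [OF 3]])
  then show ?case by (simp add: sum_subtractf sum.distrib algebra_simps)
qed

text \<open>The relation subgroup is exactly the common kernel of the coordinates. From here on,
  identities in the tensor product are checked on coordinates.\<close>

lemma N_iff: "u \<in> N \<longleftrightarrow> u \<in> tensors \<and> (\<forall>i\<in>I. ev i u = \<zero>\<^bsub>F\<^esub>)"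
proof (intro iffI conjI)
  assume u: "u \<in> tensors \<and> (\<forall>i\<in>I. ev i u = \<zero>\<^bsub>F\<^esub>)"
  then have "u - (\<Sum>i\<in>I. frag_of (e i, \<zero>\<^bsub>F\<^esub>)) \<in> N"
    using tensor_reduce [of u] by simp
  moreover have "(\<Sum>i\<in>I. frag_of (e i, \<zero>\<^bsub>F\<^esub>)) \<in> N"
    using N_zero_right e_closed by (intro N_sum) blast
  ultimately have "(u - (\<Sum>i\<in>I. frag_of (e i, \<zero>\<^bsub>F\<^esub>))) + (\<Sum>i\<in>I. frag_of (e i, \<zero>\<^bsub>F\<^esub>)) \<in> N"
    by (rule N_add)
  then show "u \<in> N" by simp
qed (use N_tensors ev_N in auto)

definition cl where "cl u = N #>\<^bsub>G\<^esub> u"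

lemma cl_eq:
  assumes "u \<in> tensors"
  shows "cl u = {v \<in> tensors. \<forall>i\<in>I. ev i v = ev i u}"
proof -
  have "v \<in> cl u \<longleftrightarrow> v - u \<in> N" for v
  proof -
    have "v \<in> cl u \<longleftrightarrow> (\<exists>h\<in>N. v = h + u)" by (simp add: cl_def r_coset_def)
    also have "\<dots> \<longleftrightarrow> v - u \<in> N" by (metis diff_add_cancel add_diff_cancel)
    finally show ?thesis .
  qed
  moreover have "v - u \<in> N \<longleftrightarrow> v \<in> tensors \<and> (\<forall>i\<in>I. ev i v = ev i u)" for v
  proof -
    have t: "v - u \<in> tensors \<longleftrightarrow> v \<in> tensors"
      using tensors_diff [of v u] tensors_add [of "v - u" u] assms by auto
    have "ev i (v - u) = \<zero>\<^bsub>F\<^esub> \<longleftrightarrow> ev i v = ev i u" if "v \<in> tensors" "i \<in> I" for i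
      using ev_diff [OF that(2,1) assms] ev_closed [OF that(2)] that(1) assms
      by (metis F.r_right_minus_eq)
    then show ?thesis unfolding N_iff t by blast
  qed
  ultimately show ?thesis by blast
qed

lemma cl_mem: "u \<in> tensors \<Longrightarrow> u \<in> cl u"
  by (simp add: cl_eq)

lemma cl_cong: 
  assumes "u \<in> tensors" "v \<in> tensors" "\<And>i. i \<in> I \<Longrightarrow> ev i u = ev i v" shows "cl u = cl v"
  using assms by (simp add: cl_eq)

lemma cl_memD: "v \<in> cl u \<Longrightarrow> u \<in> tensors \<Longrightarrow> v \<in> tensors \<and> (\<forall>i\<in>I. ev i v = ev i u)"
  by (simp add: cl_eq)

lemma E_carrier: "carrier E = cl ` tensors"
  by (auto simp: generic_algebra_def extension_of_scalars_def Let_def FactGroup_def RCOSETS_def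
      cl_def)

lemma E_zero: "\<zero>\<^bsub>E\<^esub> = cl 0"
proof -
  have "N = cl 0" unfolding cl_def r_coset_def by simp
  then show ?thesis
    by (simp add: generic_algebra_def extension_of_scalars_def Let_def FactGroup_def)
qed

lemma E_add:
  assumes "u \<in> tensors" "v \<in> tensors"
  shows "cl u \<oplus>\<^bsub>E\<^esub> cl v = cl (u + v)"
proof -
  have "N \<lhd> G"
    by (rule comm_group.subgroup_imp_normal [OF abelian_free_Abelian_group N_subgroup])
  then have "cl u <#>\<^bsub>G\<^esub> cl v = cl (u + v)"
    using normal.rcos_sum [of N G u v] assms by (simp add: cl_def)
  then show ?thesis
    by (simp add: generic_algebra_def extension_of_scalars_def Let_def FactGroup_def)
qed

definition scale where "scale c = frag_extend (\<lambda>(b, f). frag_of (b, c \<otimes>\<^bsub>F\<^esub> f))"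

lemma scale:
  assumes "c \<in> carrier F" "u \<in> tensors"
  shows "scale c u \<in> tensors \<and> (\<forall>i\<in>I. ev i (scale c u) = c \<otimes>\<^bsub>F\<^esub> ev i u)"
  using assms(2)
proof (induction u rule: tensors_induct)
  case zero
  then show ?case using assms(1) by (simp add: scale_def ev_zero)
next
  case (diff u v)
  have "scale c (u - v) = scale c u - scale c v"
    by (simp add: scale_def frag_extend_diff)
  moreover have "ev i (scale c u - scale c v) = c \<otimes>\<^bsub>F\<^esub> ev i (u - v)" if i: "i \<in> I" for i
  proof -
    have "ev i u \<in> carrier F" "ev i v \<in> carrier F" using i diff ev_closed by blast+
    then show ?thesis
      using diff i assms(1) ev_diff [OF i, of "scale c u" "scale c v"] ev_diff [OF i, of u v]
      by (simp add: F.minus_eq F.r_distr F.r_minus)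
  qed
  ultimately show ?case using diff tensors_diff [of "scale c u" "scale c v"] by simp
next
  case (of b f)
  then show ?case
    using assms(1) coef_closed tensors_of [of b "c \<otimes>\<^bsub>F\<^esub> f"] by (simp add: scale_def ev_of F.m_ac)
qed

lemma E_smult:
  assumes "c \<in> carrier F" "u \<in> tensors"
  shows "c \<odot>\<^bsub>E\<^esub> cl u = cl (scale c u)"
proof -
  have "c \<odot>\<^bsub>E\<^esub> cl u = (\<Union>v\<in>cl u. cl (scale c v))"
    by (simp add: generic_algebra_def extension_of_scalars_def Let_def cl_def scale_def)
  also have "\<dots> = (\<Union>v\<in>cl u. cl (scale c u))"
    using assms scale by (intro SUP_cong refl cl_cong) (auto dest!: cl_memD)
  also have "\<dots> = cl (scale c u)"
    using cl_mem [OF assms(2)] by auto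
  finally show ?thesis .
qed

text \<open>Any representative will do, because \<open>ev i\<close> is constant on classes.\<close>

definition coord where "coord i X = ev i (SOME u. u \<in> X)"

lemma coord_cl:
  assumes "i \<in> I" "u \<in> tensors"
  shows "coord i (cl u) = ev i u"
  using someI [of "\<lambda>v. v \<in> cl u" u] cl_mem [OF assms(2)] cl_memD [of _ u] assms
  unfolding coord_def by blast

section \<open>Left multiplication and the regular trace\<close>

definition prod where
  "prod u v = frag_extend (\<lambda>(b, f). frag_extend (\<lambda>(b', f'). frag_of (b \<otimes> b', f \<otimes>\<^bsub>F\<^esub> f')) v) u"

lemma prod_diff_left: "prod (u - u') v = prod u v - prod u' v"
  and prod_add_left: "prod (u + u') v = prod u v + prod u' v"
  and prod_minus_left: "prod (- u) v = - prod u v"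
  and prod_zero_left: "prod 0 v = 0"
  and prod_zero_right: "prod u 0 = 0"
  and prod_of: "prod (frag_of (b, f)) (frag_of (b', f')) = frag_of (b \<otimes> b', f \<otimes>\<^bsub>F\<^esub> f')"
  by (simp_all add: prod_def frag_extend_diff frag_extend_add frag_extend_minus frag_extend_zero_fun
      case_prod_unfold)

lemma prod_diff_right: "prod u (v - v') = prod u v - prod u v'"
  by (simp add: prod_def frag_extend_diff frag_extend_minus_fun [symmetric] case_prod_unfold)

lemma prod_tensors:
  assumes "u \<in> tensors" "v \<in> tensors" 
  shows "prod u v \<in> tensors"
  using assms(1)
proof (induction u rule: tensors_induct)
  case (of b f)
  show ?case using assms(2)
    by (induction v rule: tensors_induct)
      (use of tensors_diff tensors_of in \<open>auto simp: prod_of prod_diff_right prod_zero_right simp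
          del: mem_Collect_eq\<close>)
qed (use tensors_diff in \<open>auto simp: prod_diff_left prod_zero_left simp del: mem_Collect_eq\<close>)

lemma prod_N_of:
  assumes "u \<in> N" "c \<in> carrier B" "g \<in> carrier F"
  shows "prod u (frag_of (c, g)) \<in> N"
  using assms(1)
proof (induction u rule: N_induct)
  case zero
  then show ?case by (simp add: prod_zero_left N_zero)
next
  case (add u v)
  then show ?case by (simp add: prod_add_left N_add)
next
  case (minus u)
  then show ?case by (simp add: prod_minus_left N_minus)
next
  case (left b b' f)
  then show ?case
    using assms N_add_left [of "b \<otimes> c" "b' \<otimes> c" "f \<otimes>\<^bsub>F\<^esub> g"]
        by (simp add: prod_diff_left prod_of l_distr)
next
  case (right b f f')
  then show ?case
    using assms N_add_right [of "b \<otimes> c" "f \<otimes>\<^bsub>F\<^esub> g" "f' \<otimes>\<^bsub>F\<^esub> g"]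
        by (simp add: prod_diff_left prod_of F.l_distr)
next
  case (balance r b f)
  then have "frac_embed S r \<in> carrier F" using S.frac_embed_closed by blast
  then show ?case
    using assms balance R_carrier N_balance [of r "b \<otimes> c" "f \<otimes>\<^bsub>F\<^esub> g"]
    by (simp add: prod_diff_left prod_of m_assoc F.m_assoc)
qed

lemma prod_N:
  assumes "u \<in> N" "v \<in> tensors"
  shows "prod u v \<in> N"
  using assms(2)
  by (induction v rule: tensors_induct)
    (auto simp: prod_zero_right prod_diff_right N_zero N_diff prod_N_of assms(1))

lemma ev_prod_of:
  assumes "i \<in> I" "b \<in> carrier B" "v \<in> tensors"
  shows "ev i (prod (frag_of (b, \<one>\<^bsub>F\<^esub>)) v) = (\<Oplus>\<^bsub>F\<^esub>j\<in>I. coef i (b \<otimes> e j) \<otimes>\<^bsub>F\<^esub> ev j v)"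
  using assms(3)
proof (induction v rule: tensors_induct)
  case zero
  have "(\<Oplus>\<^bsub>F\<^esub>j\<in>I. coef i (b \<otimes> e j) \<otimes>\<^bsub>F\<^esub> ev j 0) = (\<Oplus>\<^bsub>F\<^esub>j\<in>I. \<zero>\<^bsub>F\<^esub>)"
    using assms e_closed by (intro F.finsum_cong') (auto simp: ev_zero coef_closed)
  then show ?case using assms(1) by (simp add: prod_zero_right ev_zero)
next
  case (diff v w)
  have t: "prod (frag_of (b, \<one>\<^bsub>F\<^esub>)) x \<in> tensors" if "x \<in> tensors" for x
    by (rule prod_tensors [OF tensors_of [OF assms(2) F.one_closed] that])
  have c: "coef i (b \<otimes> e j) \<in> carrier F" "ev j v \<in> carrier F" "ev j w \<in> carrier F"
    "ev j (v - w) \<in> carrier F" if "j \<in> I" for j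
    using that diff assms e_closed coef_closed ev_closed tensors_diff [of v w] by simp_all
  let ?s = "\<lambda>x. \<Oplus>\<^bsub>F\<^esub>j\<in>I. coef i (b \<otimes> e j) \<otimes>\<^bsub>F\<^esub> ev j x"
  have sc: "?s v \<in> carrier F" "?s w \<in> carrier F" "?s (v - w) \<in> carrier F"
    using c by (auto intro!: F.finsum_closed)
  have "?s (v - w) \<oplus>\<^bsub>F\<^esub> ?s w = (\<Oplus>\<^bsub>F\<^esub>j\<in>I. coef i (b \<otimes> e j) \<otimes>\<^bsub>F\<^esub> ev j (v - w) \<oplus>\<^bsub>F\<^esub> coef i (b \<otimes>
      e j) \<otimes>\<^bsub>F\<^esub> ev j w)"
    using c by (intro F.finsum_addf [symmetric]) auto
  also have "\<dots> = ?s v"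
  proof (intro F.finsum_cong' refl)
    fix j assume j: "j \<in> I"
    have "ev j (v - w) \<oplus>\<^bsub>F\<^esub> ev j w = ev j v"
      using c [OF j] ev_diff [OF j diff(1,2)] by (simp add: F.minus_eq F.a_assoc F.l_neg)
    then show "coef i (b \<otimes> e j) \<otimes>\<^bsub>F\<^esub> ev j (v - w) \<oplus>\<^bsub>F\<^esub> coef i (b \<otimes> e j) \<otimes>\<^bsub>F\<^esub> ev j w = coef i (b \<otimes>
        e j) \<otimes>\<^bsub>F\<^esub> ev j v"
      using F.r_distr [OF c(4) [OF j] c(3) [OF j] c(1) [OF j]] by simp
  qed (use c in auto)
  finally have eq: "?s (v - w) \<oplus>\<^bsub>F\<^esub> ?s w = ?s v" .
  have "(?s (v - w) \<oplus>\<^bsub>F\<^esub> ?s w) \<ominus>\<^bsub>F\<^esub> ?s w = ?s (v - w)"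
    using sc by (simp add: F.minus_eq F.a_assoc F.r_neg del: F.finsum_closed)
  then have "?s v \<ominus>\<^bsub>F\<^esub> ?s w = ?s (v - w)"
    unfolding eq .
  then show ?case
    using diff ev_diff [OF assms(1) t [OF diff(1)] t [OF diff(2)]] by (simp add: prod_diff_right)
next
  case (of c f)
  have cl: "coef i (b \<otimes> e j) \<in> carrier F" "coef j c \<in> carrier F" if "j \<in> I" for j
    using that of assms e_closed coef_closed by simp_all
  have "ev i (prod (frag_of (b, \<one>\<^bsub>F\<^esub>)) (frag_of (c, f))) = coef i (b \<otimes> c) \<otimes>\<^bsub>F\<^esub> f"
    using of assms by (simp add: prod_of ev_of)
  also have "\<dots> = (\<Oplus>\<^bsub>F\<^esub>j\<in>I. coef i (b \<otimes> e j) \<otimes>\<^bsub>F\<^esub> coef j c \<otimes>\<^bsub>F\<^esub> f)"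
    unfolding coef_prod [OF assms(1,2) of(1)] using finite_I of cl by (intro F.finsum_ldistr) auto
  also have "\<dots> = (\<Oplus>\<^bsub>F\<^esub>j\<in>I. coef i (b \<otimes> e j) \<otimes>\<^bsub>F\<^esub> ev j (frag_of (c, f)))"
    using of cl by (intro F.finsum_cong') (auto simp: ev_of F.m_assoc)
  finally show ?case .
qed

text \<open>The regular trace concerns left multiplication by \<open>b\<close> tensored with one, so
  the product is computed for this left factor. The union over representatives collapses by
  independence in each argument.\<close>

lemma E_mult:
  assumes "b \<in> carrier B" "v \<in> tensors"
  shows "pure_tensor B R F (frac_embed S) b \<one>\<^bsub>F\<^esub> \<otimes>\<^bsub>E\<^esub> cl v = cl (prod (frag_of (b, \<one>\<^bsub>F\<^esub>)) v)"
proof -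
  let ?b = "frag_of (b, \<one>\<^bsub>F\<^esub>)"
  have b: "?b \<in> tensors" using assms tensors_of by simp
  have "pure_tensor B R F (frac_embed S) b \<one>\<^bsub>F\<^esub> = cl ?b"
    by (simp add: pure_tensor_def Let_def cl_def)
  then have "pure_tensor B R F (frac_embed S) b \<one>\<^bsub>F\<^esub> \<otimes>\<^bsub>E\<^esub> cl v =
      (\<Union>u'\<in>cl ?b. \<Union>v'\<in>cl v. cl (prod u' v'))"
    by (simp add: generic_algebra_def extension_of_scalars_def Let_def cl_def prod_def)
  also have "\<dots> = (\<Union>u'\<in>cl ?b. \<Union>v'\<in>cl v. cl (prod ?b v))"
  proof (intro SUP_cong refl cl_cong)
    fix u' v' assume u': "u' \<in> cl ?b" and v': "v' \<in> cl v"
    have t: "u' \<in> tensors" "v' \<in> tensors"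
      using cl_memD [OF u' b] cl_memD [OF v' assms(2)] by simp_all
    show "prod u' v' \<in> tensors" "prod ?b v \<in> tensors"
      by (rule prod_tensors [OF t], rule prod_tensors [OF b assms(2)])
    fix i assume i: "i \<in> I"
    \<comment> \<open>Changing the representative on the left changes the product by an element of
      the relation subgroup.\<close>
    have n: "u' - ?b \<in> N"
      unfolding N_iff using cl_memD [OF u' b] b t tensors_diff [of u' ?b] ev_diff [of _ u' ?b]
          ev_closed
      by (simp add: F.r_right_minus_eq)
    have "ev i (prod (u' - ?b) v') = \<zero>\<^bsub>F\<^esub>"
      by (rule ev_N [OF i prod_N [OF n t(2)]])
    moreover have "prod u' v' = prod (u' - ?b) v' + prod ?b v'"
      by (simp add: prod_diff_left)
    moreover have "prod (u' - ?b) v' \<in> tensors" "prod ?b v' \<in> tensors"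
      by (rule prod_tensors [OF tensors_diff [OF t(1) b] t(2)], rule prod_tensors [OF b t(2)])
    ultimately have "ev i (prod u' v') = ev i (prod ?b v')"
      using ev_add [OF i] ev_closed [OF i] by simp
    \<comment> \<open>On the right, the coordinates of the product depend only on the coordinates of
      the second factor, through the matrix of left multiplication by \<open>b\<close>.\<close>
    also have "\<dots> = ev i (prod ?b v)"
      unfolding ev_prod_of [OF i assms(1) t(2)] ev_prod_of [OF i assms]
      using cl_memD [OF v' assms(2)] i assms e_closed
      by (intro F.finsum_cong') (auto intro!: coef_closed ev_closed)
    finally show "ev i (prod u' v') = ev i (prod ?b v)" .
  qed
  also have "\<dots> = cl (prod ?b v)"
    using cl_mem [OF b] cl_mem [OF assms(2)] by auto
  finally show ?thesis .
qed

lemma E_carrierE: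
  assumes "X \<in> carrier E"
  obtains u where "u \<in> tensors" "X = cl u"
proof -
  from assms have "X \<in> cl ` tensors" unfolding E_carrier .
  then show ?thesis using that by (rule imageE)
qed

lemma E_carrierI: "u \<in> tensors \<Longrightarrow> cl u \<in> carrier E"
  unfolding E_carrier by (rule imageI)

lemma coordinate_space_E: "coordinate_space F E I coord (\<lambda>i. cl (frag_of (e i, \<one>\<^bsub>F\<^esub>)))"
proof unfold_locales
  show "finite I" by (rule finite_I)
next
  fix i X assume i: "i \<in> I" and "X \<in> carrier E"
  from this(2) show "coord i X \<in> carrier F"
    by (rule E_carrierE) (simp only: coord_cl [OF i] ev_closed [OF i])
next
  fix X Y assume XY: "X \<in> carrier E" "Y \<in> carrier E" and eq: "\<And>i. i \<in> I \<Longrightarrow> coord i X = coord i Y"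
  obtain u where u: "u \<in> tensors" "X = cl u" using XY(1) by (rule E_carrierE)
  obtain v where v: "v \<in> tensors" "Y = cl v" using XY(2) by (rule E_carrierE)
  show "X = Y" unfolding u(2) v(2)
  proof (rule cl_cong [OF u(1) v(1)])
    fix i assume i: "i \<in> I"
    show "ev i u = ev i v"
      using eq [OF i] unfolding u(2) v(2) coord_cl [OF i u(1)] coord_cl [OF i v(1)] .
  qed
next
  fix X Y assume XY: "X \<in> carrier E" "Y \<in> carrier E"
  obtain u where u: "u \<in> tensors" "X = cl u" using XY(1) by (rule E_carrierE)
  obtain v where v: "v \<in> tensors" "Y = cl v" using XY(2) by (rule E_carrierE)
  note uv = u(1) v(1) u(2) v(2)
  show "X \<oplus>\<^bsub>E\<^esub> Y \<in> carrier E"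
    unfolding uv(3,4) E_add [OF uv(1,2)] by (rule E_carrierI [OF tensors_add [OF uv(1,2)]])
  fix i assume "i \<in> I"
  then show "coord i (X \<oplus>\<^bsub>E\<^esub> Y) = coord i X \<oplus>\<^bsub>F\<^esub> coord i Y"
    unfolding uv(3,4) E_add [OF uv(1,2)] using uv(1,2) tensors_add [OF uv(1,2)]
    by (simp only: coord_cl ev_add)
next
  show "\<zero>\<^bsub>E\<^esub> \<in> carrier E" unfolding E_zero by (rule E_carrierI [OF tensors_zero])
next
  fix i assume "i \<in> I"
  then show "coord i \<zero>\<^bsub>E\<^esub> = \<zero>\<^bsub>F\<^esub>" unfolding E_zero
    by (simp only: coord_cl [OF _ tensors_zero] ev_zero)
next
  fix c X assume c: "c \<in> carrier F" and X: "X \<in> carrier E"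
  obtain u where u: "u \<in> tensors" "X = cl u" using X by (rule E_carrierE)
  note sc = scale [OF c u(1), THEN conjunct1] scale [OF c u(1), THEN conjunct2, rule_format]
  show "c \<odot>\<^bsub>E\<^esub> X \<in> carrier E"
    unfolding u(2) E_smult [OF c u(1)] by (rule E_carrierI [OF sc(1)])
  fix i assume i: "i \<in> I"
  show "coord i (c \<odot>\<^bsub>E\<^esub> X) = c \<otimes>\<^bsub>F\<^esub> coord i X"
    unfolding u(2) E_smult [OF c u(1)] coord_cl [OF i sc(1)] coord_cl [OF i u(1)]
        by (rule sc(2) [OF i])
next
  fix i assume "i \<in> I"
  then show "cl (frag_of (e i, \<one>\<^bsub>F\<^esub>)) \<in> carrier E"
    by (intro E_carrierI tensors_of e_closed F.one_closed)
next
  fix i j assume ij: "i \<in> I" "j \<in> I"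
  have "frag_of (e j, \<one>\<^bsub>F\<^esub>) \<in> tensors"
    by (rule tensors_of [OF e_closed [OF ij(2)] F.one_closed])
  then show "coord i (cl (frag_of (e j, \<one>\<^bsub>F\<^esub>))) = (if i = j then \<one>\<^bsub>F\<^esub> else \<zero>\<^bsub>F\<^esub>)"
    using ij e_closed by (simp add: coord_cl ev_of coef_e)
qed

lemma rank_over_eq: "rank_over B R = card I"
  unfolding rank_over_def by (rule coordinate_space.dim_eq [OF coordinate_space_E])

text \<open>The matrix of left multiplication has entries \<open>coef i (b \<otimes> e j)\<close>;
  its diagonal is summed with the common denominator \<open>z\<close>.\<close>

lemma regular_trace_eq:
  assumes "b \<in> carrier B"
  shows "regular_trace B R b = fraction_of S (\<Oplus>i\<in>I. \<kappa> i (b \<otimes> e i)) z"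
proof -
  have c: "coef i (b \<otimes> e j) \<in> carrier F" if "i \<in> I" "j \<in> I" for i j
    using that assms e_closed coef_closed by simp
  have "regular_trace B R b = (\<Oplus>\<^bsub>F\<^esub>i\<in>I. coef i (b \<otimes> e i))"
    unfolding regular_trace_def Let_def
  proof (rule coordinate_space.linear_trace_eq [OF coordinate_space_E,
      where t = "\<lambda>i j. coef i (b \<otimes> e j)"])
    fix X assume X: "X \<in> carrier E"
    obtain v where v: "v \<in> tensors" "X = cl v" using X by (rule E_carrierE)
    have t: "prod (frag_of (b, \<one>\<^bsub>F\<^esub>)) v \<in> tensors"
      by (rule prod_tensors [OF tensors_of [OF assms F.one_closed] v(1)])
    show "pure_tensor B R F (frac_embed S) b \<one>\<^bsub>F\<^esub> \<otimes>\<^bsub>E\<^esub> X \<in> carrier E"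
      unfolding v(2) E_mult [OF assms v(1)] by (rule E_carrierI [OF t])
    fix i assume i: "i \<in> I"
    have "coord i (cl (prod (frag_of (b, \<one>\<^bsub>F\<^esub>)) v)) = (\<Oplus>\<^bsub>F\<^esub>j\<in>I. coef i (b \<otimes> e j) \<otimes>\<^bsub>F\<^esub> ev j v)"
      unfolding coord_cl [OF i t] by (rule ev_prod_of [OF i assms v(1)])
    also have "\<dots> = (\<Oplus>\<^bsub>F\<^esub>j\<in>I. coef i (b \<otimes> e j) \<otimes>\<^bsub>F\<^esub> coord j (cl v))"
      using c i v(1) by (intro F.finsum_cong') (auto simp: coord_cl ev_closed)
    finally show "coord i (pure_tensor B R F (frac_embed S) b \<one>\<^bsub>F\<^esub> \<otimes>\<^bsub>E\<^esub> X) =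
      (\<Oplus>\<^bsub>F\<^esub>j\<in>I. coef i (b \<otimes> e j) \<otimes>\<^bsub>F\<^esub> coord j X)"
      unfolding v(2) E_mult [OF assms v(1)] .
  qed (rule c)
  also have "\<dots> = fraction_of S (\<Oplus>i\<in>I. \<kappa> i (b \<otimes> e i)) z"
    unfolding coef_def using finite_I z \<kappa>_closed assms e_closed
    by (intro fraction_of_finsum [symmetric]) auto
  finally show ?thesis .
qed

end

section \<open>Duals and reflexive hulls over a central subring\<close>

context central_subring
begin

definition dual where "dual M = carrier (dual_module S (as_module B M))"
definition bidual where "bidual M = carrier (bidual_module S (as_module B M))"

lemma dual_iff:
  "\<phi> \<in> dual M \<longleftrightarrow> \<phi> \<in> extensional M \<and> (\<forall>x\<in>M. \<phi> x \<in> R) \<and>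
    (\<forall>x\<in>M. \<forall>y\<in>M. \<phi> (x \<oplus> y) = \<phi> x \<oplus> \<phi> y) \<and> (\<forall>r\<in>R. \<forall>x\<in>M. \<phi> (r \<otimes> x) = r \<otimes> \<phi> x)"
  by (auto simp: dual_def dual_module_def module_hom_def as_module_def)

lemma bidual_iff:
  "\<Phi> \<in> bidual M \<longleftrightarrow> \<Phi> \<in> extensional (dual M) \<and> (\<forall>\<phi>\<in>dual M. \<Phi> \<phi> \<in> R) \<and>
    (\<forall>\<phi>\<in>dual M. \<forall>\<psi>\<in>dual M. \<Phi> (\<lambda>x\<in>M. \<phi> x \<oplus> \<psi> x) = \<Phi> \<phi> \<oplus> \<Phi> \<psi>) \<and>
    (\<forall>r\<in>R. \<forall>\<phi>\<in>dual M. \<Phi> (\<lambda>x\<in>M. r \<otimes> \<phi> x) = r \<otimes> \<Phi> \<phi>)"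
proof -
  have "dual_module S (as_module B M) = \<lparr>carrier = dual M,
     mult = undefined, one = undefined,
     ring.zero = (\<lambda>x \<in> M. \<zero>),
     ring.add = (\<lambda>\<phi> \<psi>. \<lambda>x \<in> M. \<phi> x \<oplus> \<psi> x),
     smult = (\<lambda>r \<phi>. \<lambda>x \<in> M. r \<otimes> \<phi> x)\<rparr>"
    by (simp add: dual_def dual_module_def as_module_def)
  then show ?thesis
    unfolding bidual_def by (auto simp: dual_module_def module_hom_def as_module_def)
qed

lemma dualD:
  assumes "\<phi> \<in> dual M"
  shows "\<phi> \<in> extensional M" "\<And>x. x \<in> M \<Longrightarrow> \<phi> x \<in> R"
    "\<And>x y. x \<in> M \<Longrightarrow> y \<in> M \<Longrightarrow> \<phi> (x \<oplus> y) = \<phi> x \<oplus> \<phi> y"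
    "\<And>r x. r \<in> R \<Longrightarrow> x \<in> M \<Longrightarrow> \<phi> (r \<otimes> x) = r \<otimes> \<phi> x"
  using assms by (auto simp: dual_iff)

lemma bidualD:
  assumes "\<Phi> \<in> bidual M"
  shows "\<Phi> \<in> extensional (dual M)" "\<And>\<phi>. \<phi> \<in> dual M \<Longrightarrow> \<Phi> \<phi> \<in> R"
    "\<And>\<phi> \<psi>. \<phi> \<in> dual M \<Longrightarrow> \<psi> \<in> dual M \<Longrightarrow> \<Phi> (\<lambda>x\<in>M. \<phi> x \<oplus> \<psi> x) = \<Phi> \<phi> \<oplus> \<Phi> \<psi>"
    "\<And>r \<phi>. r \<in> R \<Longrightarrow> \<phi> \<in> dual M \<Longrightarrow> \<Phi> (\<lambda>x\<in>M. r \<otimes> \<phi> x) = r \<otimes> \<Phi> \<phi>"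
  using assms by (auto simp: bidual_iff)

definition submodule_of where
  "submodule_of M \<longleftrightarrow> M \<subseteq> carrier B \<and> \<zero> \<in> M \<and> (\<forall>x\<in>M. \<forall>y\<in>M. x \<oplus> y \<in> M) \<and> (\<forall>r\<in>R. \<forall>x\<in>M. r \<otimes> x \<in> M)"

lemma submodule_carrier: "submodule_of (carrier B)"
  by (auto simp: submodule_of_def R_carrier)

lemma dual_add:
  assumes "submodule_of M" "\<phi> \<in> dual M" "\<psi> \<in> dual M"
  shows "(\<lambda>x\<in>M. \<phi> x \<oplus> \<psi> x) \<in> dual M"
  unfolding dual_iff
proof (intro conjI ballI)
  note c = dualD(2) [OF assms(2)] dualD(2) [OF assms(3)]
  fix x assume x: "x \<in> M"
  show "(\<lambda>x\<in>M. \<phi> x \<oplus> \<psi> x) x \<in> R" using x c by simp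
  fix y assume y: "y \<in> M"
  have "x \<oplus> y \<in> M" using assms(1) x y by (auto simp: submodule_of_def)
  then show "(\<lambda>x\<in>M. \<phi> x \<oplus> \<psi> x) (x \<oplus> y) = (\<lambda>x\<in>M. \<phi> x \<oplus> \<psi> x) x \<oplus> (\<lambda>x\<in>M. \<phi> x \<oplus> \<psi> x) y"
    using x y c assms by (simp add: dualD S.a_ac)
next
  note c = dualD(2) [OF assms(2)] dualD(2) [OF assms(3)]
  fix r x assume x: "r \<in> R" "x \<in> M"
  then have "r \<otimes> x \<in> M" using assms(1) by (auto simp: submodule_of_def)
  then show "(\<lambda>x\<in>M. \<phi> x \<oplus> \<psi> x) (r \<otimes> x) = r \<otimes> (\<lambda>x\<in>M. \<phi> x \<oplus> \<psi> x) x"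
    using x c assms by (simp add: dualD S.r_distr)
qed simp

lemma dual_smult:
  assumes "submodule_of M" "r \<in> R" "\<phi> \<in> dual M"
  shows "(\<lambda>x\<in>M. r \<otimes> \<phi> x) \<in> dual M"
  unfolding dual_iff
proof (intro conjI ballI)
  note c = dualD(2) [OF assms(3)]
  fix x assume x: "x \<in> M"
  show "(\<lambda>x\<in>M. r \<otimes> \<phi> x) x \<in> R" using x c assms by simp
  fix y assume y: "y \<in> M"
  have "x \<oplus> y \<in> M" using assms(1) x y by (auto simp: submodule_of_def)
  then show "(\<lambda>x\<in>M. r \<otimes> \<phi> x) (x \<oplus> y) = (\<lambda>x\<in>M. r \<otimes> \<phi> x) x \<oplus> (\<lambda>x\<in>M. r \<otimes> \<phi> x) y"
    using x y c assms by (simp add: dualD S.r_distr)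
next
  note c = dualD(2) [OF assms(3)]
  fix s x assume x: "s \<in> R" "x \<in> M"
  then have "s \<otimes> x \<in> M" using assms(1) by (auto simp: submodule_of_def)
  then show "(\<lambda>x\<in>M. r \<otimes> \<phi> x) (s \<otimes> x) = s \<otimes> (\<lambda>x\<in>M. r \<otimes> \<phi> x) x"
    using x c assms by (simp add: dualD S.m_ac)
qed simp

lemma dual_zero:
  assumes "submodule_of M" "\<phi> \<in> dual M"
  shows "\<phi> \<zero> = \<zero>"
proof -
  have "\<zero> \<in> M" using assms by (simp add: submodule_of_def)
  then show ?thesis
    using dualD(2,4) [OF assms(2)] S.l_null by (metis R_carrier l_null S.zero_closed)
qed

lemma dual_finsum:
  assumes "\<phi> \<in> dual (carrier B)" "finite A" "\<And>a. a \<in> A \<Longrightarrow> f a \<in> carrier B"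
  shows "\<phi> (\<Oplus>a\<in>A. f a) = (\<Oplus>a\<in>A. \<phi> (f a))"
  using assms(2,3)
proof (induction A)
  case empty
  then show ?case using dual_zero [OF submodule_carrier assms(1)] by simp
next
  case (insert x A)
  have 1: "(\<Oplus>a\<in>insert x A. f a) = f x \<oplus> (\<Oplus>a\<in>A. f a)"
    using insert by (intro finsum_insert) auto
  have 2: "(\<Oplus>a\<in>insert x A. \<phi> (f a)) = \<phi> (f x) \<oplus> (\<Oplus>a\<in>A. \<phi> (f a))"
    using insert dualD(2) [OF assms(1)] R_carrier by (intro finsum_insert) auto
  show ?case unfolding 1 2 using insert dualD(3) [OF assms(1)] by simp
qed

text \<open>Addition and scaling in the dual produce restricted functions, so linearity of \<Phi> is
  extended from the binary operations by induction. Membership of the combination in the dual is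
  carried along because the next step needs it.\<close>

lemma bidual_finsum:
  assumes "\<Phi> \<in> bidual M" "submodule_of M" "finite A"
    and "\<And>a. a \<in> A \<Longrightarrow> r a \<in> R" "\<And>a. a \<in> A \<Longrightarrow> \<phi> a \<in> dual M"
  shows "(\<lambda>x\<in>M. \<Oplus>a\<in>A. r a \<otimes> \<phi> a x) \<in> dual M \<and>
    \<Phi> (\<lambda>x\<in>M. \<Oplus>a\<in>A. r a \<otimes> \<phi> a x) = (\<Oplus>a\<in>A. r a \<otimes> \<Phi> (\<phi> a))"
  using assms(3-5)
proof (induction A)
  case empty
  have 0: "(\<lambda>x\<in>M. \<zero>) \<in> dual M" by (auto simp: dual_iff assms(2)[unfolded submodule_of_def]
    R_carrier)
  have "(\<lambda>x\<in>M. \<zero> \<otimes> (\<lambda>x\<in>M. \<zero>) x) = (\<lambda>x\<in>M. \<zero>)" by auto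
  then have "\<Phi> (\<lambda>x\<in>M. \<zero>) = \<zero>"
    using bidualD(4) [OF assms(1) _ 0, of \<zero>] bidualD(2) [OF assms(1) 0] by simp
  with 0 show ?case unfolding finsum_empty by (rule conjI)
next
  case (insert y A)
  let ?p = "\<lambda>x\<in>M. r y \<otimes> \<phi> y x" and ?q = "\<lambda>x\<in>M. \<Oplus>a\<in>A. r a \<otimes> \<phi> a x"
  have c: "r a \<otimes> \<phi> a x \<in> carrier B" if "a \<in> insert y A" "x \<in> M" for a x
    using that insert.prems dualD(2) R_carrier by (intro m_closed) blast+
  have eq1: "(\<lambda>x\<in>M. \<Oplus>a\<in>insert y A. r a \<otimes> \<phi> a x) = (\<lambda>x\<in>M. ?p x \<oplus> ?q x)"
    using insert.hyps c by (intro restrict_ext) (auto intro!: finsum_insert)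
  have p: "?p \<in> dual M" "\<Phi> ?p = r y \<otimes> \<Phi> (\<phi> y)"
    using dual_smult [OF assms(2)] bidualD(4) [OF assms(1)] insert.prems by auto
  have qq: "?q \<in> dual M \<and> \<Phi> ?q = (\<Oplus>a\<in>A. r a \<otimes> \<Phi> (\<phi> a))"
    by (rule insert.IH) (simp_all add: insert.prems)
  note q = qq [THEN conjunct1] qq [THEN conjunct2]
  have eq2: "(\<Oplus>a\<in>insert y A. r a \<otimes> \<Phi> (\<phi> a)) = r y \<otimes> \<Phi> (\<phi> y) \<oplus> (\<Oplus>a\<in>A. r a \<otimes> \<Phi> (\<phi> a))"
    using insert.hyps insert.prems bidualD(2) [OF assms(1)] R_carrier
    by (intro finsum_insert) auto
  show ?case
    unfolding eq1 eq2 p(2) [symmetric] q(2) [symmetric]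
    by (rule conjI [OF dual_add [OF assms(2) p(1) q(1)] bidualD(3) [OF assms(1) p(1) q(1)]])
qed

lemma bidual_map_eq: "bidual_map S (as_module B M) x = (\<lambda>\<phi>\<in>dual M. \<phi> x)"
  by (simp add: bidual_map_def dual_def)

lemma bidual_map_closed:
  assumes "submodule_of M" "x \<in> M"
  shows "(\<lambda>\<phi>\<in>dual M. \<phi> x) \<in> bidual M"
  unfolding bidual_iff using assms dual_add dual_smult dualD by auto

text \<open>Membership means that evaluation at \<open>b\<close> factors, through some \<Phi>, over
  restriction of functionals to \<open>M\<close>.\<close>

lemma reflexive_hull_iff:
  "b \<in> reflexive_hull B R M \<longleftrightarrow> b \<in> carrier B \<and>
    (\<exists>\<Phi>\<in>bidual M. \<forall>\<phi>\<in>dual (carrier B). \<phi> b = \<Phi> (restrict \<phi> M))"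
proof -
  have "(\<lambda>\<phi>\<in>dual (carrier B). \<phi> b) = (\<lambda>\<phi>\<in>dual (carrier B). \<Phi> (restrict \<phi> M)) \<longleftrightarrow>
      (\<forall>\<phi>\<in>dual (carrier B). \<phi> b = \<Phi> (restrict \<phi> M))" for \<Phi>
    by (auto simp: fun_eq_iff restrict_def)
  then show ?thesis
    unfolding reflexive_hull_def bidual_inclusion_def bidual_map_eq bidual_def [symmetric] dual_def
        [symmetric]
    by auto
qed

text \<open>Division by \<open>d\<close> is an \<open>R\<close>-linear map \<theta> from
  \<open>M\<close> to \<open>B\<close>. Pulling functionals back along \<theta> carries \<Phi> to an
  element of the bidual of \<open>B\<close>, which by reflexivity is evaluation at some
  \<open>c\<close>. Then \<open>b\<close> and \<open>d \<otimes> c\<close> have the same values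
  under all functionals.\<close>

lemma reflexive_hull_subset:
  assumes refl: "reflexive_module S (as_module B (carrier B))"
    and M: "submodule_of M" "M \<subseteq> d <# carrier B" and d: "d \<in> carrier B"
    and reg: "\<And>b. b \<in> carrier B \<Longrightarrow> d \<otimes> b = \<zero> \<Longrightarrow> b = \<zero>"
  shows "reflexive_hull B R M \<subseteq> d <# carrier B"
proof
  fix b assume "b \<in> reflexive_hull B R M"
  then obtain \<Phi> where b: "b \<in> carrier B" and \<Phi>: "\<Phi> \<in> bidual M"
    and eq: "\<And>\<phi>. \<phi> \<in> dual (carrier B) \<Longrightarrow> \<phi> b = \<Phi> (restrict \<phi> M)"
    by (auto simp: reflexive_hull_iff)
  have bij: "bij_betw (\<lambda>x. \<lambda>\<phi>\<in>dual (carrier B). \<phi> x) (carrier B) (bidual (carrier B))"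
    using refl unfolding reflexive_module_def bidual_map_eq [abs_def] bidual_def
    by (simp add: as_module_def)
  have cancel: "x = y" if "x \<in> carrier B" "y \<in> carrier B" "d \<otimes> x = d \<otimes> y" for x y
  proof -
    have "d \<otimes> (x \<ominus> y) = \<zero>" using that d by (simp add: minus_eq r_distr r_minus r_neg)
    then show ?thesis using reg [of "x \<ominus> y"] that by simp
  qed
  have "\<forall>x\<in>M. \<exists>c\<in>carrier B. x = d \<otimes> c" using M(2) by (auto simp: l_coset_def)
  then obtain \<theta> where \<theta>: "\<And>x. x \<in> M \<Longrightarrow> \<theta> x \<in> carrier B" "\<And>x. x \<in> M \<Longrightarrow> x = d \<otimes> \<theta> x"
    by metis
  have MB: "\<And>x. x \<in> M \<Longrightarrow> x \<in> carrier B" and Madd: "\<And>x y. x \<in> M \<Longrightarrow> y \<in> M \<Longrightarrow> x \<oplus> y \<in> M"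
    and Mmult: "\<And>r x. r \<in> R \<Longrightarrow> x \<in> M \<Longrightarrow> r \<otimes> x \<in> M"
    using M(1) by (auto simp: submodule_of_def)
  have \<theta>_add: "\<theta> (x \<oplus> y) = \<theta> x \<oplus> \<theta> y" if xy: "x \<in> M" "y \<in> M" for x y
  proof (rule cancel)
    have "d \<otimes> \<theta> (x \<oplus> y) = x \<oplus> y" using \<theta>(2) [OF Madd [OF xy]] by simp
    also have "\<dots> = d \<otimes> \<theta> x \<oplus> d \<otimes> \<theta> y" using \<theta>(2) [OF xy(1)] \<theta>(2) [OF xy(2)] by simp
    also have "\<dots> = d \<otimes> (\<theta> x \<oplus> \<theta> y)" using d \<theta>(1) xy by (simp add: r_distr)
    finally show "d \<otimes> \<theta> (x \<oplus> y) = d \<otimes> (\<theta> x \<oplus> \<theta> y)" .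
  qed (use \<theta>(1) xy Madd in auto)
  have \<theta>_mult: "\<theta> (r \<otimes> x) = r \<otimes> \<theta> x" if rx: "r \<in> R" "x \<in> M" for r x
  proof (rule cancel)
    have "d \<otimes> \<theta> (r \<otimes> x) = r \<otimes> x" using \<theta>(2) [OF Mmult [OF rx]] by simp
    also have "\<dots> = r \<otimes> (d \<otimes> \<theta> x)" using \<theta>(2) [OF rx(2)] by simp
    also have "\<dots> = d \<otimes> (r \<otimes> \<theta> x)"
      using d \<theta>(1) rx R_carrier [OF rx(1)] R_comm [OF rx(1) d] by (simp add: m_assoc [symmetric])
    finally show "d \<otimes> \<theta> (r \<otimes> x) = d \<otimes> (r \<otimes> \<theta> x)" .
  qed (use \<theta>(1) rx Mmult R_carrier in auto)
  \<comment> \<open>The transpose of \<theta>, from functionals on \<open>B\<close> to functionals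
    on \<open>M\<close>.\<close>
  let ?t = "\<lambda>\<phi>. \<lambda>x\<in>M. \<phi> (\<theta> x)"
  have t: "?t \<phi> \<in> dual M" if "\<phi> \<in> dual (carrier B)" for \<phi>
    unfolding dual_iff using dualD [OF that] \<theta>(1) Madd Mmult by (auto simp: \<theta>_add \<theta>_mult)
  have "(\<lambda>\<phi>\<in>dual (carrier B). \<Phi> (?t \<phi>)) \<in> bidual (carrier B)"
    unfolding bidual_iff
  proof (intro conjI ballI)
    fix \<phi> assume \<phi>: "\<phi> \<in> dual (carrier B)"
    show "(\<lambda>\<phi>\<in>dual (carrier B). \<Phi> (?t \<phi>)) \<phi> \<in> R" using \<phi> bidualD(2) [OF \<Phi> t] by simp
    fix \<psi> assume \<psi>: "\<psi> \<in> dual (carrier B)"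
    have "?t (\<lambda>x\<in>carrier B. \<phi> x \<oplus> \<psi> x) = (\<lambda>x\<in>M. ?t \<phi> x \<oplus> ?t \<psi> x)"
      using \<theta>(1) by (auto simp: fun_eq_iff)
    then show "(\<lambda>\<phi>\<in>dual (carrier B). \<Phi> (?t \<phi>)) (\<lambda>x\<in>carrier B. \<phi> x \<oplus> \<psi> x) =
        (\<lambda>\<phi>\<in>dual (carrier B). \<Phi> (?t \<phi>)) \<phi> \<oplus> (\<lambda>\<phi>\<in>dual (carrier B). \<Phi> (?t \<phi>)) \<psi>"
      using dual_add [OF submodule_carrier \<phi> \<psi>] \<phi> \<psi> bidualD(3) [OF \<Phi> t [OF \<phi>] t [OF \<psi>]] by simp
  next
    fix r \<phi> assume r: "r \<in> R" and \<phi>: "\<phi> \<in> dual (carrier B)"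
    have "?t (\<lambda>x\<in>carrier B. r \<otimes> \<phi> x) = (\<lambda>x\<in>M. r \<otimes> ?t \<phi> x)"
      using \<theta>(1) by (auto simp: fun_eq_iff)
    then show "(\<lambda>\<phi>\<in>dual (carrier B). \<Phi> (?t \<phi>)) (\<lambda>x\<in>carrier B. r \<otimes> \<phi> x) =
        r \<otimes> (\<lambda>\<phi>\<in>dual (carrier B). \<Phi> (?t \<phi>)) \<phi>"
      using dual_smult [OF submodule_carrier r \<phi>] \<phi> bidualD(4) [OF \<Phi> r t [OF \<phi>]] by simp
  qed simp
  then obtain c where c: "c \<in> carrier B"
    and c_eq: "(\<lambda>\<phi>\<in>dual (carrier B). \<Phi> (?t \<phi>)) = (\<lambda>\<phi>\<in>dual (carrier B). \<phi> c)"
    using bij by (metis (no_types, lifting) bij_betw_imp_surj_on imageE)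
  have "(\<lambda>\<phi>\<in>dual (carrier B). \<phi> b) = (\<lambda>\<phi>\<in>dual (carrier B). \<phi> (d \<otimes> c))"
  proof (rule restrict_ext)
    fix \<phi> assume \<phi>: "\<phi> \<in> dual (carrier B)"
    \<comment> \<open>Precomposing \<phi> with multiplication by \<open>d\<close> and then with
      \<theta> gives \<phi> back on \<open>M\<close>, which ties the value at \<open>b\<close> to
      the value at \<open>d \<otimes> c\<close>.\<close>
    let ?m = "\<lambda>x\<in>carrier B. \<phi> (d \<otimes> x)"
    have m: "?m \<in> dual (carrier B)"
      unfolding dual_iff
    proof (intro conjI ballI)
      fix r x assume rx: "r \<in> R" "x \<in> carrier B"
      have "d \<otimes> (r \<otimes> x) = r \<otimes> (d \<otimes> x)"
        using d rx R_carrier [OF rx(1)] R_comm [OF rx(1) d] by (simp add: m_assoc [symmetric])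
      then show "?m (r \<otimes> x) = r \<otimes> ?m x"
        using rx d R_carrier [OF rx(1)] dualD(4) [OF \<phi>] by simp
    qed (use dualD [OF \<phi>] d in \<open>auto simp: r_distr\<close>)
    have "?t ?m = restrict \<phi> M"
      using \<theta> by (auto simp: fun_eq_iff restrict_def)
    then have "\<phi> b = \<Phi> (?t ?m)"
      using eq [OF \<phi>] by simp
    also have "\<dots> = ?m c"
      using fun_cong [OF c_eq, of ?m] m by simp
    finally show "\<phi> b = \<phi> (d \<otimes> c)" using c by simp
  qed
  then have "b = d \<otimes> c"
    using bij b c d unfolding bij_betw_def by (auto dest: inj_onD)
  then show "b \<in> d <# carrier B" using c by (auto simp: l_coset_def)
qed

text \<open>Evaluation at \<open>y\<close> makes no direct sense on functionals of \<open>M\<close>.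
  If \<psi> takes on \<open>s \<otimes> y\<close> a value divisible by \<open>s\<close>, the
  quotient is the value it ought to have at \<open>y\<close>; cancellation of \<open>s\<close> makes
  this assignment linear.\<close>

lemma reflexive_hullI:
  assumes M: "submodule_of M" and y: "y \<in> carrier B" and s: "s \<in> R" "s \<noteq> \<zero>" "s \<otimes> y \<in> M"
    and dvd: "\<And>\<psi>. \<psi> \<in> dual M \<Longrightarrow> \<exists>q\<in>R. \<psi> (s \<otimes> y) = s \<otimes> q"
  shows "y \<in> reflexive_hull B R M"
proof -
  obtain q where q: "\<And>\<psi>. \<psi> \<in> dual M \<Longrightarrow> q \<psi> \<in> R" "\<And>\<psi>. \<psi> \<in> dual M \<Longrightarrow> \<psi> (s \<otimes> y) = s \<otimes> q \<psi>"
    using dvd by metis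
  have cancel: "a = b" if "a \<in> R" "b \<in> R" "s \<otimes> a = s \<otimes> b" for a b
    using that s S.m_lcancel by simp
  have "restrict q (dual M) \<in> bidual M"
    unfolding bidual_iff
  proof (intro conjI ballI)
    fix \<phi> assume \<phi>: "\<phi> \<in> dual M"
    show "restrict q (dual M) \<phi> \<in> R" using \<phi> q by simp
    fix \<psi> assume \<psi>: "\<psi> \<in> dual M"
    note sum = dual_add [OF M \<phi> \<psi>]
    have "s \<otimes> q (\<lambda>x\<in>M. \<phi> x \<oplus> \<psi> x) = s \<otimes> (q \<phi> \<oplus> q \<psi>)"
      using q(2) [OF sum] q(1) [OF \<phi>] q(1) [OF \<psi>] q(2) [OF \<phi>] q(2) [OF \<psi>] s by (simp add: S.r_distr)
    then show "restrict q (dual M) (\<lambda>x\<in>M. \<phi> x \<oplus> \<psi> x) = restrict q (dual M) \<phi> \<oplus> restrict q (dual M)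
        \<psi>"
      using sum \<phi> \<psi> q(1) cancel by simp
  next
    fix r \<phi> assume r: "r \<in> R" and \<phi>: "\<phi> \<in> dual M"
    note sm = dual_smult [OF M r \<phi>]
    have "s \<otimes> q (\<lambda>x\<in>M. r \<otimes> \<phi> x) = s \<otimes> (r \<otimes> q \<phi>)"
      using q(2) [OF sm] q(1) [OF \<phi>] q(2) [OF \<phi>] s r by (simp add: S.m_ac)
    then show "restrict q (dual M) (\<lambda>x\<in>M. r \<otimes> \<phi> x) = r \<otimes> restrict q (dual M) \<phi>"
      using sm \<phi> q(1) r cancel by simp
  qed simp
  moreover have "\<phi> y = restrict q (dual M) (restrict \<phi> M)" if \<phi>: "\<phi> \<in> dual (carrier B)" for \<phi>
  proof -
    have r: "restrict \<phi> M \<in> dual M"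
      using M dualD [OF \<phi>] unfolding dual_iff by (auto simp: submodule_of_def subset_iff)
    have "s \<otimes> \<phi> y = \<phi> (s \<otimes> y)" using dualD(4) [OF \<phi> s(1) y] by simp
    also have "\<dots> = s \<otimes> q (restrict \<phi> M)" using q(2) [OF r] s(3) by simp
    finally show ?thesis using cancel dualD(2) [OF \<phi> y] q(1) [OF r] r by simp
  qed
  ultimately show ?thesis using y unfolding reflexive_hull_iff by blast
qed

end

text \<open>For \<Phi> in the bidual, the frame produces an element \<open>b\<close> of
  \<open>B\<close> that behaves like \<open>z\<close> times the element sought. All functionals take
  values divisible by \<open>z\<close> on \<open>b\<close>, so \<open>dvd\<close> allows dividing it
  by \<open>z\<close>.\<close>

lemma (in dual_frame) reflexive:
  assumes reg: "\<And>b. b \<in> carrier B \<Longrightarrow> z \<otimes> b = \<zero> \<Longrightarrow> b = \<zero>"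
    and dvd: "\<And>b. b \<in> carrier B \<Longrightarrow> (\<And>\<phi>. \<phi> \<in> dual (carrier B) \<Longrightarrow> \<exists>q\<in>R. \<phi> b = z \<otimes> q) \<Longrightarrow>
      \<exists>c\<in>carrier B. b = z \<otimes> c"
  shows "reflexive_module S (as_module B (carrier B))"
proof -
  let ?D = "dual (carrier B)"
  define \<kappa>' where "\<kappa>' i = restrict (\<kappa> i) (carrier B)" for i
  have \<kappa>': "\<kappa>' i \<in> ?D" if "i \<in> I" for i
    unfolding \<kappa>'_def dual_iff using that \<kappa>_closed \<kappa>_add \<kappa>_mult R_carrier by auto
  have zB: "z \<in> carrier B" using z R_carrier by blast
  have cancel: "x = y" if "x \<in> carrier B" "y \<in> carrier B" "z \<otimes> x = z \<otimes> y" for x y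
  proof -
    have "z \<otimes> (x \<ominus> y) = \<zero>" using that zB by (simp add: minus_eq r_distr r_minus r_neg)
    then show ?thesis using reg [of "x \<ominus> y"] that by simp
  qed
  have "bij_betw (\<lambda>x. \<lambda>\<phi>\<in>?D. \<phi> x) (carrier B) (bidual (carrier B))"
    unfolding bij_betw_def
  proof (intro conjI subset_antisym)
    show "inj_on (\<lambda>x. \<lambda>\<phi>\<in>?D. \<phi> x) (carrier B)"
    proof (rule inj_onI)
      fix x y assume xy: "x \<in> carrier B" "y \<in> carrier B" and eq: "(\<lambda>\<phi>\<in>?D. \<phi> x) = (\<lambda>\<phi>\<in>?D. \<phi> y)"
      have "\<kappa> i x = \<kappa> i y" if i: "i \<in> I" for i
        using fun_cong [OF eq, of "\<kappa>' i"] \<kappa>' [OF i] xy by (simp add: \<kappa>'_def)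
      then have "z \<otimes> x = z \<otimes> y"
        unfolding expand [OF xy(1)] expand [OF xy(2)] using \<kappa>_closed [OF _ xy(2)] R_carrier e_closed
        by (intro finsum_cong') auto
      then show "x = y" by (rule cancel [OF xy])
    qed
    show "(\<lambda>x. \<lambda>\<phi>\<in>?D. \<phi> x) ` carrier B \<subseteq> bidual (carrier B)"
      using bidual_map_closed [OF submodule_carrier] by blast
    show "bidual (carrier B) \<subseteq> (\<lambda>x. \<lambda>\<phi>\<in>?D. \<phi> x) ` carrier B"
    proof
      fix \<Phi> assume \<Phi>: "\<Phi> \<in> bidual (carrier B)"
      \<comment> \<open>Modelled on \<open>expand\<close>, with the values of \<Phi> on the frame
        functionals in place of the coefficients.\<close>
      define b where "b = (\<Oplus>i\<in>I. \<Phi> (\<kappa>' i) \<otimes> e i)"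
      have \<Phi>R: "\<Phi> (\<kappa>' i) \<in> R" "\<Phi> (\<kappa>' i) \<in> carrier B" if "i \<in> I" for i
        using bidualD(2) [OF \<Phi> \<kappa>' [OF that]] R_carrier by auto
      have b: "b \<in> carrier B" unfolding b_def using \<Phi>R e_closed by (intro finsum_closed) auto
      have key: "\<phi> b = z \<otimes> \<Phi> \<phi>" if \<phi>: "\<phi> \<in> ?D" for \<phi>
      proof -
        have \<phi>e: "\<phi> (e i) \<in> R" "\<phi> (e i) \<in> carrier B" if "i \<in> I" for i
          using dualD(2) [OF \<phi> e_closed [OF that]] R_carrier by auto
        have "\<phi> b = (\<Oplus>i\<in>I. \<phi> (\<Phi> (\<kappa>' i) \<otimes> e i))"
          unfolding b_def using finite_I \<Phi>R e_closed by (intro dual_finsum [OF \<phi>]) auto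
        also have "\<dots> = (\<Oplus>i\<in>I. \<phi> (e i) \<otimes> \<Phi> (\<kappa>' i))"
          using \<Phi>R \<phi>e dualD(4) [OF \<phi>] e_closed R_comm by (intro finsum_cong') auto
        also have "\<dots> = \<Phi> (\<lambda>x\<in>carrier B. \<Oplus>i\<in>I. \<phi> (e i) \<otimes> \<kappa>' i x)"
          using bidual_finsum [OF \<Phi> submodule_carrier finite_I, of "\<lambda>i. \<phi> (e i)" \<kappa>'] \<phi>e \<kappa>' by simp
        \<comment> \<open>Dual form of \<open>expand\<close>: every functional becomes, after
          multiplication by \<open>z\<close>, the combination of the \<open>\<kappa>' i\<close> with
          coefficients \<open>\<phi> (e i)\<close>.\<close>
        also have "(\<lambda>x\<in>carrier B. \<Oplus>i\<in>I. \<phi> (e i) \<otimes> \<kappa>' i x) = (\<lambda>x\<in>carrier B. z \<otimes> \<phi> x)"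
        proof (rule restrict_ext)
          fix x assume x: "x \<in> carrier B"
          have \<kappa>x: "\<kappa> i x \<in> R" "\<kappa> i x \<in> carrier B" if "i \<in> I" for i
            using \<kappa>_closed [OF that x] R_carrier by auto
          have "z \<otimes> \<phi> x = \<phi> (\<Oplus>i\<in>I. \<kappa> i x \<otimes> e i)"
            using dualD(4) [OF \<phi> z(1) x] expand [OF x] by simp
          also have "\<dots> = (\<Oplus>i\<in>I. \<phi> (\<kappa> i x \<otimes> e i))"
            using finite_I \<kappa>x e_closed by (intro dual_finsum [OF \<phi>]) auto
          also have "\<dots> = (\<Oplus>i\<in>I. \<phi> (e i) \<otimes> \<kappa>' i x)"
            using \<kappa>x \<phi>e dualD(4) [OF \<phi>] e_closed R_comm x
                by (intro finsum_cong') (auto simp: \<kappa>'_def)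
          finally show "(\<Oplus>i\<in>I. \<phi> (e i) \<otimes> \<kappa>' i x) = z \<otimes> \<phi> x" by simp
        qed
        also have "\<Phi> \<dots> = z \<otimes> \<Phi> \<phi>" by (rule bidualD(4) [OF \<Phi> z(1) \<phi>])
        finally show ?thesis .
      qed
      have "\<exists>c\<in>carrier B. b = z \<otimes> c"
      proof (rule dvd [OF b])
        fix \<phi> assume "\<phi> \<in> ?D"
        then show "\<exists>q\<in>R. \<phi> b = z \<otimes> q"
          using key bidualD(2) [OF \<Phi>] by blast
      qed
      then obtain c where c: "c \<in> carrier B" "b = z \<otimes> c" by blast
      have "\<Phi> = (\<lambda>\<phi>\<in>?D. \<phi> c)"
      proof (rule extensionalityI [OF bidualD(1) [OF \<Phi>]])
        fix \<phi> assume \<phi>: "\<phi> \<in> ?D"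
        have "z \<otimes> \<Phi> \<phi> = z \<otimes> \<phi> c" using key [OF \<phi>] dualD(4) [OF \<phi> z(1) c(1)] c(2) by simp
        then show "\<Phi> \<phi> = (\<lambda>\<phi>\<in>?D. \<phi> c) \<phi>"
          using cancel R_carrier bidualD(2) [OF \<Phi> \<phi>] dualD(2) [OF \<phi> c(1)] \<phi> by simp
      qed simp
      then show "\<Phi> \<in> (\<lambda>x. \<lambda>\<phi>\<in>?D. \<phi> x) ` carrier B" using c(1) by blast
    qed
  qed
  then show ?thesis
    unfolding reflexive_module_def bidual_map_eq [abs_def] bidual_def by (simp add: as_module_def)
qed

section \<open>Twisted monoid algebras\<close>

text \<open>The built-in product on finitely supported maps is the untwisted convolution, so its
  unit and numerals are kept from replacing the monomials of exponent zero.\<close>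

declare single_one [simp del] single_of_nat [simp del]

lemma pm_expand: "(f :: 'w \<Rightarrow>\<^sub>0 'k::comm_monoid_add) = (\<Sum>k\<in>Poly_Mapping.keys f.
    Poly_Mapping.single k (Poly_Mapping.lookup f k))"
proof (rule poly_mapping_eqI)
  fix k
  show "Poly_Mapping.lookup f k = Poly_Mapping.lookup
      (\<Sum>k\<in>Poly_Mapping.keys f. Poly_Mapping.single k (Poly_Mapping.lookup f k)) k"
    by (simp add: lookup_sum lookup_single when_def in_keys_iff)
qed

lemma pm_induct [consumes 1, case_names zero single add]:
  fixes f :: "'w \<Rightarrow>\<^sub>0 'k::comm_monoid_add"
  assumes "Poly_Mapping.keys f \<subseteq> K" "P 0"
    and "\<And>k v. k \<in> K \<Longrightarrow> P (Poly_Mapping.single k v)"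
    and "\<And>f g. P f \<Longrightarrow> P g \<Longrightarrow> P (f + g)"
  shows "P f"
proof -
  have "P (\<Sum>k\<in>A. Poly_Mapping.single k (Poly_Mapping.lookup f k))" if "A \<subseteq> K" for A
    using that by (induction A rule: infinite_finite_induct) (auto intro: assms)
  then show ?thesis using pm_expand [of f] assms(1) by metis
qed

text \<open>Reduces identities between additive maps to monomials with exponents in
  \<open>K\<close>; most identities for twisted products below are proved by it, one argument at a
  time.\<close>

lemma pm_additive_eq:
  fixes F H :: "('w \<Rightarrow>\<^sub>0 'k::comm_monoid_add) \<Rightarrow> 'c::ab_group_add"
  assumes "Poly_Mapping.keys f \<subseteq> K"
    and F: "\<And>f g. F (f + g) = F f + F g" and H: "\<And>f g. H (f + g) = H f + H g"
    and "\<And>k v. k \<in> K \<Longrightarrow> F (Poly_Mapping.single k v) = H (Poly_Mapping.single k v)"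
  shows "F f = H f"
  using assms(1)
proof (induction f rule: pm_induct)
  case zero
  have "F 0 = 0" "H 0 = 0" using F [of 0 0] H [of 0 0] by simp_all
  then show ?case by simp
qed (simp_all add: assms)

definition lin_ext :: "('w \<Rightarrow> 'k \<Rightarrow> 'c) \<Rightarrow> ('w \<Rightarrow>\<^sub>0 'k::zero) \<Rightarrow> 'c::comm_monoid_add" where
  "lin_ext F f = (\<Sum>w\<in>Poly_Mapping.keys f. F w (Poly_Mapping.lookup f w))"

lemma lin_ext_superset:
  assumes "finite A" "Poly_Mapping.keys f \<subseteq> A" "\<And>w. F w 0 = 0"
  shows "lin_ext F f = (\<Sum>w\<in>A. F w (Poly_Mapping.lookup f w))"
  unfolding lin_ext_def using assms by (intro sum.mono_neutral_left) (auto simp: in_keys_iff)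

lemma lin_ext_add:
  fixes F :: "'w \<Rightarrow> 'k::comm_monoid_add \<Rightarrow> 'c::comm_monoid_add"
  assumes F: "\<And>w. F w 0 = 0" "\<And>w a b. F w (a + b) = F w a + F w b"
  shows "lin_ext F (f + g) = lin_ext F f + lin_ext F g"
proof -
  let ?A = "Poly_Mapping.keys f \<union> Poly_Mapping.keys g"
  have "lin_ext F h = (\<Sum>w\<in>?A. F w (Poly_Mapping.lookup h w))" if "Poly_Mapping.keys h \<subseteq> ?A" for h
    using that F(1) by (intro lin_ext_superset) auto
  then show ?thesis
    using keys_add [of f g] by (simp add: lookup_add F(2) sum.distrib)
qed

lemma lin_ext_single: "F w 0 = 0 \<Longrightarrow> lin_ext F (Poly_Mapping.single w a) = F w a"
  by (simp add: lin_ext_def)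

text \<open>One construction for both algebras: words under concatenation with trivial twist, and
  exponents under addition with twist \<open>chi\<close>.\<close>

definition conv :: "('w \<Rightarrow> 'w \<Rightarrow> 'w) \<Rightarrow> ('w \<Rightarrow> 'w \<Rightarrow> 'k) \<Rightarrow> ('w \<Rightarrow>\<^sub>0 'k::field) \<Rightarrow> ('w \<Rightarrow>\<^sub>0 'k) \<Rightarrow> 'w \<Rightarrow>\<^sub>0 'k"
    where
  "conv m c f g = lin_ext (\<lambda>u a. lin_ext (\<lambda>v b. Poly_Mapping.single (m u v) (a * b * c u v)) g) f"

lemma lin_ext_plus_fun:
  "lin_ext (\<lambda>w a. F w a + H w a) f = lin_ext F f + lin_ext H f"
  by (simp add: lin_ext_def sum.distrib)

lemma conv_inner:
  "lin_ext (\<lambda>v b. Poly_Mapping.single (m u v) ((a::'k::field) * b * c u v)) (g + h) =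
    lin_ext (\<lambda>v b. Poly_Mapping.single (m u v) (a * b * c u v)) g +
    lin_ext (\<lambda>v b. Poly_Mapping.single (m u v) (a * b * c u v)) h"
  by (rule lin_ext_add) (simp_all add: single_add [symmetric] algebra_simps)

lemma conv_add_right: "conv m c f (g + h) = conv m c f g + conv m c f h"
  by (simp add: conv_def conv_inner lin_ext_plus_fun)

lemma conv_add_left: "conv m c (f + g) h = conv m c f h + conv m c g h"
  unfolding conv_def
proof (rule lin_ext_add)
  show "lin_ext (\<lambda>v b. Poly_Mapping.single (m w v) (0 * b * c w v)) h = 0" for w
    by (simp add: lin_ext_def)
  show "lin_ext (\<lambda>v ba. Poly_Mapping.single (m w v) ((a + b) * ba * c w v)) h =
     lin_ext (\<lambda>v ba. Poly_Mapping.single (m w v) (a * ba * c w v)) h +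
     lin_ext (\<lambda>v ba. Poly_Mapping.single (m w v) (b * ba * c w v)) h" for w a b
    unfolding lin_ext_plus_fun [symmetric] by (simp add: single_add [symmetric] algebra_simps)
qed

lemma conv_single:
  "conv m c (Poly_Mapping.single u a) (Poly_Mapping.single v b) =
      Poly_Mapping.single (m u v) (a * b * c u v)"
  unfolding conv_def
  by (subst lin_ext_single; (subst lin_ext_single)?) (simp_all add: lin_ext_def)

lemma conv_zero_left [simp]: "conv m c 0 g = 0"
  by (simp add: conv_def lin_ext_def)

lemma conv_zero_right [simp]: "conv m c f 0 = 0"
  by (simp add: conv_def lin_ext_def)

lemma conv_minus_left: "conv m c (- f) g = - conv m c f g"
  using conv_add_left [of m c "- f" f g] by (simp add: eq_neg_iff_add_eq_0)

lemma conv_minus_right: "conv m c f (- g) = - conv m c f g"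
  using conv_add_right [of m c f "- g" g] by (simp add: eq_neg_iff_add_eq_0)

lemma conv_diff_left: "conv m c (f - f') g = conv m c f g - conv m c f' g"
  using conv_add_left [of m c f "- f'" g] by (simp add: conv_minus_left)

lemma conv_diff_right: "conv m c f (g - g') = conv m c f g - conv m c f g'"
  using conv_add_right [of m c f g "- g'"] by (simp add: conv_minus_right)

lemma conv_sum_left: "conv m c (sum f A) g = (\<Sum>a\<in>A. conv m c (f a) g)"
  by (induction A rule: infinite_finite_induct) (auto simp: conv_add_left)

lemma conv_sum_right: "conv m c f (sum g A) = (\<Sum>a\<in>A. conv m c f (g a))"
  by (induction A rule: infinite_finite_induct) (auto simp: conv_add_right)

lemma keys_conv: "Poly_Mapping.keys (conv m c f g) \<subseteq> (\<lambda>(u, v).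
    m u v) ` (Poly_Mapping.keys f \<times> Poly_Mapping.keys g)"
proof -
  have "Poly_Mapping.keys (conv m c f g) \<subseteq>
      (\<Union>u\<in>Poly_Mapping.keys f. \<Union>v\<in>Poly_Mapping.keys g. {m u v})"
    unfolding conv_def lin_ext_def
    by (intro order_trans [OF keys_sum] UN_mono order_refl) auto
  then show ?thesis by auto
qed

text \<open>On monomials, associativity is the 2-cocycle identity for the twist \<open>c\<close>; it
  extends by additivity in each argument.\<close>

lemma conv_assoc:
  assumes "\<And>u v w. m (m u v) w = m u (m v w)"
    and "\<And>u v w. u \<in> K \<Longrightarrow> v \<in> K \<Longrightarrow> w \<in> K \<Longrightarrow> c u v * c (m u v) w = c v w * c u (m v w)"
    and "Poly_Mapping.keys f \<subseteq> K" "Poly_Mapping.keys g \<subseteq> K" "Poly_Mapping.keys h \<subseteq> K"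
  shows "conv m c (conv m c f g) h = conv m c f (conv m c g h)"
proof -
  have 1: "conv m c (conv m c (Poly_Mapping.single u x) (Poly_Mapping.single v y))
      (Poly_Mapping.single w z) =
    conv m c (Poly_Mapping.single u x) (conv m c (Poly_Mapping.single v y) (Poly_Mapping.single w
        z))"
    if "u \<in> K" "v \<in> K" "w \<in> K" for u v w x y z
    unfolding conv_single assms(1) using assms(2) [OF that]
        by (simp add: mult.assoc mult.left_commute mult.commute) 
  have 2: "conv m c (conv m c (Poly_Mapping.single u x) (Poly_Mapping.single v y)) h =
    conv m c (Poly_Mapping.single u x) (conv m c (Poly_Mapping.single v y) h)" if "u \<in> K" "v \<in> K"
        for u v x y
    using assms(5) by (rule pm_additive_eq) (simp_all add: conv_add_right 1 that)
  have 3: "conv m c (conv m c (Poly_Mapping.single u x) g) h =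
    conv m c (Poly_Mapping.single u x) (conv m c g h)" if "u \<in> K" for u x
    using assms(4) by (rule pm_additive_eq) (simp_all add: conv_add_right conv_add_left 2 that)
  show ?thesis
    using assms(3) by (rule pm_additive_eq) (simp_all add: conv_add_left 3)
qed

definition restrict_keys :: "'w set \<Rightarrow> ('w \<Rightarrow>\<^sub>0 'k::zero) \<Rightarrow> 'w \<Rightarrow>\<^sub>0 'k" where
  "restrict_keys C f = Poly_Mapping.mapp (\<lambda>k v. v when k \<in> C) f"

lemma lookup_restrict_keys:
  "Poly_Mapping.lookup (restrict_keys C f) k = (if k \<in> C then Poly_Mapping.lookup f k else 0)"
  by (simp add: restrict_keys_def lookup_mapp when_def in_keys_iff)

lemma keys_restrict_keys: "Poly_Mapping.keys (restrict_keys C f) = Poly_Mapping.keys f \<inter> C"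
  by (auto simp: in_keys_iff lookup_restrict_keys split: if_splits)

lemma restrict_keys_add: "restrict_keys C (f + g) = restrict_keys C f + restrict_keys C g"
  by (rule poly_mapping_eqI) (simp add: lookup_restrict_keys lookup_add)

lemma restrict_keys_zero [simp]: "restrict_keys C 0 = 0"
  by (rule poly_mapping_eqI) (simp add: lookup_restrict_keys)

lemma restrict_keys_single:
  "restrict_keys C (Poly_Mapping.single k v) = (if k \<in> C then Poly_Mapping.single k v else 0)"
  by (rule poly_mapping_eqI) (simp add: lookup_restrict_keys lookup_single when_def)

lemma restrict_keys_partition:
  assumes "finite A" "\<And>k. k \<in> Poly_Mapping.keys f \<Longrightarrow> d k \<in> A"
  shows "f = (\<Sum>a\<in>A. restrict_keys {k. d k = a} f)"
proof (rule poly_mapping_eqI)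
  fix k
  have "Poly_Mapping.lookup (\<Sum>a\<in>A. restrict_keys {k. d k = a} f) k =
      (\<Sum>a\<in>A. if d k = a then Poly_Mapping.lookup f k else 0)"
    by (simp add: lookup_sum lookup_restrict_keys)
  also have "\<dots> = (if d k \<in> A then Poly_Mapping.lookup f k else 0)"
    using assms(1) by simp
  finally show "Poly_Mapping.lookup f k = Poly_Mapping.lookup (\<Sum>a\<in>A. restrict_keys {k. d k =
      a} f) k"
    using assms(2) [of k] by (auto simp: in_keys_iff)
qed

lemma lookup_conv_single_right:
  assumes "\<And>u u'. m u v = m u' v \<Longrightarrow> u = u'"
  shows "Poly_Mapping.lookup (conv m c f (Poly_Mapping.single v b)) (m u v) =
      Poly_Mapping.lookup f u * b * c u v"
  by (rule pm_additive_eq [of f UNIV])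
    (use assms in \<open>auto simp: conv_add_left lookup_add conv_single lookup_single when_def
        algebra_simps\<close>)

section \<open>The quantum torus\<close>

locale quantum_torus =
  fixes n :: nat and p :: "nat \<Rightarrow> nat \<Rightarrow> 'k::field"
  assumes p_nonzero: "\<And>i j. i \<in> {1..n} \<Longrightarrow> j \<in> {1..n} \<Longrightarrow> p i j \<noteq> 0"
    and p_root: "\<And>i j. i \<in> {1..n} \<Longrightarrow> j \<in> {1..n} \<Longrightarrow> \<exists>m>0. p i j ^ m = 1"
begin

abbreviation lu :: "(nat \<Rightarrow>\<^sub>0 int) \<Rightarrow> nat \<Rightarrow> int" where "lu \<equiv> Poly_Mapping.lookup"
abbreviation mo :: "(nat \<Rightarrow>\<^sub>0 int) \<Rightarrow> 'k \<Rightarrow> ((nat \<Rightarrow>\<^sub>0 int) \<Rightarrow>\<^sub>0 'k)" where "mo \<equiv> Poly_Mapping.single"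
abbreviation supp :: "((nat \<Rightarrow>\<^sub>0 int) \<Rightarrow>\<^sub>0 'k) \<Rightarrow> (nat \<Rightarrow>\<^sub>0 int) set" where "supp \<equiv> Poly_Mapping.keys"

text \<open>\<open>x\<^sup>a x\<^sup>b = chi a b x\<^sup>a\<^sup>+\<^sup>b\<close> for the ordered monomials \<open>x\<^sup>a\<close>,
    by moving \<open>x\<^sub>i\<close> to the left past \<open>x\<^sub>j\<close>
  for all \<open>i < j\<close>.\<close>

definition chi :: "(nat \<Rightarrow>\<^sub>0 int) \<Rightarrow> (nat \<Rightarrow>\<^sub>0 int) \<Rightarrow> 'k" where
  "chi a b = (\<Prod>j\<in>{1..n}. \<Prod>i\<in>{1..<j}. p i j powi (lu a j * lu b i))"

lemma p_nz: "j \<in> {1..n} \<Longrightarrow> i \<in> {1..<j} \<Longrightarrow> p i j \<noteq> 0"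
  using p_nonzero by auto

lemma chi_add_left: "chi (a + b) c = chi a c * chi b c"
  unfolding chi_def prod.distrib [symmetric]
  by (intro prod.cong refl) (simp add: lookup_add distrib_right power_int_add p_nz)

lemma chi_add_right: "chi a (b + c) = chi a b * chi a c"
  unfolding chi_def prod.distrib [symmetric]
  by (intro prod.cong refl) (simp add: lookup_add distrib_left power_int_add p_nz)

lemma chi_zero [simp]: "chi 0 b = 1" "chi a 0 = 1"
  by (simp_all add: chi_def)

lemma chi_nonzero [simp]: "chi a b \<noteq> 0"
  unfolding chi_def by (auto simp: power_int_eq_0_iff p_nz)

text \<open>A common exponent annihilating all \<open>p i j\<close>, not necessarily the least one.
  It exists because the product of the individual exponents has this property.\<close>

definition period :: nat where
  "period = (SOME m. m > 0 \<and> (\<forall>i\<in>{1..n}. \<forall>j\<in>{1..n}. p i j ^ m = 1))"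

lemma period: "period > 0" "i \<in> {1..n} \<Longrightarrow> j \<in> {1..n} \<Longrightarrow> p i j ^ period = 1"
proof -
  have "\<exists>m>0. \<forall>x\<in>{1..n}\<times>{1..n}. p (fst x) (snd x) ^ m = 1"
  proof -
    have "\<forall>x\<in>{1..n}\<times>{1..n}. \<exists>m>0. p (fst x) (snd x) ^ m = 1"
      using p_root by auto
    then obtain f where f: "\<And>x. x \<in> {1..n}\<times>{1..n} \<Longrightarrow> f x > (0::nat) \<and> p (fst x) (snd x) ^ f x = 1"
      by metis
    let ?m = "\<Prod>x\<in>{1..n}\<times>{1..n}. f x"
    have "?m > 0" using f by (intro prod_pos) auto
    moreover have "p (fst x) (snd x) ^ ?m = 1" if x: "x \<in> {1..n}\<times>{1..n}" for x
    proof -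
      have "f x dvd ?m" using x by (intro dvd_prodI) auto
      then obtain q where "?m = f x * q" by (elim dvdE)
      then show ?thesis using f [OF x] by (simp add: power_mult)
    qed
    ultimately show ?thesis by blast
  qed
  then have "\<exists>m. m > 0 \<and> (\<forall>i\<in>{1..n}. \<forall>j\<in>{1..n}. p i j ^ m = 1)"
    by auto
  from someI_ex [OF this] show "period > 0" "i \<in> {1..n} \<Longrightarrow> j \<in> {1..n} \<Longrightarrow> p i j ^ period = 1"
    unfolding period_def [symmetric] by auto
qed

lemma powi_period: 
  assumes "j \<in> {1..n}" "i \<in> {1..<j}" "int period dvd k"
  shows "p i j powi k = 1"
proof -
  from assms(3) obtain q where "k = int period * q" by (elim dvdE)
  moreover have "p i j ^ period = 1" using assms by (intro period) auto
  ultimately show ?thesis by (simp add: power_int_mult)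
qed

text \<open>Exponents divisible by the period multiply without twist. They provide central monomials
  by which exponents can be shifted freely.\<close>

lemma chi_period:
  assumes "\<And>i. int period dvd lu a i"
  shows "chi a b = 1" "chi b a = 1"
  unfolding chi_def using assms by (auto intro!: prod.neutral powi_period)

definition expts :: "(nat \<Rightarrow>\<^sub>0 int) set" where
  "expts = {a. Poly_Mapping.keys a \<subseteq> {1..n}}"

definition pos :: "(nat \<Rightarrow>\<^sub>0 int) set" where
  "pos = {a \<in> expts. \<forall>i\<in>{1..n}. lu a i \<ge> 0}"

lemma expts_add: "a \<in> expts \<Longrightarrow> b \<in> expts \<Longrightarrow> a + b \<in> expts"
  and expts_diff: "a \<in> expts \<Longrightarrow> b \<in> expts \<Longrightarrow> a - b \<in> expts"
  and expts_minus: "a \<in> expts \<Longrightarrow> - a \<in> expts"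
  and expts_zero: "0 \<in> expts"
  using keys_add [of a b] keys_diff [of a b] by (auto simp: expts_def)

lemma pos_expts: "a \<in> pos \<Longrightarrow> a \<in> expts"
  by (simp add: pos_def)

lemma pos_add: "a \<in> pos \<Longrightarrow> b \<in> pos \<Longrightarrow> a + b \<in> pos"
  and pos_zero: "0 \<in> pos"
  by (auto simp: pos_def expts_add expts_zero lookup_add)

lemma expts_lookup: "a \<in> expts \<Longrightarrow> i \<notin> {1..n} \<Longrightarrow> lu a i = 0"
  unfolding expts_def by (metis (mono_tags) mem_Collect_eq not_in_keys_iff_lookup_eq_zero subsetD)

lemma expts_eqI:
  assumes "a \<in> expts" "b \<in> expts" "\<And>i. i \<in> {1..n} \<Longrightarrow> lu a i = lu b i"
  shows "a = b"
proof (rule poly_mapping_eqI)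
  fix i show "lu a i = lu b i"
    using assms(3) [of i] expts_lookup [OF assms(1), of i] expts_lookup [OF assms(2), of i] by argo
qed

definition expt :: "(nat \<Rightarrow> int) \<Rightarrow> nat \<Rightarrow>\<^sub>0 int" where
  "expt f = (\<Sum>i\<in>{1..n}. Poly_Mapping.single i (f i))"

lemma lookup_expt: "lu (expt f) i = (if i \<in> {1..n} then f i else 0)"
  by (simp add: expt_def lookup_sum lookup_single when_def)

lemma expt_expts: "expt f \<in> expts"
  unfolding expts_def using in_keys_iff [of _ "expt f"] by (auto simp: lookup_expt split: if_splits)

lemma expt_pos: "(\<And>i. i \<in> {1..n} \<Longrightarrow> f i \<ge> 0) \<Longrightarrow> expt f \<in> pos"
  by (simp add: pos_def expt_expts lookup_expt)

text \<open>The radical of the alternating bicharacter \<open>chi a b / chi b a\<close>, which is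
  the commutation factor of \<open>x^a\<close> and \<open>x^b\<close>.\<close>

definition lat :: "(nat \<Rightarrow>\<^sub>0 int) set" where
  "lat = {a \<in> expts. \<forall>b\<in>expts. chi a b = chi b a}"

lemma chi_minus_left: "chi (- a) b = inverse (chi a b)"
  using chi_add_left [of "- a" a b] by (simp add: field_simps)

lemma chi_minus_right: "chi a (- b) = inverse (chi a b)"
  using chi_add_right [of a "- b" b] by (simp add: field_simps)

lemma lat_comm: "a \<in> lat \<Longrightarrow> b \<in> expts \<Longrightarrow> chi a b = chi b a"
  by (simp add: lat_def)

lemma lat_add: "a \<in> lat \<Longrightarrow> b \<in> lat \<Longrightarrow> a + b \<in> lat"
  and lat_minus: "a \<in> lat \<Longrightarrow> - a \<in> lat"
  and lat_zero: "0 \<in> lat"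
  by (auto simp: lat_def expts_add expts_minus expts_zero chi_add_left chi_add_right chi_minus_left
      chi_minus_right)

lemma lat_diff: "a \<in> lat \<Longrightarrow> b \<in> lat \<Longrightarrow> a - b \<in> lat"
  using lat_add [OF _ lat_minus, of a b] by simp

lemma lat_period: "a \<in> expts \<Longrightarrow> (\<And>i. int period dvd lu a i) \<Longrightarrow> a \<in> lat"
  by (auto simp: lat_def chi_period)

lemma lat_add_iff: "a \<in> lat \<Longrightarrow> a + b \<in> lat \<longleftrightarrow> b \<in> lat"
  using lat_add [of a b] lat_diff [of "a + b" a] by auto

definition tm :: "((nat \<Rightarrow>\<^sub>0 int) \<Rightarrow>\<^sub>0 'k) \<Rightarrow> ((nat \<Rightarrow>\<^sub>0 int) \<Rightarrow>\<^sub>0 'k) \<Rightarrow> (nat \<Rightarrow>\<^sub>0 int) \<Rightarrow>\<^sub>0 'k"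
    (infixl "\<star>" 70) where
  "tm = conv (+) chi"

lemma tm_mo: "mo a x \<star> mo b y = mo (a + b) (x * y * chi a b)"
  by (simp add: tm_def conv_single)

lemma tm_assoc: "(f \<star> g) \<star> h = f \<star> (g \<star> h)"
  unfolding tm_def
  by (rule conv_assoc [of _ UNIV]) (auto simp: chi_add_left chi_add_right add.assoc)

lemmas tm_add_left = conv_add_left [of "(+)" chi, folded tm_def]
  and tm_add_right = conv_add_right [of "(+)" chi, folded tm_def]
  and tm_sum_left = conv_sum_left [of "(+)" chi, folded tm_def]
  and tm_sum_right = conv_sum_right [of "(+)" chi, folded tm_def]
  and tm_zero [simp] = conv_zero_left [of "(+)" chi, folded tm_def] conv_zero_right [of "(+)"
      chi, folded tm_def]
  and supp_tm_image = keys_conv [of "(+)" chi, folded tm_def]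

lemma supp_tmE:
  assumes "c \<in> supp (f \<star> g)"
  obtains a b where "a \<in> supp f" "b \<in> supp g" "c = a + b"
  using assms supp_tm_image [of f g] by auto

lemma tm_one_left: "mo 0 1 \<star> f = f"
  by (rule pm_additive_eq [of f UNIV]) (auto simp: tm_add_right tm_mo)

lemma tm_one_right: "f \<star> mo 0 1 = f"
  by (rule pm_additive_eq [of f UNIV]) (auto simp: tm_add_left tm_mo)

lemma lookup_tm_mo: "Poly_Mapping.lookup (f \<star> mo b y) (a + b) =
    Poly_Mapping.lookup f a * y * chi a b"
  unfolding tm_def by (rule lookup_conv_single_right) simp

lemma tm_central:
  assumes "supp z \<subseteq> lat" "supp f \<subseteq> expts"
  shows "z \<star> f = f \<star> z"
proof -
  have 1: "mo a x \<star> f = f \<star> mo a x" if "a \<in> lat" for a x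
    using assms(2) by (rule pm_additive_eq) (auto simp: tm_add_right tm_add_left tm_mo lat_comm [OF
        that] add.commute mult.commute)
  show ?thesis
    using assms(1) by (rule pm_additive_eq) (auto simp: tm_add_right tm_add_left 1)
qed

text \<open>Leading terms: the linear order on exponents is compatible with addition, and the twist
  is a nonzero scalar, so the product of the two greatest monomials survives.\<close>

lemma tm_no_zero_divisors:
  assumes "f \<noteq> 0" "g \<noteq> 0"
  shows "f \<star> g \<noteq> 0"
proof -
  let ?a = "Max (supp f)" and ?b = "Max (supp g)"
  have ne: "supp f \<noteq> {}" "supp g \<noteq> {}" using assms by simp_all
  have a: "?a \<in> supp f" and b: "?b \<in> supp g" using ne by (simp_all add: Max_in)
  \<comment> \<open>Without its leading term, \<open>g\<close> contributes only exponents strictly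
    below the sum of the two maxima.\<close>
  let ?g = "g - mo ?b (Poly_Mapping.lookup g ?b)"
  have "Poly_Mapping.lookup (f \<star> ?g) (?a + ?b) = 0"
  proof (rule ccontr)
    assume "Poly_Mapping.lookup (f \<star> ?g) (?a + ?b) \<noteq> 0"
    then have "?a + ?b \<in> supp (f \<star> ?g)" by (simp add: in_keys_iff)
    then obtain u v where uv: "u \<in> supp f" "v \<in> supp ?g" "?a + ?b = u + v" by (rule supp_tmE)
    have "Poly_Mapping.lookup ?g v \<noteq> 0" using uv(2) by (simp add: in_keys_iff)
    then have "v \<in> supp g" "v \<noteq> ?b"
      by (auto simp: lookup_minus lookup_single in_keys_iff when_def split: if_splits)
    then have "v < ?b" by (simp add: order.strict_iff_order)
    moreover have "u \<le> ?a" using uv(1) by simp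
    ultimately have "u + v < ?a + ?b" by (rule add_le_less_mono [rotated])
    then show False using uv(3) by simp
  qed
  moreover have "f \<star> g = f \<star> ?g + f \<star> mo ?b (Poly_Mapping.lookup g ?b)"
    by (simp add: tm_add_right [symmetric])
  ultimately have "Poly_Mapping.lookup (f \<star> g) (?a + ?b) =
      Poly_Mapping.lookup f ?a * Poly_Mapping.lookup g ?b * chi ?a ?b"
    by (simp add: lookup_add lookup_tm_mo)
  then show ?thesis using a b by (auto simp: in_keys_iff)
qed

definition tr where "tr = restrict_keys lat"

lemma tr_add: "tr (f + g) = tr f + tr g"
  by (simp add: tr_def restrict_keys_add)

lemma tr_mo: "tr (mo a x) = (if a \<in> lat then mo a x else 0)"
  by (simp add: tr_def restrict_keys_single)

lemma tr_zero [simp]: "tr 0 = 0" by (simp add: tr_def)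

lemma supp_tr: "supp (tr f) = supp f \<inter> lat"
  by (simp add: tr_def keys_restrict_keys)

lemma tr_tm_central:
  assumes "supp z \<subseteq> lat"
  shows "tr (z \<star> f) = z \<star> tr f"
proof -
  have 1: "tr (mo a x \<star> f) = mo a x \<star> tr f" if "a \<in> lat" for a x
    by (rule pm_additive_eq [of f UNIV])
      (auto simp: tm_add_right tr_add tm_mo tr_mo lat_add_iff [OF that])
  show ?thesis
    using assms by (rule pm_additive_eq) (auto simp: tm_add_left tr_add 1)
qed

end

section \<open>Ordered monomials form a basis of the skew polynomial ring\<close>

lemma free_algebra_carrier: "f \<in> carrier (free_algebra n) \<longleftrightarrow> Poly_Mapping.keys f \<subseteq> {w.
    set w \<subseteq> {1..n}}"
  by (auto simp: free_algebra_def)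

lemma free_algebra_ops:
  "f \<otimes>\<^bsub>free_algebra n\<^esub> g = conv (@) (\<lambda>_ _. 1) f g"
  "f \<oplus>\<^bsub>free_algebra n\<^esub> g = f + g"
  "\<zero>\<^bsub>free_algebra n\<^esub> = 0" "\<one>\<^bsub>free_algebra n\<^esub> = Poly_Mapping.single [] 1"
  by (simp_all add: free_algebra_def conv_def lin_ext_def)

lemma ring_free_algebra: "ring (free_algebra n :: (nat list \<Rightarrow>\<^sub>0 'k::field) ring)"
proof (intro ringI abelian_groupI monoidI)
  let ?A = "free_algebra n :: (nat list \<Rightarrow>\<^sub>0 'k) ring"
  fix f g h :: "nat list \<Rightarrow>\<^sub>0 'k"
  assume f: "f \<in> carrier ?A" and g: "g \<in> carrier ?A"
  show "f \<oplus>\<^bsub>?A\<^esub> g \<in> carrier ?A"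
    using f g keys_add [of f g] unfolding free_algebra_carrier free_algebra_ops by blast
  show "f \<otimes>\<^bsub>?A\<^esub> g \<in> carrier ?A"
    using f g keys_conv [of "(@)" "\<lambda>_ _. 1" f g] unfolding free_algebra_carrier free_algebra_ops
        by fastforce
  show "f \<otimes>\<^bsub>?A\<^esub> g \<otimes>\<^bsub>?A\<^esub> h = f \<otimes>\<^bsub>?A\<^esub> (g \<otimes>\<^bsub>?A\<^esub> h)"
    unfolding free_algebra_ops by (rule conv_assoc [of _ UNIV]) auto
  have "- f \<in> carrier ?A" "- f \<oplus>\<^bsub>?A\<^esub> f = \<zero>\<^bsub>?A\<^esub>"
    using f by (simp_all add: free_algebra_carrier free_algebra_ops)
  then show "\<exists>y\<in>carrier ?A. y \<oplus>\<^bsub>?A\<^esub> f = \<zero>\<^bsub>?A\<^esub>" by blast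
  show "\<one>\<^bsub>?A\<^esub> \<otimes>\<^bsub>?A\<^esub> f = f"
    unfolding free_algebra_ops by (rule pm_additive_eq [of f UNIV]) (auto simp: conv_add_right
        conv_single)
  show "f \<otimes>\<^bsub>?A\<^esub> \<one>\<^bsub>?A\<^esub> = f"
    unfolding free_algebra_ops by (rule pm_additive_eq [of f UNIV]) (auto simp: conv_add_left
        conv_single)
qed (auto simp: free_algebra_carrier free_algebra_ops conv_add_left conv_add_right)

section \<open>Evaluation of words and the kernel of the presentation\<close>

context quantum_torus
begin

definition qring :: "((nat \<Rightarrow>\<^sub>0 int) \<Rightarrow>\<^sub>0 'k) ring" where
  "qring = \<lparr>carrier = {f. supp f \<subseteq> pos}, mult = (\<star>), one = mo 0 1, ring.zero = 0, ring.add = (+)\<rparr>"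

lemma qring_simps:
  "f \<in> carrier qring \<longleftrightarrow> supp f \<subseteq> pos"
  "f \<otimes>\<^bsub>qring\<^esub> g = f \<star> g" "f \<oplus>\<^bsub>qring\<^esub> g = f + g" "\<zero>\<^bsub>qring\<^esub> = 0" "\<one>\<^bsub>qring\<^esub> = mo 0 1"
  by (simp_all add: qring_def)

lemma supp_tm_pos: "supp f \<subseteq> pos \<Longrightarrow> supp g \<subseteq> pos \<Longrightarrow> supp (f \<star> g) \<subseteq> pos"
  by (auto elim!: supp_tmE intro: pos_add)

lemma ring_qring: "ring qring"
proof (intro ringI abelian_groupI monoidI)
  fix f assume f: "f \<in> carrier qring"
  then have "- f \<in> carrier qring" "- f \<oplus>\<^bsub>qring\<^esub> f = \<zero>\<^bsub>qring\<^esub>"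
    by (simp_all add: qring_simps)
  then show "\<exists>y\<in>carrier qring. y \<oplus>\<^bsub>qring\<^esub> f = \<zero>\<^bsub>qring\<^esub>" by blast
  fix g assume g: "g \<in> carrier qring"
  show "f \<oplus>\<^bsub>qring\<^esub> g \<in> carrier qring"
    using f g keys_add [of f g] unfolding qring_simps by blast
qed (auto simp: qring_simps tm_add_left tm_add_right tm_assoc tm_one_left tm_one_right pos_zero
      add.assoc add.commute dest: supp_tm_pos)

primrec content :: "nat list \<Rightarrow> nat \<Rightarrow>\<^sub>0 int" where
  "content [] = 0"
| "content (i # w) = Poly_Mapping.single i 1 + content w"

text \<open>The scalar by which a word, read as a product of generators, differs from the ordered
  monomial with the same content. Letters are multiplied in from the left.\<close>

primrec word_coeff :: "nat list \<Rightarrow> 'k" where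
  "word_coeff [] = 1"
| "word_coeff (i # w) = word_coeff w * chi (Poly_Mapping.single i 1) (content w)"

lemma content_append: "content (u @ v) = content u + content v"
  by (induction u) (auto simp: add.assoc)

lemma word_coeff_append: "word_coeff (u @ v) = word_coeff u * word_coeff v * chi (content u)
    (content v)"
  by (induction u) (auto simp: content_append chi_add_left chi_add_right)

lemma word_coeff_nonzero: "word_coeff w \<noteq> 0"
  by (induction w) auto

lemma lookup_content: "lu (content w) i = int (count (mset w) i)"
  by (induction w) (auto simp: lookup_add lookup_single when_def)

lemma content_pos:
  assumes "set w \<subseteq> {1..n}"
  shows "content w \<in> pos"
proof -
  have "Poly_Mapping.keys (content w) \<subseteq> {1..n}"
  proof
    fix i assume "i \<in> Poly_Mapping.keys (content w)"
    then have "count (mset w) i \<noteq> 0" by (simp add: in_keys_iff lookup_content)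
    then have "i \<in> set w" by (simp add: count_eq_zero_iff)
    then show "i \<in> {1..n}" using assms by blast
  qed
  then show ?thesis by (simp add: pos_def expts_def lookup_content)
qed

definition ordered_word :: "(nat \<Rightarrow>\<^sub>0 int) \<Rightarrow> nat list" where
  "ordered_word a = concat (map (\<lambda>i. replicate (nat (lu a i)) i) [1..<Suc n])"

lemma set_ordered_word: "set (ordered_word a) \<subseteq> {1..n}"
  by (auto simp: ordered_word_def)

lemma content_ordered_word:
  assumes "a \<in> pos"
  shows "content (ordered_word a) = a"
proof (rule expts_eqI [OF pos_expts [OF content_pos [OF set_ordered_word]] pos_expts [OF assms]])
  fix i assume i: "i \<in> {1..n}"
  have rep: "count (mset (concat (map (\<lambda>i. replicate (f i) i) xs))) j = (\<Sum>k\<leftarrow>xs. if k =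
      j then f k else 0)"
    for f :: "nat \<Rightarrow> nat" and xs j
    by (induction xs) auto
  have "(\<Sum>k\<leftarrow>[1..<Suc n]. if k = i then nat (lu a k) else 0) = (\<Sum>k\<in>{1..<Suc n}. if k =
      i then nat (lu a k) else 0)"
    by (subst sum_list_distinct_conv_sum_set) (auto simp del: upt_Suc)
  also have "\<dots> = nat (lu a i)" using i by simp
  finally have "count (mset (ordered_word a)) i = nat (lu a i)"
    unfolding ordered_word_def rep .
  then show "lu (content (ordered_word a)) i = lu a i"
    using assms i by (simp add: lookup_content pos_def)
qed

definition eval_words :: "(nat list \<Rightarrow>\<^sub>0 'k) \<Rightarrow> (nat \<Rightarrow>\<^sub>0 int) \<Rightarrow>\<^sub>0 'k" where
  "eval_words = lin_ext (\<lambda>w x. mo (content w) (x * word_coeff w))"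

lemma eval_words_add: "eval_words (f + g) = eval_words f + eval_words g"
  unfolding eval_words_def by (rule lin_ext_add) (simp_all add: single_add [symmetric]
      algebra_simps)

lemma eval_words_zero [simp]: "eval_words 0 = 0"
  by (simp add: eval_words_def lin_ext_def)

lemma eval_words_single: "eval_words (Poly_Mapping.single w x) = mo (content w) (x * word_coeff w)"
  unfolding eval_words_def by (rule lin_ext_single) simp

lemma eval_words_conv: "eval_words (conv (@) (\<lambda>_ _. 1) f g) = eval_words f \<star> eval_words g"
proof -
  have 1: "eval_words (conv (@) (\<lambda>_ _. 1) (Poly_Mapping.single u x) g) =
      eval_words (Poly_Mapping.single u x) \<star> eval_words g" for u x
    by (rule pm_additive_eq [of g UNIV])
      (auto simp: conv_add_right eval_words_add tm_add_right conv_single eval_words_single tm_mo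
        content_append word_coeff_append algebra_simps)
  show ?thesis
    by (rule pm_additive_eq [of f UNIV]) (auto simp: conv_add_left eval_words_add tm_add_left 1)
qed

lemma eval_words_closed:
  assumes "Poly_Mapping.keys f \<subseteq> {w. set w \<subseteq> {1..n}}"
  shows "supp (eval_words f) \<subseteq> pos"
  using assms
proof (induction f rule: pm_induct)
  case zero
  show ?case by simp
next
  case (single w x)
  then show ?case using content_pos [of w] by (simp add: eval_words_single)
next
  case (add f g)
  then show ?case using keys_add [of "eval_words f" "eval_words g"] by (auto simp: eval_words_add)
qed

abbreviation "FA \<equiv> free_algebra n :: (nat list \<Rightarrow>\<^sub>0 'k) ring"

lemma eval_words_hom: "ring_hom_ring FA qring eval_words"
proof (intro ring_hom_ringI ring_free_algebra ring_qring)
  show "eval_words f \<in> carrier qring" if "f \<in> carrier FA" for f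
    using that eval_words_closed by (simp add: free_algebra_carrier qring_simps)
qed (auto simp: free_algebra_ops qring_simps eval_words_add eval_words_conv eval_words_single)

text \<open>A linear section of \<open>eval_words\<close> over the polynomial exponents. Dividing by
  the coefficient of the ordered word makes it a section without computing that coefficient.\<close>

definition order_words :: "((nat \<Rightarrow>\<^sub>0 int) \<Rightarrow>\<^sub>0 'k) \<Rightarrow> nat list \<Rightarrow>\<^sub>0 'k" where
  "order_words = lin_ext (\<lambda>a x. Poly_Mapping.single (ordered_word a) (x * inverse (word_coeff
      (ordered_word a))))"

lemma order_words_add: "order_words (f + g) = order_words f + order_words g"
  unfolding order_words_def by (rule lin_ext_add) (simp_all add: single_add [symmetric]
      algebra_simps)

lemma order_words_zero [simp]: "order_words 0 = 0"
  by (simp add: order_words_def lin_ext_def)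

lemma order_words_single:
  "order_words (mo a x) = Poly_Mapping.single (ordered_word a) (x * inverse (word_coeff
      (ordered_word a)))"
  unfolding order_words_def by (rule lin_ext_single) simp

lemma eval_words_order_words: "supp f \<subseteq> pos \<Longrightarrow> eval_words (order_words f) = f"
  by (erule pm_additive_eq [where H = "\<lambda>f. f"])
    (auto simp: order_words_add eval_words_add order_words_single eval_words_single
        content_ordered_word word_coeff_nonzero mult.assoc)

lemma order_words_closed: "supp f \<subseteq> pos \<Longrightarrow> order_words f \<in> carrier FA"
proof (induction f rule: pm_induct)
  case zero
  show ?case by (simp add: free_algebra_carrier)
next
  case (single w x)
  then show ?case using set_ordered_word by (simp add: order_words_single free_algebra_carrier)
next
  case (add f g)
  then show ?case using keys_add [of "order_words f" "order_words g"]
    unfolding free_algebra_carrier order_words_add by blast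
qed

lemma eval_words_surj: "eval_words ` carrier FA = carrier qring"
proof
  show "eval_words ` carrier FA \<subseteq> carrier qring"
    using eval_words_closed by (auto simp: free_algebra_carrier qring_simps)
  show "carrier qring \<subseteq> eval_words ` carrier FA"
    using eval_words_order_words order_words_closed by (metis image_eqI qring_simps(1) subsetI)
qed

lemma chi_single:
  assumes "i \<in> {1..n}" "j \<in> {1..n}"
  shows "chi (Poly_Mapping.single j 1) (Poly_Mapping.single i 1) = (if i < j then p i j else 1)"
proof -
  have "chi (Poly_Mapping.single j 1) (Poly_Mapping.single i 1) =
    (\<Prod>j'\<in>{1..n}. if j' = j then (\<Prod>i'\<in>{1..<j'}. if i' = i then p i' j' else 1) else 1)"
    unfolding chi_def
  proof (intro prod.cong refl)
    fix j'
    show "(\<Prod>i'\<in>{1..<j'}. p i' j' powi (lu (Poly_Mapping.single j 1) j' * lu (Poly_Mapping.single i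
        1) i')) =
      (if j' = j then (\<Prod>i'\<in>{1..<j'}. if i' = i then p i' j' else 1) else 1)"
    proof (cases "j' = j")
      case True
      show ?thesis
        unfolding True
        by (simp only: simp_thms if_True, rule prod.cong [OF refl]) (simp add: lookup_single
            when_def)
    next
      case False
      then show ?thesis by (simp add: lookup_single when_def)
    qed
  qed
  also have "\<dots> = (if i < j then p i j else 1)"
    using assms by simp
  finally show ?thesis .
qed

definition rel_ideal :: "(nat list \<Rightarrow>\<^sub>0 'k) set" where
  "rel_ideal = Idl\<^bsub>FA\<^esub> (skew_relations n p)"

lemma skew_relations_carrier: "skew_relations n p \<subseteq> carrier FA"
proof
  fix r assume "r \<in> skew_relations n p"
  then obtain i j where ij: "1 \<le> i" "i < j" "j \<le> n"
    and r: "r = Poly_Mapping.single [j, i] 1 - Poly_Mapping.single [i, j] (p i j)"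
    by (auto simp: skew_relations_def)
  have "Poly_Mapping.keys r \<subseteq> {[j, i], [i, j]}"
    unfolding r by (rule order_trans [OF keys_diff]) auto
  also have "\<dots> \<subseteq> {w. set w \<subseteq> {1..n}}" using ij by auto
  finally show "r \<in> carrier FA" by (simp only: free_algebra_carrier)
qed

lemma ideal_rel_ideal: "ideal rel_ideal FA"
  unfolding rel_ideal_def by (rule ring.genideal_ideal [OF ring_free_algebra
      skew_relations_carrier])

lemma rel_ideal_add: "f \<in> rel_ideal \<Longrightarrow> g \<in> rel_ideal \<Longrightarrow> f + g \<in> rel_ideal"
  using additive_subgroup.a_closed [OF ideal.axioms(1) [OF ideal_rel_ideal], of f g]
  by (simp add: free_algebra_ops)

lemma rel_ideal_zero: "0 \<in> rel_ideal"
  using additive_subgroup.zero_closed [OF ideal.axioms(1) [OF ideal_rel_ideal]]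
  by (simp add: free_algebra_ops)

lemma rel_ideal_mult_left: 
  assumes "f \<in> rel_ideal" "set w \<subseteq> {1..n}"
  shows "conv (@) (\<lambda>_ _. 1) (Poly_Mapping.single w x) f \<in> rel_ideal"
proof -
  have "Poly_Mapping.single w x \<in> carrier FA" using assms by (simp add: free_algebra_carrier)
  from ideal.I_l_closed [OF ideal_rel_ideal assms(1) this] show ?thesis
    by (simp add: free_algebra_ops)
qed

lemma rel_ideal_mult_right: 
  assumes "f \<in> rel_ideal" "set w \<subseteq> {1..n}"
  shows "conv (@) (\<lambda>_ _. 1) f (Poly_Mapping.single w x) \<in> rel_ideal"
proof -
  have "Poly_Mapping.single w x \<in> carrier FA" using assms by (simp add: free_algebra_carrier)
  from ideal.I_r_closed [OF ideal_rel_ideal assms(1) this] show ?thesis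
    by (simp add: free_algebra_ops)
qed

lemma rel_ideal_minus:
  assumes "f \<in> rel_ideal"
  shows "- f \<in> rel_ideal"
proof -
  have "conv (@) (\<lambda>_ _. 1) (Poly_Mapping.single [] (- 1)) f = - f"
    by (rule pm_additive_eq [of f UNIV]) (auto simp: conv_add_right conv_single single_uminus
        conv_minus_left)
  then show ?thesis using rel_ideal_mult_left [OF assms, of "[]" "- 1"] by simp
qed

text \<open>Each word is normalised by its coefficient, so that words with equal content become
  congruent modulo the relations and no scalars have to be tracked while sorting.\<close>

definition word_equiv :: "nat list \<Rightarrow> nat list \<Rightarrow> bool" where
  "word_equiv u v \<longleftrightarrow> content u = content v \<and>
    Poly_Mapping.single u (inverse (word_coeff u)) - Poly_Mapping.single v (inverse (word_coeff v))
        \<in> rel_ideal"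

lemma word_equiv_refl: "word_equiv u u"
  by (simp add: word_equiv_def rel_ideal_zero)

lemma word_equiv_trans: "word_equiv u v \<Longrightarrow> word_equiv v w \<Longrightarrow> word_equiv u w"
  unfolding word_equiv_def
  using rel_ideal_add [of "Poly_Mapping.single u (inverse (word_coeff u)) - Poly_Mapping.single v
      (inverse (word_coeff v))"
      "Poly_Mapping.single v (inverse (word_coeff v)) - Poly_Mapping.single w (inverse (word_coeff
          w))"]
  by simp

lemma word_equiv_sym: 
  assumes "word_equiv u v"
  shows "word_equiv v u"
  using assms rel_ideal_minus unfolding word_equiv_def by fastforce

lemma word_equiv_Cons:
  assumes "word_equiv u v" "i \<in> {1..n}"
  shows "word_equiv (i # u) (i # v)"
proof -
  \<comment> \<open>The extra scalar turns the normalisation of \<open>u\<close> and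
    \<open>v\<close> into that of the longer words; it is the same for both because their contents
    agree.\<close>
  have "conv (@) (\<lambda>_ _. 1) (Poly_Mapping.single [i] (inverse (chi (Poly_Mapping.single i 1) (content
      v))))
      (Poly_Mapping.single u (inverse (word_coeff u)) - Poly_Mapping.single v (inverse (word_coeff
          v))) \<in> rel_ideal"
    using assms by (intro rel_ideal_mult_left) (auto simp: word_equiv_def)
  then show ?thesis
    using assms unfolding word_equiv_def by (simp add: conv_diff_right conv_single mult.commute)
qed

text \<open>The defining relation times \<open>w\<close>. The factor \<open>p j i\<close> in the
  relation is exactly the quotient of the two word coefficients.\<close>

lemma word_equiv_swap:
  assumes "j < i" "j \<in> {1..n}" "i \<in> {1..n}" "set w \<subseteq> {1..n}"
  shows "word_equiv (i # j # w) (j # i # w)"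
proof -
  let ?r = "Poly_Mapping.single [i, j] 1 - Poly_Mapping.single [j, i] (p j i)"
  have "?r \<in> skew_relations n p"
    using assms unfolding skew_relations_def by auto
  then have "?r \<in> rel_ideal"
    unfolding rel_ideal_def using ring.genideal_self [OF ring_free_algebra skew_relations_carrier]
        by blast
  then have "conv (@) (\<lambda>_ _. 1) ?r (Poly_Mapping.single w (inverse (word_coeff (i # j # w)))) \<in>
      rel_ideal"
    using assms(4) by (rule rel_ideal_mult_right)
  moreover have "word_coeff (i # j # w) = p j i * word_coeff (j # i # w)"
    using assms by (simp add: chi_add_right chi_single)
  ultimately show ?thesis
    unfolding word_equiv_def using p_nonzero [OF assms(2,3)]
    by (simp add: conv_diff_left conv_single add.left_commute mult.assoc [symmetric] del:
        word_coeff.simps)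
qed

lemma word_equiv_insort:
  assumes "set w \<subseteq> {1..n}" "i \<in> {1..n}"
  shows "word_equiv (i # w) (insort i w)"
  using assms(1)
proof (induction w)
  case Nil
  show ?case by (simp add: word_equiv_refl)
next
  case (Cons j w)
  show ?case
  proof (cases "i \<le> j")
    case True
    then show ?thesis by (simp add: word_equiv_refl)
  next
    case False
    have "word_equiv (i # j # w) (j # i # w)"
      using False Cons.prems assms(2) by (intro word_equiv_swap) auto
    moreover have "word_equiv (j # i # w) (j # insort i w)"
      using Cons by (intro word_equiv_Cons) auto
    ultimately show ?thesis using False by (auto intro: word_equiv_trans)
  qed
qed

lemma word_equiv_sort:
  assumes "set w \<subseteq> {1..n}"
  shows "word_equiv w (sort w)"
  using assms
proof (induction w)
  case Nil
  show ?case by (simp add: word_equiv_refl)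
next
  case (Cons i w)
  have "word_equiv (i # w) (i # sort w)" using Cons by (intro word_equiv_Cons) auto
  moreover have "word_equiv (i # sort w) (insort i (sort w))" using Cons.prems
    by (intro word_equiv_insort) auto
  ultimately show ?case by (auto intro: word_equiv_trans)
qed

text \<open>Equal contents mean equal multisets of letters, so insertion sort brings both words to
  the same word.\<close>

lemma word_equivI:
  assumes "set u \<subseteq> {1..n}" "set v \<subseteq> {1..n}" "content u = content v"
  shows "word_equiv u v"
proof -
  have "mset u = mset v"
  proof (rule multiset_eqI)
    fix i show "count (mset u) i = count (mset v) i"
      using arg_cong [OF assms(3), of "\<lambda>a. lu a i"] by (simp add: lookup_content)
  qed
  then have "sort u = sort v" by (intro properties_for_sort) auto
  then show ?thesis
    using word_equiv_trans [OF word_equiv_sort [OF assms(1)]] word_equiv_sym [OF word_equiv_sort [OF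
        assms(2)]] by simp
qed

text \<open>Straightening: modulo the relations every element equals the combination of ordered
  words with the same evaluation. This gives the inclusion of the kernel in the ideal.\<close>

lemma rel_ideal_order:
  assumes "f \<in> carrier FA"
  shows "f - order_words (eval_words f) \<in> rel_ideal"
  using assms unfolding free_algebra_carrier
proof (induction f rule: pm_induct)
  case zero
  show ?case by (simp add: rel_ideal_zero)
next
  case (single w x)
  let ?v = "ordered_word (content w)"
  have w: "set w \<subseteq> {1..n}" using single by simp
  have "word_equiv w ?v"
    using w set_ordered_word content_ordered_word [OF content_pos [OF w]]
        by (intro word_equivI) auto
  then have "conv (@) (\<lambda>_ _. 1) (Poly_Mapping.single [] (x * word_coeff w))
      (Poly_Mapping.single w (inverse (word_coeff w)) - Poly_Mapping.single ?v (inverse (word_coeff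
          ?v))) \<in> rel_ideal"
    by (intro rel_ideal_mult_left) (auto simp: word_equiv_def)
  then show ?case
    by (simp add: conv_diff_right conv_single eval_words_single order_words_single
        word_coeff_nonzero mult.assoc)
next
  case (add f g)
  then show ?case
    using rel_ideal_add [OF add] by (simp add: eval_words_add order_words_add algebra_simps)
qed

lemma rel_ideal_eq_kernel: "rel_ideal = a_kernel FA qring eval_words"
proof
  show "rel_ideal \<subseteq> a_kernel FA qring eval_words"
    unfolding rel_ideal_def
  proof (rule ring.genideal_minimal [OF ring_free_algebra])
    show "ideal (a_kernel FA qring eval_words) FA"
      by (rule ring_hom_ring.kernel_is_ideal [OF eval_words_hom])
    show "skew_relations n p \<subseteq> a_kernel FA qring eval_words"
    proof
      fix r assume r': "r \<in> skew_relations n p"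
      then obtain i j where ij: "i \<in> {1..n}" "j \<in> {1..n}" "i < j"
        and r: "r = Poly_Mapping.single [j, i] 1 - Poly_Mapping.single [i, j] (p i j)"
        by (auto simp: skew_relations_def)
      have "r + Poly_Mapping.single [i, j] (p i j) = Poly_Mapping.single [j, i] 1" by (simp add: r)
      then have "eval_words r + eval_words (Poly_Mapping.single [i, j] (p i j)) =
          eval_words (Poly_Mapping.single [j, i] 1)"
        by (simp add: eval_words_add [symmetric])
      then have "eval_words r = 0"
        using ij by (simp add: eval_words_single chi_single add.commute)
      moreover have "r \<in> carrier FA" using r' skew_relations_carrier by blast
      ultimately show "r \<in> a_kernel FA qring eval_words"
        by (simp add: a_kernel_def kernel_def qring_simps)
    qed
  qed
  show "a_kernel FA qring eval_words \<subseteq> rel_ideal"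
  proof
    fix f assume "f \<in> a_kernel FA qring eval_words"
    then have f: "f \<in> carrier FA" "eval_words f = 0"
      by (simp_all add: a_kernel_def kernel_def qring_simps)
    show "f \<in> rel_ideal" using rel_ideal_order [OF f(1)] f(2) by simp
  qed
qed

lemma skew_polynomial_ring_iso:
  "\<exists>h. h \<in> ring_iso (skew_polynomial_ring n p) qring"
proof -
  have "skew_polynomial_ring n p = FA Quot (a_kernel FA qring eval_words)"
    unfolding skew_polynomial_ring_def rel_ideal_eq_kernel [symmetric] rel_ideal_def ..
  then show ?thesis
    using ring_hom_ring.FactRing_iso_set [OF eval_words_hom eval_words_surj] by auto
qed

lemma ring_skew_polynomial_ring: "ring (skew_polynomial_ring n p)"
  unfolding skew_polynomial_ring_def
  using ideal.quotient_is_ring [OF ideal_rel_ideal] by (simp add: rel_ideal_def)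

end

section \<open>Skew polynomial rings over their center\<close>

context quantum_torus
begin

lemma lookup_mo_tm: "Poly_Mapping.lookup (mo b y \<star> f) (b + a) =
    y * Poly_Mapping.lookup f a * chi b a"
  by (rule pm_additive_eq [of f UNIV])
    (auto simp: tm_add_right lookup_add tm_mo lookup_single when_def algebra_simps)

lemma supp_mo_zero: "supp (mo 0 x) \<subseteq> lat" "supp (mo 0 x) \<subseteq> pos"
  using lat_zero pos_zero by auto

lemma sum_const_tm: "finite A \<Longrightarrow> (\<Sum>a\<in>A. q) = mo 0 (of_nat (card A)) \<star> q"
proof -
  assume "finite A"
  then have "(\<Sum>a\<in>A. mo 0 1) = mo 0 (of_nat (card A))"
    by induction (simp_all add: single_add [symmetric] del: sum_constant)
  then have "mo 0 (of_nat (card A)) \<star> q = (\<Sum>a\<in>A. mo 0 1 \<star> q)"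
    by (simp only: tm_sum_left [symmetric])
  then show ?thesis unfolding tm_one_left by (rule sym)
qed

text \<open>Multiplication by an untwisted central monomial makes any Laurent monomial polynomial
  without changing its commutation with others.\<close>

lemma shift_to_pos:
  assumes "b \<in> expts"
  obtains c where "c \<in> lat" "\<And>i. int period dvd lu c i" "b + c \<in> pos" "c \<in> pos"
proof -
  let ?c = "expt (\<lambda>i. int period * \<bar>lu b i\<bar>)"
  have dvd: "int period dvd lu ?c i" for i by (simp add: lookup_expt)
  have le: "0 \<le> lu b i + int period * \<bar>lu b i\<bar>" for i
  proof -
    have "1 * \<bar>lu b i\<bar> \<le> int period * \<bar>lu b i\<bar>"
      using period(1) by (intro mult_right_mono) auto
    then show ?thesis by linarith
  qed
  have "b + ?c \<in> pos"
    using assms le by (simp add: pos_def expts_add expt_expts lookup_add lookup_expt)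
  moreover have "?c \<in> pos" by (intro expt_pos) simp
  moreover have "?c \<in> lat" using dvd expt_expts by (intro lat_period)
  ultimately show ?thesis using that dvd by blast
qed

section \<open>Coset representatives and dual monomials\<close>

definition box :: "(nat \<Rightarrow>\<^sub>0 int) set" where
  "box = {a \<in> pos. \<forall>i\<in>{1..n}. lu a i < int period}"

definition reduce :: "(nat \<Rightarrow>\<^sub>0 int) \<Rightarrow> nat \<Rightarrow>\<^sub>0 int" where
  "reduce a = expt (\<lambda>i. lu a i mod int period)"

lemma reduce_box: "reduce a \<in> box"
  unfolding box_def reduce_def using period(1) by (auto intro!: expt_pos simp: lookup_expt)

lemma reduce_dvd: "a \<in> expts \<Longrightarrow> int period dvd lu (a - reduce a) i"
  by (cases "i \<in> {1..n}") (auto simp: reduce_def lookup_minus lookup_expt expts_lookup)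

lemma reduce_pos: 
  assumes "a \<in> pos" 
  shows "a - reduce a \<in> pos"
proof -
  have "lu a i mod int period \<le> lu a i" if "i \<in> {1..n}" for i
    using assms that period(1) by (intro zmod_le_nonneg_dividend) (auto simp: pos_def)
  then show ?thesis
    using assms by (simp add: pos_def reduce_def expts_diff expt_expts lookup_minus lookup_expt)
qed

lemma box_pos: "a \<in> box \<Longrightarrow> a \<in> pos"
  by (simp add: box_def)

lemma finite_box: "finite box"
proof -
  have "box \<subseteq> expt ` (\<lambda>f i. if i \<in> {1..n} then f i else 0) ` ({1..n} \<rightarrow>\<^sub>E {0..<int period})"
  proof
    fix a assume a: "a \<in> box"
    let ?f = "\<lambda>i\<in>{1..n}. lu a i"
    have "?f \<in> {1..n} \<rightarrow>\<^sub>E {0..<int period}" using a by (auto simp: box_def pos_def)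
    moreover have "a = expt (\<lambda>i. if i \<in> {1..n} then ?f i else 0)"
      using a by (intro expts_eqI expt_expts pos_expts box_pos) (auto simp: lookup_expt)
    ultimately show "a \<in> expt ` (\<lambda>f i. if i \<in> {1..n} then f i else 0) ` ({1..n} \<rightarrow>\<^sub>E {0..<int
        period})"
      by blast
  qed
  then show ?thesis by (rule finite_subset) (intro finite_imageI finite_PiE, auto)
qed

text \<open>The property under the choice depends on \<open>a\<close> only through its coset, so the
  chosen value does as well. Taking it in the box bounds its exponents by the period.\<close>

definition rep :: "(nat \<Rightarrow>\<^sub>0 int) \<Rightarrow> nat \<Rightarrow>\<^sub>0 int" where
  "rep a = (SOME b. b \<in> box \<and> b - a \<in> lat)"

lemma rep: 
  assumes "a \<in> expts"
  shows "rep a \<in> box" "rep a - a \<in> lat"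
proof -
  have "a - reduce a \<in> lat"
    using assms reduce_dvd by (intro lat_period expts_diff) (auto simp: reduce_def expt_expts)
  then have "reduce a - a \<in> lat" using lat_minus by fastforce
  then have "\<exists>b. b \<in> box \<and> b - a \<in> lat" using reduce_box by blast
  from someI_ex [OF this] show "rep a \<in> box" "rep a - a \<in> lat" by (simp_all add: rep_def)
qed

lemma rep_expts: "a \<in> expts \<Longrightarrow> rep a \<in> expts"
  using rep(1) box_pos pos_expts by blast

lemma rep_eq_iff:
  assumes "a \<in> expts" "b \<in> expts"
  shows "rep a = rep b \<longleftrightarrow> a - b \<in> lat"
proof
  assume "rep a = rep b"
  then show "a - b \<in> lat"
    using lat_diff [OF rep(2) [OF assms(2)] rep(2) [OF assms(1)]] by simp
next
  assume ab: "a - b \<in> lat"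
  have "c - a \<in> lat \<longleftrightarrow> c - b \<in> lat" for c
    using lat_add [OF _ ab, of "c - a"] lat_diff [OF _ ab, of "c - b"] by auto
  then show "rep a = rep b" by (simp add: rep_def)
qed

text \<open>One exponent for each coset of the lattice; the number of cosets will be the rank over
  the center.\<close>

definition creps :: "(nat \<Rightarrow>\<^sub>0 int) set" where
  "creps = image rep expts"

lemma creps_box: "g \<in> creps \<Longrightarrow> g \<in> box"
  by (auto simp: creps_def rep)

lemma creps_pos: "g \<in> creps \<Longrightarrow> g \<in> pos"
  using creps_box box_pos by blast

lemma creps_expts: "g \<in> creps \<Longrightarrow> g \<in> expts"
  using creps_pos pos_expts by blast

lemma finite_creps: "finite creps"
  using finite_subset [OF _ finite_box, of creps] creps_box by blast

lemma rep_creps: "g \<in> creps \<Longrightarrow> rep g = g"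
  by (auto simp: creps_def rep_eq_iff rep_expts rep)

lemma rep_in_creps: "a \<in> expts \<Longrightarrow> rep a \<in> creps"
  by (simp add: creps_def)

text \<open>Exponent of the denominator \<open>z\<close> of the frame. It is at least as large as
  every exponent of the box in each variable, and its twist is trivial.\<close>

definition zexp :: "nat \<Rightarrow>\<^sub>0 int" where "zexp = expt (\<lambda>_. int period)"

lemma zexp: "zexp \<in> pos" "zexp \<in> expts" "zexp \<in> lat" "chi zexp b = 1" "chi b zexp = 1"
proof -
  show "zexp \<in> pos" unfolding zexp_def by (intro expt_pos) simp
  then show "zexp \<in> expts" by (rule pos_expts)
  have d: "int period dvd lu zexp i" for i by (simp add: zexp_def lookup_expt)
  show "chi zexp b = 1" "chi b zexp = 1" using chi_period d by auto
  show "zexp \<in> lat" using d \<open>zexp \<in> expts\<close> by (intro lat_period)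
qed

lemma zexp_diff_pos: "a \<in> box \<Longrightarrow> zexp - a \<in> pos"
  by (auto simp: box_def pos_def expts_diff zexp lookup_minus zexp_def lookup_expt expt_expts)

text \<open>The scalar \<open>chi g g\<close> cancels the twist of \<open>x^g\<close> against
  \<open>x^(zexp - g)\<close>, so that the product is exactly \<open>x^zexp\<close> in both
  orders.\<close>

definition dual_mono :: "(nat \<Rightarrow>\<^sub>0 int) \<Rightarrow> (nat \<Rightarrow>\<^sub>0 int) \<Rightarrow>\<^sub>0 'k" where
  "dual_mono g = mo (zexp - g) (chi g g)"

lemma dual_mono: "mo g 1 \<star> dual_mono g = mo zexp 1" "dual_mono g \<star> mo g 1 = mo zexp 1"
proof -
  have "chi g (zexp - g) = inverse (chi g g)" "chi (zexp - g) g = inverse (chi g g)"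
    using chi_add_right [of g zexp "- g"] chi_add_left [of zexp "- g" g]
    by (simp_all add: chi_minus_left chi_minus_right zexp)
  then show "mo g 1 \<star> dual_mono g = mo zexp 1" "dual_mono g \<star> mo g 1 = mo zexp 1"
    by (simp_all add: dual_mono_def tm_mo)
qed

text \<open>The dual monomial of \<open>g\<close> shifts precisely the class of \<open>g\<close>
  into the lattice; the projection annihilates all other classes.\<close>

lemma tr_dual_mono:
  assumes "a \<in> expts" "g \<in> creps"
  shows "tr (mo a x \<star> dual_mono g) = (if rep a = g then mo a x \<star> dual_mono g else 0)"
proof -
  have eq: "a + (zexp - g) = zexp + (a - g)" by simp
  have "a + (zexp - g) \<in> lat \<longleftrightarrow> a - g \<in> lat"
    unfolding eq by (rule lat_add_iff [OF zexp(3)])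
  also have "\<dots> \<longleftrightarrow> rep a = g"
    using rep_eq_iff [OF assms(1) creps_expts [OF assms(2)]] rep_creps [OF assms(2)] by simp
  finally show ?thesis by (auto simp: dual_mono_def tm_mo tr_mo)
qed

lemma dual_mono_expand:
  assumes "supp f \<subseteq> expts"
  shows "mo zexp 1 \<star> f = (\<Sum>g\<in>creps. tr (f \<star> dual_mono g) \<star> mo g 1)"
  using assms
proof (rule pm_additive_eq)
  fix a x assume a: "a \<in> expts"
  have "(\<Sum>g\<in>creps. tr (mo a x \<star> dual_mono g) \<star> mo g 1) = (\<Sum>g\<in>creps. if rep a = g then mo a x \<star>
      mo zexp 1 else 0)"
    using a by (intro sum.cong refl) (simp add: tr_dual_mono tm_assoc dual_mono)
  also have "\<dots> = mo a x \<star> mo zexp 1"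
    using finite_creps rep_in_creps [OF a] by simp
  also have "\<dots> = mo zexp 1 \<star> mo a x"
    by (simp add: tm_mo zexp add.commute)
  finally show "mo zexp 1 \<star> mo a x = (\<Sum>g\<in>creps. tr (mo a x \<star> dual_mono g) \<star> mo g 1)" by simp
qed (simp_all add: tm_add_right tm_add_left tr_add sum.distrib)

end

section \<open>Center, frame and trace of the skew polynomial ring\<close>

locale skew_ring = quantum_torus n p + ring B
  for n :: nat and p :: "nat \<Rightarrow> nat \<Rightarrow> 'k::field" and B :: "('a, 'm) ring_scheme" (structure) +
  fixes h :: "'a \<Rightarrow> (nat \<Rightarrow>\<^sub>0 int) \<Rightarrow>\<^sub>0 'k"
  assumes h_iso: "h \<in> ring_iso B qring"
begin

text \<open>Turns polynomials into ring elements. It inverts \<open>h\<close> only on supports in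
  \<open>pos\<close>, so each use comes with a proof of polynomiality.\<close>

definition el :: "((nat \<Rightarrow>\<^sub>0 int) \<Rightarrow>\<^sub>0 'k) \<Rightarrow> 'a" where "el = inv_into (carrier B) h"

lemma h_bij: "bij_betw h (carrier B) {f. supp f \<subseteq> pos}"
proof -
  have "carrier qring = {f. supp f \<subseteq> pos}" by (auto simp: qring_simps)
  then show ?thesis using h_iso by (auto simp: ring_iso_def)
qed

lemma h_supp: "x \<in> carrier B \<Longrightarrow> supp (h x) \<subseteq> pos"
  using bij_betwE [OF h_bij] by blast

lemma h_supp_expts: "x \<in> carrier B \<Longrightarrow> supp (h x) \<subseteq> expts"
  using h_supp pos_expts by blast

lemma h_mult: "x \<in> carrier B \<Longrightarrow> y \<in> carrier B \<Longrightarrow> h (x \<otimes> y) = h x \<star> h y"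
  and h_add: "x \<in> carrier B \<Longrightarrow> y \<in> carrier B \<Longrightarrow> h (x \<oplus> y) = h x + h y"
  and h_one: "h \<one> = mo 0 1"
  using h_iso by (auto simp: ring_iso_def ring_hom_def qring_simps)

lemma h_zero: "h \<zero> = 0"
  using h_add [of \<zero> \<zero>] by (metis add_cancel_right_right l_zero zero_closed)

lemma h_inj: "x \<in> carrier B \<Longrightarrow> y \<in> carrier B \<Longrightarrow> h x = h y \<Longrightarrow> x = y"
  using h_bij by (auto simp: bij_betw_def dest: inj_onD)

lemma h_eq_zero_iff: "x \<in> carrier B \<Longrightarrow> h x = 0 \<longleftrightarrow> x = \<zero>"
  using h_inj [of x \<zero>] h_zero by auto

lemma h_minus: "x \<in> carrier B \<Longrightarrow> h (\<ominus> x) = - h x"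
  using h_add [of "\<ominus> x" x] by (simp add: h_zero l_neg eq_neg_iff_add_eq_0)

lemma el_closed: "supp q \<subseteq> pos \<Longrightarrow> el q \<in> carrier B"
  unfolding el_def using h_bij by (metis (mono_tags, lifting) bij_betw_def inv_into_into
      mem_Collect_eq)

lemma h_el: "supp q \<subseteq> pos \<Longrightarrow> h (el q) = q"
  unfolding el_def using h_bij by (metis (mono_tags, lifting) bij_betw_inv_into_right
      mem_Collect_eq)

lemma h_finsum:
  assumes "finite A" "\<And>a. a \<in> A \<Longrightarrow> f a \<in> carrier B"
  shows "h (\<Oplus>a\<in>A. f a) = (\<Sum>a\<in>A. h (f a))"
  using assms
proof (induction A)
  case empty
  then show ?case by (simp add: h_zero)
next
  case (insert x A)
  have "(\<Oplus>a\<in>insert x A. f a) = f x \<oplus> (\<Oplus>a\<in>A. f a)"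
    using insert by (intro finsum_insert) auto
  moreover have "(\<Oplus>a\<in>A. f a) \<in> carrier B" using insert by (intro finsum_closed) auto
  ultimately show ?case using insert by (simp add: h_add)
qed

abbreviation "Z \<equiv> center B"

text \<open>A central element commutes with all monomials, and comparing coefficients tests each of
  its exponents separately. The lattice is defined by arbitrary integer exponents \<open>b\<close>,
  so \<open>b\<close> is first shifted into the polynomial range by an untwisted central
  exponent.\<close>

lemma center_iff: "x \<in> Z \<longleftrightarrow> x \<in> carrier B \<and> supp (h x) \<subseteq> lat"
proof (intro iffI conjI subsetI)
  assume x: "x \<in> Z"
  then show xB: "x \<in> carrier B" by (simp add: center_def)
  fix a assume a: "a \<in> supp (h x)"
  have "chi a b = chi b a" if b: "b \<in> expts" for b
  proof -
    obtain c where c: "\<And>i. int period dvd lu c i" "b + c \<in> pos"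
      using shift_to_pos [OF b] by blast
    have m: "supp (mo (b + c) 1) \<subseteq> pos" using c by simp
    have "x \<otimes> el (mo (b + c) 1) = el (mo (b + c) 1) \<otimes> x"
      using x el_closed [OF m] by (simp add: center_def)
    then have "h x \<star> mo (b + c) 1 = mo (b + c) 1 \<star> h x"
      using xB el_closed [OF m] h_mult h_el [OF m] by metis
    \<comment> \<open>Both products are compared at the exponent \<open>a + (b + c)\<close>, to
      which only the coefficient of \<open>x\<close> at \<open>a\<close> contributes.\<close>
    then have "Poly_Mapping.lookup (h x) a * chi a (b + c) =
        Poly_Mapping.lookup (h x) a * chi (b + c) a"
      using lookup_tm_mo [of "h x" "b + c" 1 a] lookup_mo_tm [of "b + c" 1 "h x" a]
      by (simp add: add.commute)
    moreover have "Poly_Mapping.lookup (h x) a \<noteq> 0" using a by (simp add: in_keys_iff)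
    ultimately have "chi a (b + c) = chi (b + c) a" by simp
    then show ?thesis by (simp add: chi_add_left chi_add_right chi_period [OF c(1)])
  qed
  moreover have "a \<in> expts" using a h_supp_expts [OF xB] by blast
  ultimately show "a \<in> lat" by (simp add: lat_def)
next
  assume x: "x \<in> carrier B \<and> supp (h x) \<subseteq> lat"
  show "x \<in> Z"
    unfolding center_def
  proof (intro CollectI conjI ballI)
    show "x \<in> carrier B" using x by simp
    fix b assume b: "b \<in> carrier B"
    have "h (x \<otimes> b) = h (b \<otimes> x)"
      using x b tm_central [OF _ h_supp_expts [OF b]] by (simp add: h_mult)
    then show "x \<otimes> b = b \<otimes> x" using x b by (intro h_inj) auto
  qed
qed

lemma el_center: "supp q \<subseteq> pos \<Longrightarrow> supp q \<subseteq> lat \<Longrightarrow> el q \<in> Z"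
  by (simp add: center_iff el_closed h_el)

lemma no_zero_divisors: "x \<in> carrier B \<Longrightarrow> y \<in> carrier B \<Longrightarrow> x \<otimes> y = \<zero> \<Longrightarrow> x = \<zero> \<or> y = \<zero>"
  using tm_no_zero_divisors [of "h x" "h y"] h_mult [of x y] h_eq_zero_iff h_zero by auto

lemma one_not_zero: "\<one> \<noteq> \<zero>"
proof
  assume "\<one> = \<zero>"
  then have "mo 0 1 = 0" using h_one h_zero by simp
  then have "Poly_Mapping.lookup (mo 0 1) 0 = 0" by simp
  then show False by simp
qed

lemma Z_carrier: "x \<in> Z \<Longrightarrow> x \<in> carrier B"
  and center_comm: "x \<in> Z \<Longrightarrow> y \<in> carrier B \<Longrightarrow> x \<otimes> y = y \<otimes> x"
  by (simp_all add: center_def)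

lemma subring_center: "subring Z B"
proof (rule subringI)
  show "Z \<subseteq> carrier B" "\<one> \<in> Z" by (auto simp: center_def)
  fix x y assume xy: "x \<in> Z" "y \<in> Z"
  then show "\<ominus> x \<in> Z" by (simp add: center_iff h_minus)
  show "x \<oplus> y \<in> Z" using xy keys_add [of "h x" "h y"] by (auto simp: center_iff h_add)
  show "x \<otimes> y \<in> Z" using xy by (auto simp: center_iff h_mult elim!: supp_tmE intro: lat_add)
qed

lemma domain_center: "domain (B\<lparr>carrier := Z\<rparr>)"
proof -
  have "subcring Z B"
    by (rule subcringI [OF subring_center]) (simp add: center_comm Z_carrier)
  then have c: "cring (B\<lparr>carrier := Z\<rparr>)"
    by (rule iffD1 [OF subcring_iff, rotated]) (rule subsetI, rule Z_carrier)
  show ?thesis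
  proof (rule domain.intro [OF c domain_axioms.intro])
    show "\<one>\<^bsub>B\<lparr>carrier := Z\<rparr>\<^esub> \<noteq> \<zero>\<^bsub>B\<lparr>carrier := Z\<rparr>\<^esub>"
      using one_not_zero by simp
    fix a b assume "a \<otimes>\<^bsub>B\<lparr>carrier := Z\<rparr>\<^esub> b = \<zero>\<^bsub>B\<lparr>carrier := Z\<rparr>\<^esub>"
      "a \<in> carrier (B\<lparr>carrier := Z\<rparr>)" "b \<in> carrier (B\<lparr>carrier := Z\<rparr>)"
    then show "a = \<zero>\<^bsub>B\<lparr>carrier := Z\<rparr>\<^esub> \<or> b = \<zero>\<^bsub>B\<lparr>carrier := Z\<rparr>\<^esub>"
      using no_zero_divisors [of a b] Z_carrier by simp
  qed
qed

sublocale central_subring B Z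
  by (intro central_subring.intro central_subring_axioms.intro ring_axioms subring_center
      domain_center order_refl)

definition z where "z = el (mo zexp 1)"
definition e where "e g = el (mo g 1)"
text \<open>The coefficient of \<open>x^g\<close> in the expansion of \<open>b\<close>, times
  \<open>z\<close>. The coefficient itself may have negative exponents; the factor \<open>z\<close>
  makes it a polynomial.\<close>

definition \<kappa> where "\<kappa> g b = el (tr (h b \<star> dual_mono g))"

lemma z_el: "z \<in> Z" "z \<in> carrier B" "h z = mo zexp 1" "z \<noteq> \<zero>"
proof -
  have s: "supp (mo zexp 1) \<subseteq> pos" "supp (mo zexp 1) \<subseteq> lat" using zexp by auto
  show "z \<in> Z" "z \<in> carrier B" "h z = mo zexp 1" unfolding z_def
    using el_center [OF s] el_closed h_el s by auto
  then show "z \<noteq> \<zero>" using h_zero by (metis keys_single keys_zero insert_not_empty one_neq_zero)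
qed

lemma e: "a \<in> pos \<Longrightarrow> e a \<in> carrier B" "a \<in> pos \<Longrightarrow> h (e a) = mo a 1"
  unfolding e_def by (auto intro!: el_closed h_el)

lemma \<kappa>: 
  assumes "g \<in> creps" "b \<in> carrier B"
  shows "\<kappa> g b \<in> Z" "h (\<kappa> g b) = tr (h b \<star> dual_mono g)"
proof -
  have "supp (dual_mono g) \<subseteq> pos"
    using zexp_diff_pos [OF creps_box [OF assms(1)]] by (simp add: dual_mono_def)
  then have s: "supp (tr (h b \<star> dual_mono g)) \<subseteq> pos" "supp (tr (h b \<star> dual_mono g)) \<subseteq> lat"
    using supp_tm_pos [OF h_supp [OF assms(2)]] by (auto simp: supp_tr)
  show "\<kappa> g b \<in> Z" "h (\<kappa> g b) = tr (h b \<star> dual_mono g)"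
    unfolding \<kappa>_def using s el_center h_el by auto
qed

lemma \<kappa>_carrier: "g \<in> creps \<Longrightarrow> b \<in> carrier B \<Longrightarrow> \<kappa> g b \<in> carrier B"
  by (rule Z_carrier [OF \<kappa>(1)])

lemma e_creps: "g \<in> creps \<Longrightarrow> e g \<in> carrier B"
  by (rule e(1) [OF creps_pos])

sublocale dual_frame B Z creps e \<kappa> z
proof (intro dual_frame.intro dual_frame_axioms.intro central_subring_axioms)
  show "finite creps" by (rule finite_creps)
  show "z \<in> Z" "z \<noteq> \<zero>" by (rule z_el)+
  show "e i \<in> carrier B" if "i \<in> creps" for i by (rule e_creps [OF that])
  show "\<kappa> i b \<in> Z" if "i \<in> creps" "b \<in> carrier B" for i b by (rule \<kappa>(1) [OF that])
  show "\<kappa> i (b \<oplus> c) = \<kappa> i b \<oplus> \<kappa> i c" if "i \<in> creps" "b \<in> carrier B" "c \<in> carrier B" for i b c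
    using that by (intro h_inj) (auto simp: \<kappa> Z_carrier h_add tm_add_left tr_add)
  show "\<kappa> i (r \<otimes> b) = r \<otimes> \<kappa> i b" if "i \<in> creps" "r \<in> Z" "b \<in> carrier B" for i r b
  proof (rule h_inj)
    have r: "r \<in> carrier B" "supp (h r) \<subseteq> lat" using that by (simp_all add: center_iff)
    have k: "\<kappa> i b \<in> carrier B" "\<kappa> i (r \<otimes> b) \<in> carrier B"
      using that r \<kappa>(1) Z_carrier by simp_all
    show "\<kappa> i (r \<otimes> b) \<in> carrier B" by (rule k)
    show "r \<otimes> \<kappa> i b \<in> carrier B" using r k by simp
    show "h (\<kappa> i (r \<otimes> b)) = h (r \<otimes> \<kappa> i b)"
      using that r k by (simp add: \<kappa>(2) h_mult tm_assoc tr_tm_central)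
  qed
  show "\<kappa> i (e j) = (if i = j then z else \<zero>)" if ij: "i \<in> creps" "j \<in> creps" for i j
  proof (rule h_inj)
    have "h (\<kappa> i (e j)) = tr (mo j 1 \<star> dual_mono i)"
      using ij e creps_pos by (simp add: \<kappa>)
    also have "\<dots> = (if j = i then mo zexp 1 else 0)"
      using ij by (simp add: tr_dual_mono creps_expts rep_creps dual_mono)
    finally show "h (\<kappa> i (e j)) = h (if i = j then z else \<zero>)" by (auto simp: z_el h_zero)
    show "\<kappa> i (e j) \<in> carrier B" by (rule \<kappa>_carrier [OF ij(1) e_creps [OF ij(2)]])
  qed (use z_el in auto)
  show "z \<otimes> b = (\<Oplus>i\<in>creps. \<kappa> i b \<otimes> e i)" if b: "b \<in> carrier B" for b
  proof (rule h_inj)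
    have c: "\<kappa> i b \<otimes> e i \<in> carrier B" if "i \<in> creps" for i
      by (rule m_closed [OF \<kappa>_carrier [OF that b] e_creps [OF that]])
    show "(\<Oplus>i\<in>creps. \<kappa> i b \<otimes> e i) \<in> carrier B" using c by (intro finsum_closed) auto
    have "h (\<Oplus>i\<in>creps. \<kappa> i b \<otimes> e i) = (\<Sum>i\<in>creps. h (\<kappa> i b \<otimes> e i))"
      using finite_creps c by (rule h_finsum)
    also have "\<dots> = (\<Sum>i\<in>creps. tr (h b \<star> dual_mono i) \<star> mo i 1)"
      using b by (intro sum.cong refl) (simp add: h_mult \<kappa>(2) e creps_pos \<kappa>_carrier)
    also have "\<dots> = h (z \<otimes> b)"
      using dual_mono_expand [OF h_supp_expts [OF b]] b z_el by (simp add: h_mult)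
    finally show "h (z \<otimes> b) = h (\<Oplus>i\<in>creps. \<kappa> i b \<otimes> e i)" by simp
  qed (use z_el b in auto)
qed

text \<open>The rank read in the base field; it vanishes when the characteristic divides the
  rank.\<close>

definition rk :: 'k where "rk = of_nat (card creps)"

definition trace where "trace b = el (mo 0 rk \<star> tr (h b))"

lemma trace:
  assumes "b \<in> carrier B"
  shows "trace b \<in> Z" "h (trace b) = mo 0 rk \<star> tr (h b)"
proof -
  have s: "supp (mo 0 rk \<star> tr (h b)) \<subseteq> pos" "supp (mo 0 rk \<star> tr (h b)) \<subseteq> lat"
    using h_supp [OF assms] supp_mo_zero [of rk]
    by (auto simp: supp_tr elim!: supp_tmE intro!: pos_add lat_add)
  show "trace b \<in> Z" "h (trace b) = mo 0 rk \<star> tr (h b)"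
    unfolding trace_def using s el_center h_el by auto
qed

text \<open>Every diagonal entry is the same: \<open>e i\<close> times its dual monomial is
  \<open>z\<close>, so \<open>\<kappa> i (b \<otimes> e i)\<close> is \<open>z\<close> times the
  projection of \<open>b\<close>, independently of \<open>i\<close>.\<close>

lemma regular_trace:
  assumes b: "b \<in> carrier B"
  shows "regular_trace B Z b = frac_embed S (trace b)"
proof -
  have c: "b \<otimes> e i \<in> carrier B" "\<kappa> i (b \<otimes> e i) \<in> carrier B" if "i \<in> creps" for i
  proof -
    show "b \<otimes> e i \<in> carrier B" using b e_creps [OF that] by simp
    then show "\<kappa> i (b \<otimes> e i) \<in> carrier B" by (rule \<kappa>_carrier [OF that])
  qed
  have "(\<Oplus>i\<in>creps. \<kappa> i (b \<otimes> e i)) = trace b \<otimes> z"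
  proof (rule h_inj)
    show "(\<Oplus>i\<in>creps. \<kappa> i (b \<otimes> e i)) \<in> carrier B" using c by (intro finsum_closed) auto
    show "trace b \<otimes> z \<in> carrier B" by (rule m_closed [OF Z_carrier [OF trace(1) [OF b]] z_el(2)])
    have "h (\<Oplus>i\<in>creps. \<kappa> i (b \<otimes> e i)) = (\<Sum>i\<in>creps. h (\<kappa> i (b \<otimes> e i)))"
      using finite_creps c by (intro h_finsum) auto
    also have "\<dots> = (\<Sum>i\<in>creps. mo zexp 1 \<star> tr (h b))"
    proof (intro sum.cong refl)
      fix i assume i: "i \<in> creps"
      have "h (\<kappa> i (b \<otimes> e i)) = tr (h b \<star> mo zexp 1)"
        using i b c by (simp add: \<kappa> h_mult e creps_pos tm_assoc dual_mono)
      also have "h b \<star> mo zexp 1 = mo zexp 1 \<star> h b"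
        using h_supp_expts [OF b] zexp by (intro tm_central [symmetric]) auto
      also have "tr \<dots> = mo zexp 1 \<star> tr (h b)"
        using zexp by (intro tr_tm_central) auto
      finally show "h (\<kappa> i (b \<otimes> e i)) = mo zexp 1 \<star> tr (h b)" .
    qed
    also have "\<dots> = mo 0 rk \<star> (mo zexp 1 \<star> tr (h b))"
      unfolding rk_def by (rule sum_const_tm [OF finite_creps])
    also have "mo zexp 1 \<star> tr (h b) = tr (h b) \<star> mo zexp 1"
      using zexp supp_tr [of "h b"] h_supp_expts [OF b] by (intro tm_central) auto
    also have "mo 0 rk \<star> (tr (h b) \<star> mo zexp 1) = h (trace b \<otimes> z)"
      using trace [OF b] z_el by (simp add: h_mult Z_carrier tm_assoc)
    finally show "h (\<Oplus>i\<in>creps. \<kappa> i (b \<otimes> e i)) = h (trace b \<otimes> z)" .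
  qed
  then have "regular_trace B Z b = fraction_of S (trace b \<otimes> z) z"
    using regular_trace_eq [OF b] by simp
  also have "\<dots> = frac_embed S (trace b)"
    unfolding frac_embed_def using trace(1) [OF b] z_el S.one_nonzero
    by (simp add: S.fraction_of_eq_iff)
  finally show ?thesis .
qed

lemma regular_trace_in: 
  assumes "b \<in> carrier B"
  shows "regular_trace_in B Z b = trace b"
  unfolding regular_trace_in_def regular_trace [OF assms]
  using trace(1) [OF assms] S.frac_embed_eq_iff by (intro the_equality) auto

lemma module_B: "Module.module S (as_module B (carrier B))"
proof (rule moduleI)
  show "cring S" by (rule S.is_cring)
  show "abelian_group (as_module B (carrier B))"
    by (rule abelian_groupI) (auto simp: as_module_def a_ac intro: bexI [of _ "\<ominus> _"] l_neg)
qed (auto simp: as_module_def Z_carrier l_distr r_distr m_assoc)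

text \<open>The monomials of the box generate: the remaining exponent \<open>a - reduce a\<close> is
  polynomial and divisible by the period, hence central. One representative per coset would not
  suffice, since the quotient could have negative exponents.\<close>

lemma finitely_generated:
  "\<exists>A. finite A \<and> A \<subseteq> carrier B \<and> module.span S (as_module B (carrier B)) A = carrier B"
proof (intro exI conjI)
  let ?M = "as_module B (carrier B)"
  let ?A = "e ` box"
  interpret M: Module.module S ?M by (rule module_B)
  show "finite ?A" using finite_box by simp
  show A: "?A \<subseteq> carrier B" using e box_pos by blast
  have A': "?A \<subseteq> carrier ?M" using A by (simp add: as_module_def)
  have sub: "LinearCombinations.submodule S (M.span ?A) ?M"
    by (rule M.span_is_submodule [OF A'])
  have span_add: "x \<oplus> y \<in> M.span ?A" if "x \<in> M.span ?A" "y \<in> M.span ?A" for x y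
    using sub that by (auto simp: LinearCombinations.submodule_def as_module_def)
  have span_zero: "\<zero> \<in> M.span ?A"
    using sub by (auto simp: LinearCombinations.submodule_def as_module_def)
  have smult: "r \<otimes> x \<in> M.span ?A" if "r \<in> Z" "x \<in> M.span ?A" for r x
    using sub that by (auto simp: LinearCombinations.submodule_def as_module_def)
  have self: "x \<in> M.span ?A" if "x \<in> ?A" for x
    using M.in_own_span [OF A'] that by blast
  show "M.span ?A = carrier B"
  proof
    show "M.span ?A \<subseteq> carrier B"
      using sub by (auto simp: LinearCombinations.submodule_def as_module_def)
    show "carrier B \<subseteq> M.span ?A"
    proof
      fix b assume b: "b \<in> carrier B"
      have "supp f \<subseteq> pos \<and> el f \<in> M.span ?A" if "supp f \<subseteq> pos" for f
        using that
      proof (induction f rule: pm_induct)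
        case zero
        have "el 0 = \<zero>" by (rule h_inj) (auto simp: h_el h_zero el_closed)
        then show ?case using span_zero by simp
      next
        case (single a x)
        \<comment> \<open>Quotient and remainder of the exponents by the period; the scalar in
          \<open>?r\<close> undoes the twist between the two parts.\<close>
        let ?q = "a - reduce a"
        let ?r = "mo ?q (x * inverse (chi ?q (reduce a)))"
        have q: "?q \<in> pos" "?q \<in> lat"
          using single reduce_pos reduce_dvd [OF pos_expts [OF single]] lat_period pos_expts by auto
        then have r: "supp ?r \<subseteq> pos" "supp ?r \<subseteq> lat" by auto
        have "el (mo a x) = el ?r \<otimes> e (reduce a)"
          using single r reduce_box [of a] box_pos el_closed
          by (intro h_inj) (auto simp: h_mult h_el e tm_mo mult.assoc)
        then show ?case
          using smult [OF el_center [OF r] self] reduce_box [of a] single by auto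
      next
        case (add f g)
        have s: "supp (f + g) \<subseteq> pos" using add keys_add [of f g] by blast
        have "el (f + g) = el f \<oplus> el g"
          using add s by (intro h_inj) (auto simp: h_add h_el el_closed)
        then show ?case using add s span_add by simp
      qed
      from this [OF h_supp [OF b]] have "el (h b) \<in> M.span ?A" by simp
      moreover have "el (h b) = b" using b h_supp [OF b] by (intro h_inj el_closed h_el)
      ultimately show "b \<in> M.span ?A" by simp
    qed
  qed
qed

lemma discriminant_setting: "discriminant_setting B Z"
  unfolding discriminant_setting_def
proof (intro conjI)
  show "prime_ring B"
    unfolding prime_ring_def
  proof (intro conjI ballI impI)
    fix a b assume ab: "a \<in> carrier B" "b \<in> carrier B" "\<forall>x\<in>carrier B. a \<otimes> x \<otimes> b = \<zero>"
    then have "a \<otimes> \<one> \<otimes> b = \<zero>" by blast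
    then show "a = \<zero> \<or> b = \<zero>" using ab no_zero_divisors by simp
  qed (use one_not_zero ring_axioms in auto)
  show "\<forall>b\<in>carrier B. regular_trace B Z b \<in> frac_embed S ` Z"
    using regular_trace trace(1) by auto
qed (use subring_center domain_center finitely_generated in auto)

end

section \<open>Homogeneous components and least degrees\<close>

context quantum_torus
begin

lemma posI: "a \<in> expts \<Longrightarrow> (\<And>k. k \<in> {1..n} \<Longrightarrow> 0 \<le> lu a k) \<Longrightarrow> a \<in> pos"
  by (simp add: pos_def)

lemma posD: "a \<in> pos \<Longrightarrow> k \<in> {1..n} \<Longrightarrow> 0 \<le> lu a k"
  by (simp add: pos_def)

lemma diff_pos_iff:
  "a \<in> expts \<Longrightarrow> b \<in> expts \<Longrightarrow> a - b \<in> pos \<longleftrightarrow> (\<forall>k\<in>{1..n}. lu b k \<le> lu a k)"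
  by (auto simp: pos_def expts_diff lookup_minus)

text \<open>The monomial is invertible in the torus, and the assumption on the support says that the
  quotient is polynomial.\<close>

lemma mono_divide:
  assumes "\<And>a. a \<in> supp f \<Longrightarrow> a - a0 \<in> pos"
  shows "\<exists>q. supp q \<subseteq> pos \<and> f = mo a0 1 \<star> q" "\<exists>q. supp q \<subseteq> pos \<and> f = q \<star> mo a0 1"
proof -
  let ?m = "mo (- a0) (inverse (chi a0 (- a0)))" and ?m' = "mo (- a0) (inverse (chi (- a0) a0))"
  have "supp (?m \<star> f) \<subseteq> pos" "supp (f \<star> ?m') \<subseteq> pos"
    using assms by (auto elim!: supp_tmE split: if_splits simp: add.commute)
  moreover have "f = mo a0 1 \<star> (?m \<star> f)" "f = (f \<star> ?m') \<star> mo a0 1"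
    by (simp_all add: tm_assoc tm_mo tm_one_right) (simp add: tm_assoc [symmetric] tm_mo
        tm_one_left)
  ultimately show "\<exists>q. supp q \<subseteq> pos \<and> f = mo a0 1 \<star> q" "\<exists>q. supp q \<subseteq> pos \<and> f = q \<star> mo a0 1"
    by blast+
qed

lemma least_in_coset:
  assumes "a \<in> pos"
  obtains b where "b \<in> pos" "rep b = rep a"
      "\<And>c. c \<in> pos \<Longrightarrow> rep c = rep a \<Longrightarrow> nat (lu b k) \<le> nat (lu c k)"
  using ex_has_least_nat [of "\<lambda>c. c \<in> pos \<and> rep c = rep a" a "\<lambda>c. nat (lu c k)"] assms by blast

text \<open>The exponent \<open>a\<close> commutes with the central exponent \<open>a + b\<close>
  and with itself, hence with \<open>b\<close>.\<close>

lemma chi_comm: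
  assumes "a \<in> expts" "a + b \<in> lat"
  shows "chi a b = chi b a"
  using lat_comm [OF assms(2,1)] by (simp add: chi_add_left chi_add_right)

text \<open>Under the trace, an element of class \<open>g\<close> pairs only with the component of
  the opposite class.\<close>

lemma tr_homogeneous:
  assumes "g \<in> creps" "supp f \<subseteq> {a \<in> expts. rep a = g}"
  shows "tr (f \<star> f') = f \<star> restrict_keys {b. g + b \<in> lat} f'"
proof -
  have 1: "tr (mo a x \<star> f') = mo a x \<star> restrict_keys {b. g + b \<in> lat} f'"
    if a: "a \<in> expts" "rep a = g" for a x
  proof (rule pm_additive_eq [of f' UNIV])
    fix b y
    have "a - g \<in> lat"
      using rep_eq_iff [OF a(1) creps_expts [OF assms(1)]] a(2) rep_creps [OF assms(1)] by simp
    then have "a + b \<in> lat \<longleftrightarrow> g + b \<in> lat"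
      using lat_add_iff [of "a - g" "g + b"] by simp
    then show "tr (mo a x \<star> mo b y) = mo a x \<star> restrict_keys {b. g + b \<in> lat} (mo b y)"
      by (simp add: tm_mo tr_mo restrict_keys_single)
  qed (simp_all add: tm_add_right tr_add restrict_keys_add)
  show ?thesis
    using assms(2) by (rule pm_additive_eq) (simp_all add: tm_add_left tr_add 1)
qed

lemma tm_commute:
  assumes "supp f \<subseteq> expts" "\<And>a b. a \<in> supp f \<Longrightarrow> b \<in> supp f' \<Longrightarrow> a + b \<in> lat"
  shows "f \<star> f' = f' \<star> f"
proof -
  have 1: "mo a x \<star> f' = f' \<star> mo a x" if a: "a \<in> supp f" for a x
  proof (rule pm_additive_eq [of f' "supp f'"])
    fix b y assume b: "b \<in> supp f'"
    have "chi a b = chi b a" using assms a b by (intro chi_comm) auto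
    then show "mo a x \<star> mo b y = mo b y \<star> mo a x" by (simp add: tm_mo add.commute mult.commute)
  qed (simp_all add: tm_add_left tm_add_right)
  show ?thesis
    by (rule pm_additive_eq [of f "supp f"]) (simp_all add: tm_add_left tm_add_right 1)
qed

text \<open>Source of the vanishing minors. Products of elements of class \<open>g\<close> and of
  the opposite class are central, and the two factors commute with each other; this moves
  \<open>b'\<close> past \<open>b\<close> and \<open>a'\<close>.\<close>

lemma homogeneous_swap:
  assumes "supp a \<subseteq> {x \<in> expts. rep x = g}" "supp a' \<subseteq> {x \<in> expts. rep x = g}" "g \<in> creps"
    and b: "supp b \<subseteq> {x \<in> expts. g + x \<in> lat}" "supp b' \<subseteq> {x \<in> expts. g + x \<in> lat}"
  shows "(a \<star> b) \<star> (a' \<star> b') = (a \<star> b') \<star> (a' \<star> b)"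
proof -
  have l: "x + y \<in> lat" if "x \<in> expts" "rep x = g" "g + y \<in> lat" for x y
  proof -
    have "x - g \<in> lat"
      using rep_eq_iff [OF that(1) creps_expts [OF assms(3)]] that(2) rep_creps [OF assms(3)]
          by simp
    then show ?thesis using lat_add [OF _ that(3), of "x - g"] by simp
  qed
  have l': "x + y \<in> lat" if "x \<in> supp a'" "y \<in> supp b" for x y
    using subsetD [OF assms(2) that(1)] subsetD [OF b(1) that(2)] l [of x y] by simp
  have c: "supp (b \<star> a') \<subseteq> lat"
  proof
    fix c assume "c \<in> supp (b \<star> a')"
    then obtain y x where xy: "y \<in> supp b" "x \<in> supp a'" "c = y + x" by (rule supp_tmE)
    have "x + y \<in> lat" by (rule l') (rule xy)+
    then show "c \<in> lat" using xy(3) by (simp add: add.commute)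
  qed
  have "(a \<star> b) \<star> (a' \<star> b') = a \<star> ((b \<star> a') \<star> b')" by (simp add: tm_assoc)
  also have "(b \<star> a') \<star> b' = b' \<star> (b \<star> a')" by (rule tm_central [OF c]) (use b(2) in blast)
  also have "b \<star> a' = a' \<star> b"
  proof (rule tm_commute [symmetric])
    show "supp a' \<subseteq> expts" using assms(2) by blast
  qed (rule l')
  also have "a \<star> (b' \<star> (a' \<star> b)) = (a \<star> b') \<star> (a' \<star> b)" by (simp add: tm_assoc)
  finally show ?thesis .
qed

text \<open>The smallest \<open>x\<^sub>k\<close>-degree of a product of two monomials that pair nontrivially under the
    trace,
  the first one being of class \<open>g\<close>.\<close>

definition mu :: "nat \<Rightarrow> (nat \<Rightarrow>\<^sub>0 int) \<Rightarrow> nat" where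
  "mu k g = (LEAST v. \<exists>a\<in>pos. \<exists>b\<in>pos. rep a = g \<and> a + b \<in> lat \<and> lu (a + b) k = int v)"

lemma mu_le:
  assumes "a \<in> pos" "b \<in> pos" "a + b \<in> lat" "k \<in> {1..n}"
  shows "int (mu k (rep a)) \<le> lu (a + b) k"
proof -
  have "0 \<le> lu (a + b) k" by (rule posD [OF pos_add [OF assms(1,2)] assms(4)])
  moreover have "mu k (rep a) \<le> nat (lu (a + b) k)"
    unfolding mu_def using assms calculation by (intro Least_le) auto
  ultimately show ?thesis by simp
qed

lemma mu_attained:
  assumes "g \<in> creps" "k \<in> {1..n}"
  obtains a b where "a \<in> pos" "b \<in> pos" "rep a = g" "a + b \<in> lat" "lu (a + b) k = int (mu k g)"
proof -
  \<comment> \<open>The pair \<open>g\<close> and \<open>zexp - g\<close> shows that the minimum is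
    taken over a nonempty set.\<close>
  have "g \<in> pos" "zexp - g \<in> pos" "rep g = g" "g + (zexp - g) \<in> lat"
    "lu (g + (zexp - g)) k = int (nat (lu zexp k))"
    using assms creps_pos zexp_diff_pos creps_box rep_creps zexp posD by auto
  then have "\<exists>v. \<exists>a\<in>pos. \<exists>b\<in>pos. rep a = g \<and> a + b \<in> lat \<and> lu (a + b) k = int v" by blast
  from LeastI_ex [OF this] show ?thesis
    using that unfolding mu_def [symmetric] by blast
qed

definition dexp :: "nat \<Rightarrow>\<^sub>0 int" where "dexp = expt (\<lambda>k. \<Sum>g\<in>creps. int (mu k g))"

lemma dexp: "dexp \<in> pos" "dexp \<in> expts" "k \<in> {1..n} \<Longrightarrow> lu dexp k = (\<Sum>g\<in>creps. int (mu k g))"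
  unfolding dexp_def by (auto intro!: expt_pos expt_expts sum_nonneg simp: lookup_expt)

end

section \<open>Monomial ideals and reflexivity\<close>

context skew_ring
begin

lemma z_eq: "z = e zexp"
  by (simp add: z_def e_def)

text \<open>Left and right multiples of a monomial are given by the same condition on exponents,
  since the twist only changes scalars. Normality of monomials follows.\<close>

lemma e_coset:
  assumes "a \<in> pos"
  shows "e a <# carrier B = {b \<in> carrier B. \<forall>c\<in>supp (h b). c - a \<in> pos}"
    and "carrier B #> e a = {b \<in> carrier B. \<forall>c\<in>supp (h b). c - a \<in> pos}"
proof -
  note ea = e [OF assms]
  have 1: "c - a \<in> pos" if "c \<in> supp (mo a 1 \<star> q) \<or> c \<in> supp (q \<star> mo a 1)" "supp q \<subseteq> pos" for c q
    using that by (auto elim!: supp_tmE)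
  show "e a <# carrier B = {b \<in> carrier B. \<forall>c\<in>supp (h b). c - a \<in> pos}"
  proof (intro subset_antisym subsetI)
    fix b assume "b \<in> e a <# carrier B"
    then obtain q where "q \<in> carrier B" "b = e a \<otimes> q" by (auto simp: l_coset_def)
    then show "b \<in> {b \<in> carrier B. \<forall>c\<in>supp (h b). c - a \<in> pos}"
      using ea 1 h_supp by (auto simp: h_mult)
  next
    fix b assume b: "b \<in> {b \<in> carrier B. \<forall>c\<in>supp (h b). c - a \<in> pos}"
    then obtain q where q: "supp q \<subseteq> pos" "h b = mo a 1 \<star> q" using mono_divide(1) [of "h b" a]
      by auto
    then have "b = e a \<otimes> el q" using b ea by (intro h_inj) (auto simp: h_mult h_el el_closed)
    then show "b \<in> e a <# carrier B" using el_closed [OF q(1)] by (auto simp: l_coset_def)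
  qed
  show "carrier B #> e a = {b \<in> carrier B. \<forall>c\<in>supp (h b). c - a \<in> pos}"
  proof (intro subset_antisym subsetI)
    fix b assume "b \<in> carrier B #> e a"
    then obtain q where "q \<in> carrier B" "b = q \<otimes> e a" by (auto simp: r_coset_def)
    then show "b \<in> {b \<in> carrier B. \<forall>c\<in>supp (h b). c - a \<in> pos}"
      using ea 1 h_supp by (auto simp: h_mult)
  next
    fix b assume b: "b \<in> {b \<in> carrier B. \<forall>c\<in>supp (h b). c - a \<in> pos}"
    then obtain q where q: "supp q \<subseteq> pos" "h b = q \<star> mo a 1" using mono_divide(2) [of "h b" a]
      by auto
    then have "b = el q \<otimes> e a" using b ea by (intro h_inj) (auto simp: h_mult h_el el_closed)
    then show "b \<in> carrier B #> e a" using el_closed [OF q(1)] by (auto simp: r_coset_def)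
  qed
qed

lemma normal_element_e: "a \<in> pos \<Longrightarrow> normal_element B (e a)"
  unfolding normal_element_def by (simp add: e e_coset)

lemma e_nonzero: "a \<in> pos \<Longrightarrow> e a \<noteq> \<zero>"
  using e h_zero by (metis keys_single keys_zero insert_not_empty one_neq_zero)

text \<open>Division by \<open>x^hv\<close> followed by the projection to the center. The exponent
  \<open>hv\<close> may have negative entries; the assumption says that whatever survives the
  projection is polynomial.\<close>

lemma coefficient_functional:
  assumes hv: "hv \<in> expts" and pos: "\<And>a. a \<in> pos \<Longrightarrow> a - hv \<in> lat \<Longrightarrow> a - hv \<in> pos"
  obtains \<phi> where "\<phi> \<in> dual (carrier B)" "\<And>b. b \<in> carrier B \<Longrightarrow> h (\<phi> b) = tr (h b \<star> mo (- hv) 1)"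
proof -
  define \<phi> where "\<phi> = (\<lambda>b\<in>carrier B. el (tr (h b \<star> mo (- hv) 1)))"
  have s: "supp (tr (h b \<star> mo (- hv) 1)) \<subseteq> pos" "supp (tr (h b \<star> mo (- hv) 1)) \<subseteq> lat"
    if "b \<in> carrier B" for b
    using h_supp [OF that] pos by (auto simp: supp_tr elim!: supp_tmE)
  have \<phi>: "\<phi> b \<in> Z" "\<phi> b \<in> carrier B" "h (\<phi> b) = tr (h b \<star> mo (- hv) 1)" if "b \<in> carrier B" for b
    unfolding \<phi>_def using s [OF that] that el_center el_closed h_el by auto
  have "\<phi> \<in> dual (carrier B)"
    unfolding dual_iff
  proof (intro conjI ballI)
    show "\<phi> \<in> extensional (carrier B)" by (simp add: \<phi>_def)
    fix x assume x: "x \<in> carrier B"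
    show "\<phi> x \<in> Z" by (rule \<phi>(1) [OF x])
    fix y assume y: "y \<in> carrier B"
    show "\<phi> (x \<oplus> y) = \<phi> x \<oplus> \<phi> y"
      using x y \<phi>(2) by (intro h_inj) (simp_all add: \<phi>(3) h_add tm_add_left tr_add)
  next
    fix r x assume r: "r \<in> Z" and x: "x \<in> carrier B"
    then show "\<phi> (r \<otimes> x) = r \<otimes> \<phi> x"
      using \<phi>(2) Z_carrier [OF r] r [unfolded center_iff]
      by (intro h_inj) (simp_all add: \<phi>(3) h_mult tm_assoc tr_tm_central)
  qed
  then show ?thesis using that \<phi>(3) by blast
qed

text \<open>It remains to show that \<open>z\<close> divides \<open>b\<close> once it divides all
  values of functionals on \<open>b\<close>. This is read off one monomial \<open>a\<close> of
  \<open>b\<close> and one variable \<open>k\<close> at a time, with a functional that does not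
  raise the \<open>x_k\<close>-degree of the monomials it retains.\<close>

lemma reflexive_B: "reflexive_module S (as_module B (carrier B))"
proof (rule reflexive)
  show "b = \<zero>" if "b \<in> carrier B" "z \<otimes> b = \<zero>" for b
    using no_zero_divisors [OF z_el(2) that] z_el by simp
  fix b assume b: "b \<in> carrier B" and dvd: "\<And>\<phi>. \<phi> \<in> dual (carrier B) \<Longrightarrow> \<exists>q\<in>Z. \<phi> b = z \<otimes> q"
  have "a - zexp \<in> pos" if a: "a \<in> supp (h b)" for a
  proof -
    have ap: "a \<in> pos" using a h_supp [OF b] by blast
    have ae: "a \<in> expts" by (rule pos_expts [OF ap])
    have "lu zexp k \<le> lu a k" if k: "k \<in> {1..n}" for k
    proof -
      \<comment> \<open>The least \<open>x_k\<close>-degree in the class of \<open>a\<close>: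
        division by this power of \<open>x_k\<close> keeps all monomials of the class polynomial in
        \<open>x_k\<close>.\<close>
      obtain am where am: "am \<in> pos" "rep am = rep a"
        and least: "\<And>c. c \<in> pos \<Longrightarrow> rep c = rep a \<Longrightarrow> nat (lu am k) \<le> nat (lu c k)"
        using least_in_coset [OF ap] by blast
      \<comment> \<open>Lowering the other exponents by multiples of the period makes them
        nonpositive in \<open>?hv\<close>, so dividing by \<open>x^hv\<close> creates no
        denominators in those variables. The class modulo the lattice is unchanged.\<close>
      let ?s = "expt (\<lambda>j. if j = k then 0 else int period * lu am j)"
      let ?hv = "am - ?s"
      have ame: "am \<in> expts" by (rule pos_expts [OF am(1)])
      have hve: "?hv \<in> expts" by (rule expts_diff [OF ame expt_expts])
      have sl: "?s \<in> lat" by (rule lat_period [OF expt_expts]) (simp add: lookup_expt)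
      have hvk: "lu ?hv k = lu am k" using k by (simp add: lookup_minus lookup_expt)
      have hvj: "lu ?hv j \<le> 0" if j: "j \<in> {1..n}" "j \<noteq> k" for j
      proof -
        have "1 * lu am j \<le> int period * lu am j"
          using period(1) posD [OF am(1) j(1)] by (intro mult_right_mono) auto
        then show ?thesis using j by (simp add: lookup_minus lookup_expt)
      qed
      have cond: "c - ?hv \<in> pos" if c: "c \<in> pos" "c - ?hv \<in> lat" for c
      proof -
        have "c - am = (c - ?hv) - ?s" by simp
        then have "c - am \<in> lat" using lat_diff [OF c(2) sl] by simp
        then have "rep c = rep a" using rep_eq_iff [OF pos_expts [OF c(1)] ame] am(2) by simp
        then have "nat (lu am k) \<le> nat (lu c k)" by (rule least [OF c(1)])
        then have ck: "lu am k \<le> lu c k" using posD [OF am(1) k] posD [OF c(1) k] by simp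
        show ?thesis
        proof (rule posI [OF expts_diff [OF pos_expts [OF c(1)] hve]])
          fix j assume j: "j \<in> {1..n}"
          show "0 \<le> lu (c - ?hv) j"
          proof (cases "j = k")
            case True
            then show ?thesis using ck hvk by (simp add: lookup_minus [of c])
          next
            case False
            then show ?thesis using hvj [OF j False] posD [OF c(1) j]
              by (simp add: lookup_minus [of c])
          qed
        qed
      qed
      obtain \<phi> where \<phi>: "\<phi> \<in> dual (carrier B)"
          "\<And>b. b \<in> carrier B \<Longrightarrow> h (\<phi> b) = tr (h b \<star> mo (- ?hv) 1)"
        using coefficient_functional [OF hve cond] by blast
      obtain q where q: "q \<in> Z" "\<phi> b = z \<otimes> q" using dvd [OF \<phi>(1)] by blast
      have eq: "tr (h b \<star> mo (- ?hv) 1) = mo zexp 1 \<star> h q"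
        using \<phi>(2) [OF b] q z_el by (simp add: h_mult Z_carrier)
      have "am - a \<in> lat" using rep_eq_iff [OF ame ae] am(2) by simp
      then have "(am - a) - ?s \<in> lat" by (rule lat_diff [OF _ sl])
      then have "- ((am - a) - ?s) \<in> lat" by (rule lat_minus)
      moreover have "- ((am - a) - ?s) = a + - ?hv" by simp
      ultimately have al: "a + - ?hv \<in> lat" by (simp only:)
      \<comment> \<open>Right multiplication by a monomial shifts exponents injectively, so the term
        coming from \<open>a\<close> cannot be cancelled by another term.\<close>
      have "Poly_Mapping.lookup (h b \<star> mo (- ?hv) 1) (a + - ?hv) \<noteq> 0"
        unfolding lookup_tm_mo using a by (simp add: in_keys_iff)
      then have "a + - ?hv \<in> supp (tr (h b \<star> mo (- ?hv) 1))"
        unfolding supp_tr using al by (simp add: in_keys_iff del: add_uminus_conv_diff)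
      then obtain c where c: "c \<in> supp (h q)" "a + - ?hv = zexp + c"
        unfolding eq by (auto elim!: supp_tmE)
      have "c \<in> pos" using c(1) h_supp [OF Z_carrier [OF q(1)]] by blast
      then have c0: "0 \<le> lu c k" using posD k by blast
      have "lu (a + - ?hv) k = lu (zexp + c) k" using c(2) by (rule arg_cong)
      then have "lu a k - lu ?hv k = lu zexp k + lu c k"
          by (simp add: lookup_add lookup_minus)
      \<comment> \<open>Divisibility by \<open>z\<close> bounds \<open>a - hv\<close> below by the
        period in \<open>x_k\<close>; as \<open>hv\<close> is nonnegative there, the bound passes to
        \<open>a\<close>.\<close>
      moreover have "0 \<le> lu ?hv k" unfolding hvk by (rule posD [OF am(1) k])
      ultimately show ?thesis using c0 by linarith
    qed
    then show ?thesis using diff_pos_iff [OF ae zexp(2)] by blast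
  qed
  then have "b \<in> e zexp <# carrier B" using b e_coset(1) [OF zexp(1)] by blast
  then show "\<exists>c\<in>carrier B. b = z \<otimes> c" by (auto simp: l_coset_def z_eq)
qed

end

section \<open>Divisibility of the discriminant determinants\<close>

context skew_ring
begin

lemma minus_S:
  assumes "x \<in> Z"
  shows "\<ominus>\<^bsub>S\<^esub> x = \<ominus> x"
proof -
  have "\<ominus> x \<in> Z" by (rule subringE(5) [OF subring_center assms])
  moreover have "\<ominus> x \<oplus> x = \<zero>" using Z_carrier [OF assms] by (rule l_neg)
  ultimately show ?thesis using assms by (intro S.minus_equality) auto
qed

text \<open>Lower bounds for the order in each variable add up under multiplication.\<close>

lemma h_finprod_bound:
  assumes "finite A" "\<And>i. i \<in> A \<Longrightarrow> y i \<in> Z"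
    and "\<And>i a k. i \<in> A \<Longrightarrow> a \<in> supp (h (y i)) \<Longrightarrow> k \<in> {1..n} \<Longrightarrow> m k i \<le> lu a k"
  shows "finprod S y A \<in> Z \<and> (\<forall>a\<in>supp (h (finprod S y A)). \<forall>k\<in>{1..n}. (\<Sum>i\<in>A. m k i) \<le> lu a k)"
  using assms
proof (induction A)
  case empty
  then show ?case using S.one_closed by (simp add: h_one)
next
  case (insert x A)
  have IH: "finprod S y A \<in> Z \<and> (\<forall>a\<in>supp (h (finprod S y A)). \<forall>k\<in>{1..n}. (\<Sum>i\<in>A. m k i) \<le> lu a k)"
    by (rule insert.IH) (simp_all add: insert.prems)
  have x: "y x \<in> Z" using insert.prems(1) by simp
  have eq: "finprod S y (insert x A) = y x \<otimes> finprod S y A"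
    using insert.hyps insert.prems(1) by (intro S.finprod_insert) auto
  show ?case
  proof (intro conjI ballI)
    show "finprod S y (insert x A) \<in> Z" unfolding eq using x IH S.m_closed by blast
    fix a k assume a: "a \<in> supp (h (finprod S y (insert x A)))" and k: "k \<in> {1..n}"
    have "h (finprod S y (insert x A)) = h (y x) \<star> h (finprod S y A)"
      unfolding eq using x IH Z_carrier by (intro h_mult) auto
    with a have "a \<in> supp (h (y x) \<star> h (finprod S y A))" by simp
    then obtain b c where bc: "b \<in> supp (h (y x))" "c \<in> supp (h (finprod S y A))" "a = b + c"
      by (rule supp_tmE)
    have "m k x \<le> lu b k" using insert.prems(2) [OF _ bc(1) k] by simp
    moreover have "(\<Sum>i\<in>A. m k i) \<le> lu c k" using IH bc(2) k by blast
    ultimately show "(\<Sum>i\<in>insert x A. m k i) \<le> lu a k"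
      using insert.hyps by (simp add: bc(3) lookup_add)
  qed
qed

text \<open>The central multiples of the monomial \<open>x^dexp\<close>, an ideal of the center that
  will contain all generators of the discriminant ideal.\<close>

definition V where "V = {x \<in> Z. \<forall>a\<in>supp (h x). a - dexp \<in> pos}"

lemma V_zero: "\<zero> \<in> V"
  using S.zero_closed by (simp add: V_def h_zero)

lemma V_add: "x \<in> V \<Longrightarrow> y \<in> V \<Longrightarrow> x \<oplus> y \<in> V"
  using keys_add [of "h x" "h y"] S.a_closed [of x y]
  by (auto simp: V_def h_add Z_carrier)

lemma V_minus: "x \<in> V \<Longrightarrow> \<ominus>\<^bsub>S\<^esub> x \<in> V"
  using subringE(5) [OF subring_center] by (simp add: V_def minus_S h_minus Z_carrier)

lemma V_mult: 
  assumes "x \<in> V" "r \<in> Z"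
  shows "r \<otimes> x \<in> V" "x \<otimes> r \<in> V"
proof -
  have x: "x \<in> Z" "\<And>a. a \<in> supp (h x) \<Longrightarrow> a - dexp \<in> pos" using assms(1) by (auto simp: V_def)
  have "a - dexp \<in> pos" if a: "a \<in> supp (h (r \<otimes> x))" for a
  proof -
    have "a \<in> supp (h r \<star> h x)" using a x assms(2) by (simp add: h_mult Z_carrier)
    then obtain b c where bc: "b \<in> supp (h r)" "c \<in> supp (h x)" "a = b + c" by (rule supp_tmE)
    have "b \<in> pos" using bc(1) h_supp [OF Z_carrier [OF assms(2)]] by blast
    then have "b + (c - dexp) \<in> pos" using x(2) [OF bc(2)] by (rule pos_add)
    then show ?thesis using bc(3) by (simp add: algebra_simps)
  qed
  then show "r \<otimes> x \<in> V" using S.m_closed [OF assms(2) x(1)] by (simp add: V_def)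
  then show "x \<otimes> r \<in> V" using center_comm [OF x(1) Z_carrier [OF assms(2)]] by simp
qed

lemma ideal_V: "ideal V S"
proof (rule idealI)
  show "ring S" by (rule S.ring_axioms)
  show "subgroup V (add_monoid S)"
  proof (rule group.subgroupI)
    show "Group.group (add_monoid S)" by (rule abelian_group.a_group [OF ring.is_abelian_group [OF
      S.ring_axioms]])
    show "V \<subseteq> carrier (add_monoid S)" by (auto simp: V_def)
    show "V \<noteq> {}" using V_zero by blast
    show "inv\<^bsub>add_monoid S\<^esub> a \<in> V" if "a \<in> V" for a using V_minus [OF that] by (simp add: a_inv_def)
    show "a \<otimes>\<^bsub>add_monoid S\<^esub> b \<in> V" if "a \<in> V" "b \<in> V" for a b using V_add that by simp
  qed
qed (use V_mult in auto)

lemma tr_sum: "tr (sum f A) = (\<Sum>a\<in>A. tr (f a))"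
  by (induction A rule: infinite_finite_induct) (auto simp: tr_add)

context
  fixes u u' :: "nat \<Rightarrow> 'a"
  assumes u: "u \<in> {1..card creps} \<rightarrow> carrier B" and u': "u' \<in> {1..card creps} \<rightarrow> carrier B"
begin

abbreviation "w \<equiv> card creps"

text \<open>Only the first family is split into degrees, since this already splits the rows; the
  second family is cut down by the projection itself.\<close>

definition homog where "homog i g = restrict_keys {a. rep a = g} (h (u i))"

definition summand where "summand i g j = el (mo 0 rk \<star> tr (homog i g \<star> h (u' j)))"

lemma homog:
  assumes "i \<in> {1..w}"
  shows "supp (homog i g) \<subseteq> pos" "supp (homog i g) \<subseteq> {a \<in> expts. rep a = g}"
  using h_supp [of "u i"] h_supp_expts [of "u i"] Pi_mem [OF u assms]
  by (auto simp: homog_def keys_restrict_keys)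

lemma summand:
  assumes "i \<in> {1..w}" "j \<in> {1..w}"
  shows "summand i g j \<in> Z" "h (summand i g j) = mo 0 rk \<star> tr (homog i g \<star> h (u' j))"
proof -
  have s: "supp (tr (homog i g \<star> h (u' j))) \<subseteq> pos"
    using supp_tm_pos [OF homog(1) [OF assms(1)] h_supp [OF Pi_mem [OF u' assms(2)]]]
        by (auto simp: supp_tr)
  have p: "supp (mo 0 rk \<star> tr (homog i g \<star> h (u' j))) \<subseteq> pos"
    by (rule supp_tm_pos [OF supp_mo_zero(2) s])
  moreover have "supp (mo 0 rk \<star> tr (homog i g \<star> h (u' j))) \<subseteq> lat"
    using supp_mo_zero(1) [of rk] by (auto simp: supp_tr elim!: supp_tmE intro!: lat_add)
  ultimately show "summand i g j \<in> Z" unfolding summand_def by (rule el_center)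
  show "h (summand i g j) = mo 0 rk \<star> tr (homog i g \<star> h (u' j))"
    unfolding summand_def by (rule h_el [OF p])
qed

lemma trace_expand:
  assumes "i \<in> {1..w}" "j \<in> {1..w}"
  shows "trace (u i \<otimes> u' j) = finsum S (\<lambda>g. summand i g j) creps"
proof -
  have c: "u i \<in> carrier B" "u' j \<in> carrier B" using Pi_mem [OF u assms(1)] Pi_mem [OF u' assms(2)]
    by auto
  have s: "finsum S (\<lambda>g. summand i g j) creps = finsum B (\<lambda>g. summand i g j) creps"
    "finsum B (\<lambda>g. summand i g j) creps \<in> Z"
    using finsum_S [OF finite_creps, of "\<lambda>g. summand i g j"] summand(1) [OF assms] by auto
  show ?thesis
  proof (rule h_inj)
    show "trace (u i \<otimes> u' j) \<in> carrier B" by (rule Z_carrier [OF trace(1) [OF m_closed [OF c]]])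
    show "finsum S (\<lambda>g. summand i g j) creps \<in> carrier B" unfolding s(1)
      by (rule Z_carrier [OF s(2)])
    have "h (finsum S (\<lambda>g. summand i g j) creps) = (\<Sum>g\<in>creps. h (summand i g j))"
      unfolding s(1) by (rule h_finsum [OF finite_creps Z_carrier [OF summand(1) [OF assms]]])
    also have "\<dots> = mo 0 rk \<star> tr ((\<Sum>g\<in>creps. homog i g) \<star> h (u' j))"
      by (simp add: summand(2) [OF assms] tm_sum_right [symmetric] tr_sum [symmetric] tm_sum_left
          [symmetric])
    also have "(\<Sum>g\<in>creps. homog i g) = h (u i)"
      unfolding homog_def
      by (rule restrict_keys_partition [OF finite_creps, symmetric])
        (use h_supp_expts [OF c(1)] rep_in_creps in blast)
    finally show "h (trace (u i \<otimes> u' j)) = h (finsum S (\<lambda>g. summand i g j) creps)"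
      using trace(2) [OF m_closed [OF c]] by (simp add: h_mult c)
  qed
qed

text \<open>Each monomial that survives the projection is a product of polynomial monomials, one of
  class \<open>g\<close>, with central exponent. This is the kind of pair over which
  \<open>mu\<close> takes its minimum.\<close>

lemma summand_bound:
  assumes "i \<in> {1..w}" "j \<in> {1..w}" "a \<in> supp (h (summand i g j))" "k \<in> {1..n}"
  shows "int (mu k g) \<le> lu a k"
proof -
  from assms(3) have "a \<in> supp (mo 0 rk \<star> tr (homog i g \<star> h (u' j)))"
    by (simp add: summand(2) [OF assms(1,2)])
  then obtain x b where "x \<in> supp (mo 0 rk)" "b \<in> supp (tr (homog i g \<star> h (u' j)))" "a = x + b"
    by (rule supp_tmE)
  then have a: "a \<in> lat" "a \<in> supp (homog i g \<star> h (u' j))" by (auto simp: supp_tr split: if_splits)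
  from a(2) obtain b c where bc: "b \<in> supp (homog i g)" "c \<in> supp (h (u' j))" "a = b + c"
    by (rule supp_tmE)
  have "b \<in> pos" "rep b = g" using homog [OF assms(1)] bc(1) by blast+
  moreover have "c \<in> pos" using h_supp [OF Pi_mem [OF u' assms(2)]] bc(2) by blast
  ultimately show ?thesis using mu_le [of b c k] a(1) bc(3) assms(4) by auto
qed

text \<open>By \<open>tr_homogeneous\<close> an entry is an honest product of homogeneous elements,
  up to the central scalar, so \<open>homogeneous_swap\<close> applies.\<close>

lemma summand_minor:
  assumes "k \<in> {1..w}" "l \<in> {1..w}" "i \<in> {1..w}" "j \<in> {1..w}" "g \<in> creps"
  shows "summand k g i \<otimes> summand l g j = summand k g j \<otimes> summand l g i"
proof -
  define b where "b i = restrict_keys {b. g + b \<in> lat} (h (u' i))" for i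
  have b: "supp (b i) \<subseteq> {x \<in> expts. g + x \<in> lat}" if "i \<in> {1..w}" for i
    using h_supp_expts [OF Pi_mem [OF u' that]] by (auto simp: b_def keys_restrict_keys)
  have s: "h (summand k g i) = mo 0 rk \<star> (homog k g \<star> b i)" if "k \<in> {1..w}" "i \<in> {1..w}" for k i
    unfolding summand(2) [OF that] tr_homogeneous [OF assms(5) homog(2) [OF that(1)]] b_def ..
  have m: "h (summand k g i \<otimes> summand l g j) = mo 0 rk \<star> (mo 0 rk \<star> ((homog k g \<star> b i) \<star>
      (homog l g \<star> b j)))"
    if "k \<in> {1..w}" "i \<in> {1..w}" "l \<in> {1..w}" "j \<in> {1..w}" for k i l j
  proof -
    have e: "supp (homog k g \<star> b i) \<subseteq> expts"
      using homog(2) [OF that(1)] b [OF that(2)] by (auto elim!: supp_tmE intro!: expts_add)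
    have "h (summand k g i \<otimes> summand l g j) = (mo 0 rk \<star> (homog k g \<star> b i)) \<star> (mo 0 rk \<star>
        (homog l g \<star> b j))"
      using that by (simp add: h_mult Z_carrier summand(1) s)
    also have "\<dots> = mo 0 rk \<star> (((homog k g \<star> b i) \<star> mo 0 rk) \<star> (homog l g \<star> b j))"
      by (simp only: tm_assoc)
    also have "(homog k g \<star> b i) \<star> mo 0 rk = mo 0 rk \<star> (homog k g \<star> b i)"
      by (rule tm_central [OF supp_mo_zero(1) e, symmetric])
    finally show ?thesis by (simp only: tm_assoc)
  qed
  show ?thesis
  proof (rule h_inj)
    show "h (summand k g i \<otimes> summand l g j) = h (summand k g j \<otimes> summand l g i)"
      unfolding m [OF assms(1,3,2,4)] m [OF assms(1,4,2,3)]
      using homogeneous_swap [OF homog(2) [OF assms(1)] homog(2) [OF assms(2)] assms(5) b [OF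
          assms(3)] b [OF assms(4)]]
      by simp
  qed (use assms summand(1) Z_carrier in auto)
qed

text \<open>After expansion of the rows, a choice \<open>f\<close> of degrees either repeats a
  degree, and the determinant vanishes, or runs through all classes, and every product in the
  determinant is divisible by \<open>x^dexp\<close>.\<close>

lemma determinant_in_V:
  "determinant S w (\<lambda>i j. regular_trace_in B Z (u i \<otimes> u' j)) \<in> V"
proof -
  have c: "summand i g j \<in> Z" if "i \<in> {1..w}" "g \<in> creps" "j \<in> {1..w}" for i g j
    using summand(1) that by blast
  have sc: "finsum S (\<lambda>g. summand i g j) creps \<in> Z" if "i \<in> {1..w}" "j \<in> {1..w}" for i j
    using finsum_S [OF finite_creps, of "\<lambda>g. summand i g j"] c that by auto
  have "determinant S w (\<lambda>i j. regular_trace_in B Z (u i \<otimes> u' j)) =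
      determinant S w (\<lambda>i j. finsum S (\<lambda>g. summand i g j) creps)"
  proof (rule S.determinant_cong)
    show "S.entries_closed w (\<lambda>i j. finsum S (\<lambda>g. summand i g j) creps)"
      using sc by (simp add: S.entries_closed_def)
    fix i j assume ij: "i \<in> {1..w}" "j \<in> {1..w}"
    have "u i \<otimes> u' j \<in> carrier B" using Pi_mem [OF u ij(1)] Pi_mem [OF u' ij(2)] by simp
    then show "regular_trace_in B Z (u i \<otimes> u' j) = finsum S (\<lambda>g. summand i g j) creps"
      using trace_expand [OF ij] by (simp add: regular_trace_in)
  qed
  also have "\<dots> \<in> V"
  proof (rule S.determinant_mem_expand [OF V_zero V_add finite_creps c])
    fix f assume f: "f \<in> {1..w} \<rightarrow> creps"
    show "determinant S w (\<lambda>i j. summand i (f i) j) \<in> V"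
    proof (cases "inj_on f {1..w}")
      case True
      \<comment> \<open>There are as many rows as classes, so an injective choice uses each class
        exactly once.\<close>
      have img: "f ` {1..w} = creps"
      proof (rule card_subset_eq [OF finite_creps])
        show "f ` {1..w} \<subseteq> creps" using f by auto
        show "card (f ` {1..w}) = w" unfolding card_image [OF True] by simp
      qed
      show ?thesis
      proof (rule S.determinant_mem [OF _ V_zero V_add V_minus])
        show "V \<subseteq> Z" by (auto simp: V_def)
        fix \<sigma> assume "\<sigma> permutes {1..w}"
        then have \<sigma>: "\<sigma> i \<in> {1..w}" if "i \<in> {1..w}" for i using that permutes_in_image by fastforce
        have fp: "finprod S (\<lambda>i. summand i (f i) (\<sigma> i)) {1..w} \<in> Z \<and>
          (\<forall>a\<in>supp (h (finprod S (\<lambda>i. summand i (f i) (\<sigma> i)) {1..w})). \<forall>k\<in>{1..n}. (\<Sum>i\<in>{1..w}.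
              int (mu k (f i))) \<le> lu a k)"
        proof (rule h_finprod_bound)
          show "summand i (f i) (\<sigma> i) \<in> Z" if "i \<in> {1..w}" for i
            by (rule summand(1) [OF that \<sigma> [OF that]])
          show "int (mu k (f i)) \<le> lu a k"
            if "i \<in> {1..w}" "a \<in> supp (h (summand i (f i) (\<sigma> i)))" "k \<in> {1..n}" for i a k
            by (rule summand_bound [OF that(1) \<sigma> [OF that(1)] that(2,3)])
        qed simp
        \<comment> \<open>The sum over the rows of the bounds becomes the sum over all classes,
          which is how \<open>dexp\<close> is defined.\<close>
        have "(\<Sum>i\<in>{1..w}. int (mu k (f i))) = lu dexp k" if "k \<in> {1..n}" for k
          using sum.reindex [OF True, of "\<lambda>g. int (mu k g)"]
          unfolding img dexp(3) [OF that] by (simp add: comp_def)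
        then have "a - dexp \<in> pos" if "a \<in> supp (h (finprod S (\<lambda>i. summand i (f i) (\<sigma> i)) {1..w}))"
          for a
          using fp that diff_pos_iff [OF _ dexp(2), of a] h_supp_expts [OF Z_carrier [OF conjunct1
              [OF fp]]] by auto
        then show "S.diagonal_product w (\<lambda>i j. summand i (f i) j) \<sigma> \<in> V"
          using fp by (simp add: S.diagonal_product_def V_def)
      qed
    next
      case False
      then obtain k l where kl: "k \<in> {1..w}" "l \<in> {1..w}" "k \<noteq> l" "f k = f l"
        by (auto simp: inj_on_def)
      have "determinant S w (\<lambda>i j. summand i (f i) j) = \<zero>"
      proof (rule S.determinant_eq_zero [OF _ kl(1-3)])
        show "S.entries_closed w (\<lambda>i j. summand i (f i) j)"
          unfolding S.entries_closed_def using summand(1) by blast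
        fix i j assume ij: "i \<in> {1..w}" "j \<in> {1..w}"
        show "summand k (f k) i \<otimes> summand l (f l) j = summand k (f k) j \<otimes> summand l (f l) i"
          unfolding kl(4) by (rule summand_minor [OF kl(1,2) ij Pi_mem [OF f kl(2)]])
      qed
      then show ?thesis using V_zero by simp
    qed
  qed
  finally show ?thesis .
qed

end

section \<open>The discriminant ideal and its hull\<close>

definition gens where
  "gens = {determinant S (card creps) (\<lambda>i j. regular_trace_in B Z (u i \<otimes> u' j)) | u u'.
      u \<in> {1..card creps} \<rightarrow> carrier B \<and> inj_on u {1..card creps} \<and>
      u' \<in> {1..card creps} \<rightarrow> carrier B \<and> inj_on u' {1..card creps}}"

lemma MD_eq: "MD B Z = Idl\<^bsub>S\<^esub> gens"
  unfolding MD_def rank_over_eq MDv_def gens_def ..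

lemma gens_V: "gens \<subseteq> V"
  unfolding gens_def using determinant_in_V by blast

lemma gens_Z: "gens \<subseteq> Z"
  using gens_V by (auto simp: V_def)

lemma MD_V: "MD B Z \<subseteq> V"
  unfolding MD_eq by (rule S.genideal_minimal [OF ideal_V gens_V])

lemma MD_Z: "MD B Z \<subseteq> Z"
  using MD_V by (auto simp: V_def)

lemma ideal_MD: "ideal (MD B Z) S"
  unfolding MD_eq by (rule S.genideal_ideal [OF gens_Z])

abbreviation "MDB \<equiv> ideal_prod B (MD B Z) (carrier B)"

lemma MDB_carrier: "x \<in> MDB \<Longrightarrow> x \<in> carrier B"
  by (induction rule: ideal_prod.induct) (use MD_Z Z_carrier in auto)

lemma submodule_MDB: "submodule_of MDB"
  unfolding submodule_of_def
proof (intro conjI ballI)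
  show "MDB \<subseteq> carrier B" using MDB_carrier by blast
  have "\<zero> \<in> MD B Z"
    using additive_subgroup.zero_closed [OF ideal.axioms(1) [OF ideal_MD]] by simp
  then have "\<zero> \<otimes> \<zero> \<in> MDB" by (intro ideal_prod.prod) auto
  then show "\<zero> \<in> MDB" by simp
  show "x \<oplus> y \<in> MDB" if "x \<in> MDB" "y \<in> MDB" for x y
    using that by (rule ideal_prod.sum)
  fix r x assume r: "r \<in> Z" and x: "x \<in> MDB"
  from x show "r \<otimes> x \<in> MDB"
  proof (induction rule: ideal_prod.induct)
    case (prod i j)
    have "r \<otimes> i \<in> MD B Z" using ideal.I_l_closed [OF ideal_MD prod(1), of r] r by simp
    then have "(r \<otimes> i) \<otimes> j \<in> MDB" using prod(2) by (rule ideal_prod.prod)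
    moreover have "i \<in> carrier B" using prod(1) MD_Z Z_carrier by blast
    ultimately show ?case using prod(2) Z_carrier [OF r] by (simp add: m_assoc)
  next
    case (sum s1 s2)
    have "r \<otimes> (s1 \<oplus> s2) = r \<otimes> s1 \<oplus> r \<otimes> s2"
      using sum.hyps MDB_carrier Z_carrier [OF r] by (intro r_distr) auto
    then show ?case using ideal_prod.sum [OF sum.IH] by simp
  qed
qed

lemma MDB_subset: "MDB \<subseteq> e dexp <# carrier B"
proof
  fix x assume "x \<in> MDB"
  then show "x \<in> e dexp <# carrier B"
  proof (induction rule: ideal_prod.induct)
    case (prod i j)
    have i: "i \<in> carrier B" "i \<in> e dexp <# carrier B"
      using prod(1) MD_V Z_carrier by (auto simp: e_coset(1) [OF dexp(1)] V_def)
    then obtain q where "q \<in> carrier B" "i = e dexp \<otimes> q" by (auto simp: l_coset_def)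
    then have "i \<otimes> j = e dexp \<otimes> (q \<otimes> j)" using prod(2) e(1) [OF dexp(1)] by (simp add: m_assoc)
    then show ?case using \<open>q \<in> carrier B\<close> prod(2) by (auto simp: l_coset_def)
  next
    case (sum s1 s2)
    then obtain q q' where "q \<in> carrier B" "q' \<in> carrier B" "s1 = e dexp \<otimes> q" "s2 = e dexp \<otimes> q'"
      by (auto simp: l_coset_def)
    then have "s1 \<oplus> s2 = e dexp \<otimes> (q \<oplus> q')" using e(1) [OF dexp(1)] by (simp add: r_distr)
    then show ?case using \<open>q \<in> carrier B\<close> \<open>q' \<in> carrier B\<close> by (auto simp: l_coset_def)
  qed
qed

lemma finprod_monomial:
  assumes "finite A" "\<And>i. i \<in> A \<Longrightarrow> y i \<in> Z" "\<And>i. i \<in> A \<Longrightarrow> \<exists>x. x \<noteq> 0 \<and> h (y i) = mo (a i) x"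
  shows "finprod S y A \<in> Z \<and> (\<exists>x. x \<noteq> 0 \<and> h (finprod S y A) = mo (\<Sum>i\<in>A. a i) x)"
  using assms
proof (induction A)
  case empty
  then show ?case using S.one_closed by (auto simp: h_one intro!: exI [of _ 1])
next
  case (insert i A)
  have IH: "finprod S y A \<in> Z \<and> (\<exists>x. x \<noteq> 0 \<and> h (finprod S y A) = mo (\<Sum>i\<in>A. a i) x)"
    by (rule insert.IH) (simp_all add: insert.prems)
  have i: "y i \<in> Z" using insert.prems(1) by simp
  have eq: "finprod S y (insert i A) = y i \<otimes> finprod S y A"
    using insert.hyps insert.prems(1) by (intro S.finprod_insert) auto
  obtain x x' where x: "x \<noteq> 0" "h (y i) = mo (a i) x" "x' \<noteq> 0"
      "h (finprod S y A) = mo (\<Sum>i\<in>A. a i) x'"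
    using insert.prems(2) [of i] IH by auto
  have "h (y i \<otimes> finprod S y A) = mo (a i + (\<Sum>i\<in>A. a i)) (x * x' * chi (a i) (\<Sum>i\<in>A. a i))"
    using i IH Z_carrier x by (simp add: h_mult tm_mo)
  then have "h (finprod S y (insert i A)) = mo (\<Sum>i\<in>insert i A. a i) (x * x' * chi (a i) (\<Sum>i\<in>A.
      a i))"
    unfolding eq using insert.hyps by simp
  moreover have "x * x' * chi (a i) (\<Sum>i\<in>A. a i) \<noteq> 0" using x by simp
  moreover have "finprod S y (insert i A) \<in> Z" unfolding eq using i IH S.m_closed by blast
  ultimately show ?case by blast
qed

text \<open>For a fixed variable \<open>k\<close>, pairs of monomials attaining all
  \<open>mu k g\<close> give a diagonal trace matrix. Its determinant is a nonzero scalar times a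
  monomial of the least possible \<open>x_k\<close>-degree; its degrees in the other variables are
  not controlled.\<close>

lemma MDB_monomial:
  assumes rk: "rk \<noteq> 0" and k: "k \<in> {1..n}"
  obtains c where "c \<in> pos" "lu c k = lu dexp k" "e c <# carrier B \<subseteq> MDB"
proof -
  let ?w = "card creps"
  have "\<forall>g\<in>creps. \<exists>ab. fst ab \<in> pos \<and> snd ab \<in> pos \<and> rep (fst ab) = g \<and> fst ab + snd ab \<in> lat \<and>
      lu (fst ab + snd ab) k = int (mu k g)"
    using mu_attained [OF _ k] by (metis fst_conv snd_conv)
  then obtain ab where ab: "\<And>g. g \<in> creps \<Longrightarrow> fst (ab g) \<in> pos \<and> snd (ab g) \<in> pos \<and> rep (fst (ab g)) =
      g \<and>
      fst (ab g) + snd (ab g) \<in> lat \<and> lu (fst (ab g) + snd (ab g)) k = int (mu k g)"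
    by metis
  obtain f where f: "bij_betw f {1..?w} creps"
    using ex_bij_betw_nat_finite_1 [OF finite_creps] by blast
  define a where "a i = fst (ab (f i))" for i
  define b where "b i = snd (ab (f i))" for i
  have fi: "f i \<in> creps" if "i \<in> {1..?w}" for i using bij_betwE [OF f] that by blast
  have a: "a i \<in> pos" "b i \<in> pos" "rep (a i) = f i" "a i + b i \<in> lat"
    "lu (a i + b i) k = int (mu k (f i))"
    if "i \<in> {1..?w}" for i
    using ab [OF fi [OF that]] by (auto simp: a_def b_def)
  \<comment> \<open>If \<open>a i\<close> paired with \<open>b j\<close>, it would lie in the class
    of \<open>a j\<close>, but distinct indices have distinct classes.\<close>
  have off: "a i + b j \<in> lat \<longleftrightarrow> i = j" if ij: "i \<in> {1..?w}" "j \<in> {1..?w}" for i j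
  proof
    assume "a i + b j \<in> lat"
    then have "(a i + b j) - (a j + b j) \<in> lat" using a(4) [OF ij(2)] by (rule lat_diff)
    then have "a i - a j \<in> lat" by simp
    then have "rep (a i) = rep (a j)"
      using rep_eq_iff pos_expts a(1) [OF ij(1)] a(1) [OF ij(2)] by blast
    then have "f i = f j" using a(3) ij by simp
    then show "i = j" using f ij by (auto simp: bij_betw_def dest: inj_onD)
  qed (use a(4) ij in simp)
  let ?u = "\<lambda>i. e (a i)" and ?u' = "\<lambda>i. e (b i)"
  have u: "?u \<in> {1..?w} \<rightarrow> carrier B" "?u' \<in> {1..?w} \<rightarrow> carrier B" using e(1) a by auto
  have hu: "h (?u i) = mo (a i) 1" "h (?u' i) = mo (b i) 1" if "i \<in> {1..?w}" for i
    using e(2) a that by auto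
  have inj: "x = y" if "mo x 1 = mo y 1" for x y
    using arg_cong [OF that, of supp] by simp
  \<comment> \<open>The generators range over subsets with as many elements as the rank, so both
    families must be injective; this follows from the diagonal pattern.\<close>
  have inju: "inj_on ?u {1..?w}"
  proof (rule inj_onI)
    fix i j assume ij: "i \<in> {1..?w}" "j \<in> {1..?w}" "?u i = ?u j"
    then have "a i = a j" using hu(1) [OF ij(1)] hu(1) [OF ij(2)] inj by simp
    then show "i = j" using off [OF ij(1,2)] a(4) [OF ij(2)] by simp
  qed
  have inju': "inj_on ?u' {1..?w}"
  proof (rule inj_onI)
    fix i j assume ij: "i \<in> {1..?w}" "j \<in> {1..?w}" "?u' i = ?u' j"
    then have "b i = b j" using hu(2) [OF ij(1)] hu(2) [OF ij(2)] inj by simp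
    then show "i = j" using off [OF ij(1,2)] a(4) [OF ij(1)] by simp
  qed
  let ?M = "\<lambda>i j. regular_trace_in B Z (?u i \<otimes> ?u' j)"
  have M: "?M i j \<in> Z" "h (?M i j) = (if i = j then mo (a i + b i) (rk * chi (a i) (b i)) else 0)"
    if ij: "i \<in> {1..?w}" "j \<in> {1..?w}" for i j
  proof -
    have c: "?u i \<in> carrier B" "?u' j \<in> carrier B" using e(1) a ij by auto
    show "?M i j \<in> Z" using regular_trace_in [OF m_closed [OF c]] trace(1) [OF m_closed [OF c]]
      by simp
    show "h (?M i j) = (if i = j then mo (a i + b i) (rk * chi (a i) (b i)) else 0)"
    proof -
      have "h (?M i j) = mo 0 rk \<star> tr (mo (a i + b j) (chi (a i) (b j)))"
        using regular_trace_in [OF m_closed [OF c]] trace(2) [OF m_closed [OF c]]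
        by (simp add: h_mult c hu(1) [OF ij(1)] hu(2) [OF ij(2)] tm_mo)
      then show ?thesis using off [OF ij] by (auto simp: tr_mo tm_mo)
    qed
  qed
  define det where "det = determinant S ?w ?M"
  have "det = finprod S (\<lambda>i. ?M i i) {1..?w}"
    unfolding det_def
  proof (rule S.determinant_diagonal)
    show "S.entries_closed ?w ?M" using M(1) by (simp add: S.entries_closed_def)
    fix i j assume ij: "i \<in> {1..?w}" "j \<in> {1..?w}" "i \<noteq> j"
    show "?M i j = \<zero>" using M [OF ij(1,2)] ij(3) h_eq_zero_iff Z_carrier by auto
  qed
  moreover have "finprod S (\<lambda>i. ?M i i) {1..?w} \<in> Z \<and>
      (\<exists>x. x \<noteq> 0 \<and> h (finprod S (\<lambda>i. ?M i i) {1..?w}) = mo (\<Sum>i\<in>{1..?w}. a i + b i) x)"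
  proof (rule finprod_monomial)
    fix i assume i: "i \<in> {1..?w}"
    show "?M i i \<in> Z" by (rule M(1) [OF i i])
    show "\<exists>x. x \<noteq> 0 \<and> h (?M i i) = mo (a i + b i) x"
      using M(2) [OF i i] rk by (intro exI [of _ "rk * chi (a i) (b i)"]) simp
  qed simp
  ultimately obtain x where x: "det \<in> Z" "x \<noteq> 0" "h det = mo (\<Sum>i\<in>{1..?w}. a i + b i) x" by auto
  define c where "c = (\<Sum>i\<in>{1..?w}. a i + b i)"
  have hc: "h det = mo c x" using x(3) by (simp add: c_def)
  have det_MD: "det \<in> MD B Z"
  proof -
    have "det \<in> gens"
      unfolding gens_def det_def
      by (rule CollectI, rule exI [of _ ?u], rule exI [of _ ?u'], intro conjI refl u inju inju')
    then show ?thesis unfolding MD_eq by (rule subsetD [OF S.genideal_self [OF gens_Z]])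
  qed
  have "c \<in> supp (h det)" using hc x(2) by simp
  then have c: "c \<in> pos" using h_supp [OF Z_carrier [OF x(1)]] by blast
  moreover have "lu c k = lu dexp k"
  proof -
    have "lu c k = (\<Sum>i\<in>{1..?w}. int (mu k (f i)))"
      unfolding c_def lookup_sum by (intro sum.cong refl a(5))
    also have "\<dots> = (\<Sum>g\<in>creps. int (mu k g))"
      by (rule sum.reindex_bij_betw [OF f])
    finally show ?thesis using k by (simp add: dexp(3))
  qed
  moreover have "e c <# carrier B \<subseteq> MDB"
  proof
    fix y assume "y \<in> e c <# carrier B"
    then obtain q where q: "q \<in> carrier B" "y = e c \<otimes> q" by (auto simp: l_coset_def)
    have s: "supp (mo 0 (inverse x)) \<subseteq> pos" by (rule supp_mo_zero(2))
    \<comment> \<open>The determinant differs from the monomial by the nonzero scalar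
      \<open>x\<close>, which is inverted by a constant polynomial.\<close>
    have "e c = det \<otimes> el (mo 0 (inverse x))"
    proof (rule h_inj)
      show "h (e c) = h (det \<otimes> el (mo 0 (inverse x)))"
        using x(1,2) c s by (simp add: h_mult Z_carrier el_closed h_el e(2) hc tm_mo)
    qed (use x(1) c s Z_carrier el_closed e(1) in auto)
    then have "y = det \<otimes> (el (mo 0 (inverse x)) \<otimes> q)"
      using q x(1) s by (simp add: Z_carrier el_closed m_assoc)
    then show "y \<in> MDB"
      using ideal_prod.prod [OF det_MD, of "el (mo 0 (inverse x)) \<otimes> q" "carrier B" B] q s el_closed
          by simp
  qed
  ultimately show ?thesis using that by blast
qed

text \<open>For each variable \<open>k\<close> the submodule contains all multiples of a monomial
  \<open>c k\<close> that is minimal in \<open>x_k\<close>. Multiplying \<open>y\<close> by a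
  central monomial \<open>t k\<close> free of \<open>x_k\<close> therefore brings it into the
  submodule, and \<open>reflexive_hullI\<close> applies with denominator \<open>t 1\<close>.\<close>

lemma hull_superset:
  assumes rk: "rk \<noteq> 0" and n: "n \<ge> 1"
  shows "e dexp <# carrier B \<subseteq> reflexive_hull B Z MDB"
proof
  fix y assume "y \<in> e dexp <# carrier B"
  then have y: "y \<in> carrier B" "\<And>a. a \<in> supp (h y) \<Longrightarrow> a - dexp \<in> pos"
    by (auto simp: e_coset(1) [OF dexp(1)])
  have "\<forall>k\<in>{1..n}. \<exists>c. c \<in> pos \<and> lu c k = lu dexp k \<and> e c <# carrier B \<subseteq> MDB"
    using MDB_monomial [OF rk] by metis
  then obtain c where c: "\<And>k. k \<in> {1..n} \<Longrightarrow> c k \<in> pos \<and> lu (c k) k = lu dexp k \<and>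
      e (c k) <# carrier B \<subseteq> MDB"
    by metis
  \<comment> \<open>A crude common bound for all exponents of the monomials \<open>c k\<close>; the
    entries are nonnegative, so the total sum serves.\<close>
  define N where "N = (\<Sum>k\<in>{1..n}. \<Sum>j\<in>{1..n}. lu (c k) j)"
  have N: "lu (c k) j \<le> N" if "k \<in> {1..n}" "j \<in> {1..n}" for k j
  proof -
    have p: "0 \<le> lu (c k) j" if "k \<in> {1..n}" "j \<in> {1..n}" for k j using c that posD by blast
    have "lu (c k) j \<le> (\<Sum>j\<in>{1..n}. lu (c k) j)"
      using p that by (intro member_le_sum) auto
    also have "\<dots> \<le> N"
      unfolding N_def using p that by (intro member_le_sum [of k _ "\<lambda>k. \<Sum>j\<in>{1..n}.
          lu (c k) j"] sum_nonneg) auto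
    finally show ?thesis .
  qed
  have N0: "0 \<le> N" unfolding N_def using c posD by (intro sum_nonneg) blast
  text \<open>No variable divides all the \<open>t k\<close>, so a fraction having each \<open>t k\<close> as a denominator has no
    denominator at all.\<close>
  define t where "t k = expt (\<lambda>j. if j = k then 0 else int period * N)" for k
  have t: "t k \<in> pos" "t k \<in> lat" "lu (t k) j = (if j \<noteq> k \<and> j \<in> {1..n} then int period * N else 0)"
    for k j
    unfolding t_def using N0 by (auto intro!: expt_pos lat_period expt_expts simp: lookup_expt)
  have et: "e (t k) \<in> Z" "e (t k) \<in> carrier B" "h (e (t k)) = mo (t k) 1" for k
    using t(1,2) [of k] e [OF t(1)] by (auto simp: center_iff)
  \<comment> \<open>In \<open>x_k\<close> the bound comes from the divisibility of \<open>y\<close>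
    by \<open>x^dexp\<close>, in the other variables from the large exponents of
    \<open>t k\<close>.\<close>
  have ty: "e (t k) \<otimes> y \<in> MDB" if k: "k \<in> {1..n}" for k
  proof -
    have "a - c k \<in> pos" if a: "a \<in> supp (h (e (t k) \<otimes> y))" for a
    proof -
      have "a \<in> supp (mo (t k) 1 \<star> h y)" using a et y by (simp add: h_mult)
      then obtain b where b: "b \<in> supp (h y)" "a = t k + b" by (auto elim!: supp_tmE)
      have bp: "b \<in> pos" using b(1) h_supp [OF y(1)] by blast
      have ap: "a \<in> pos" unfolding b(2) by (rule pos_add [OF t(1) bp])
      show ?thesis
        unfolding diff_pos_iff [OF pos_expts [OF ap] pos_expts [OF conjunct1 [OF c [OF k]]]]
      proof
        fix j assume j: "j \<in> {1..n}"
        show "lu (c k) j \<le> lu a j"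
        proof (cases "j = k")
          case True
          have "lu dexp k \<le> lu b k"
            using y(2) [OF b(1)] diff_pos_iff [OF pos_expts [OF bp] dexp(2)] k by blast
          then show ?thesis using True c [OF k] by (simp add: b(2) lookup_add t(3))
        next
          case False
          have "1 * N \<le> int period * N" using period(1) N0 by (intro mult_right_mono) auto
          moreover have "0 \<le> lu b j" by (rule posD [OF bp j])
          ultimately show ?thesis using False j N [OF k j] by (simp add: b(2) lookup_add t(3))
        qed
      qed
    qed
    then have "e (t k) \<otimes> y \<in> e (c k) <# carrier B"
      using c [OF k] et y(1) by (simp add: e_coset(1))
    then show ?thesis using c [OF k] by blast
  qed
  have k1: "1 \<in> {1..n}" using n by simp
  show "y \<in> reflexive_hull B Z MDB"
  proof (rule reflexive_hullI [OF submodule_MDB y(1) et(1) _ ty [OF k1]])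
    show "e (t 1) \<noteq> \<zero>" by (rule e_nonzero [OF t(1)])
    fix \<psi> assume \<psi>: "\<psi> \<in> dual MDB"
    \<comment> \<open>All fractions \<open>v k\<close> over \<open>t k\<close> are equal, as the
      relation \<open>swap\<close> expresses without fractions.\<close>
    define v where "v k = \<psi> (e (t k) \<otimes> y)" for k
    have v: "v k \<in> Z" if "k \<in> {1..n}" for k unfolding v_def by (rule dualD(2) [OF \<psi> ty [OF that]])
    have swap: "mo (t j) 1 \<star> h (v k) = mo (t k) 1 \<star> h (v j)" if jk: "j \<in> {1..n}" "k \<in> {1..n}"
      for j k
    proof -
      have "e (t j) \<otimes> (e (t k) \<otimes> y) = e (t k) \<otimes> (e (t j) \<otimes> y)"
        using et(2) y(1) center_comm [OF et(1) et(2), of j k] by (metis m_assoc)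
      then have "e (t j) \<otimes> v k = e (t k) \<otimes> v j"
        unfolding v_def using dualD(4) [OF \<psi> et(1)] ty jk by metis
      then have "h (e (t j) \<otimes> v k) = h (e (t k) \<otimes> v j)" by simp
      then show ?thesis using et v jk Z_carrier by (simp add: h_mult)
    qed
    have "a - t 1 \<in> pos" if a: "a \<in> supp (h (v 1))" for a
    proof -
      have ap: "a \<in> pos" using a h_supp [OF Z_carrier [OF v [OF k1]]] by blast
      \<comment> \<open>Compares \<open>x_k\<close>-degrees in \<open>swap\<close>: since
        \<open>t k\<close> is free of \<open>x_k\<close>, each monomial of \<open>v 1\<close>
        already carries the \<open>x_k\<close>-degree of \<open>t 1\<close>.\<close>
      have "lu (t 1) k \<le> lu a k" if k: "k \<in> {1..n}" for k
      proof -
        have "Poly_Mapping.lookup (mo (t k) 1 \<star> h (v 1)) (t k + a) \<noteq> 0"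
          unfolding lookup_mo_tm using a by (simp add: in_keys_iff)
        then have "t k + a \<in> supp (mo (t 1) 1 \<star> h (v k))"
          unfolding swap [OF k k1] by (simp add: in_keys_iff)
        then obtain b where b: "b \<in> supp (h (v k))" "t k + a = t 1 + b" by (auto elim!: supp_tmE)
        have "0 \<le> lu b k" using b(1) h_supp [OF Z_carrier [OF v [OF k]]] posD [OF _ k] by blast
        moreover have "lu (t k) k + lu a k = lu (t 1) k + lu b k"
          using arg_cong [OF b(2), of "\<lambda>a. lu a k"] by (simp only: lookup_add)
        ultimately show ?thesis by (simp add: t(3) [of k k])
      qed
      then show ?thesis using diff_pos_iff [OF pos_expts [OF ap] pos_expts [OF t(1)]] by blast
    qed
    then have "v 1 \<in> e (t 1) <# carrier B"
      using Z_carrier [OF v [OF k1]] by (simp add: e_coset(1) [OF t(1)])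
    then obtain q where q: "q \<in> carrier B" "v 1 = e (t 1) \<otimes> q" by (auto simp: l_coset_def)
    \<comment> \<open>The quotient is obtained only in the ring. Its commutators are annihilated by
      the nonzero central monomial of \<open>t 1\<close>, because \<open>v 1\<close> is central, and
      hence vanish.\<close>
    have "q \<in> Z"
      unfolding center_def
    proof (intro CollectI conjI ballI)
      fix b assume b: "b \<in> carrier B"
      have "e (t 1) \<otimes> (q \<otimes> b \<ominus> b \<otimes> q) = v 1 \<otimes> b \<ominus> b \<otimes> v 1"
        using q et b center_comm [OF et(1) b]
            by (simp add: minus_eq r_distr r_minus m_assoc [symmetric])
      also have "\<dots> = \<zero>" using center_comm [OF v [OF k1] b] b Z_carrier [OF v [OF k1]]
        by (simp add: r_right_minus_eq)
      finally have "q \<otimes> b \<ominus> b \<otimes> q = \<zero>"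
        using no_zero_divisors [OF et(2)] e_nonzero [OF t(1)] q b by blast
      then show "q \<otimes> b = b \<otimes> q" using q b by simp
    qed (rule q)
    then show "\<exists>q\<in>Z. \<psi> (e (t 1) \<otimes> y) = e (t 1) \<otimes> q" using q(2) by (auto simp: v_def)
  qed
qed

lemma discriminant_rk_nonzero:
  assumes "rk \<noteq> 0" "n \<ge> 1"
  shows "ext_reflexive_hull_discriminant B Z (e dexp)"
  unfolding ext_reflexive_hull_discriminant_def
proof (intro conjI discriminant_setting reflexive_B normal_element_e [OF dexp(1)] subset_antisym)
  show "e dexp <# carrier B \<subseteq> reflexive_hull B Z MDB" by (rule hull_superset [OF assms])
  show "reflexive_hull B Z MDB \<subseteq> e dexp <# carrier B"
  proof (rule reflexive_hull_subset [OF reflexive_B submodule_MDB MDB_subset e(1) [OF dexp(1)]])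
    show "b = \<zero>" if "b \<in> carrier B" "e dexp \<otimes> b = \<zero>" for b
      using no_zero_divisors [OF e(1) [OF dexp(1)] that] e_nonzero [OF dexp(1)] by blast
  qed
qed

text \<open>If the rank vanishes in the field, then so do the trace and the discriminant ideal, and
  zero is a normal element generating the zero hull.\<close>

lemma discriminant_rk_zero:
  assumes rk: "rk = 0"
  shows "ext_reflexive_hull_discriminant B Z \<zero>"
proof -
  let ?w = "card creps"
  have "rep 0 \<in> creps" by (rule rep_in_creps [OF expts_zero])
  \<comment> \<open>At least one row is required: the empty determinant would be one instead of
    zero.\<close>
  then have w: "1 \<in> {1..?w}" using finite_creps card_gt_0_iff [of creps] by (auto simp: Suc_le_eq)
  have tr0: "trace b = \<zero>" if "b \<in> carrier B" for b
    using trace [OF that] h_eq_zero_iff Z_carrier by (simp add: rk)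
  have "x = \<zero>" if gen: "x \<in> gens" for x
  proof -
    obtain u u' where x: "x = determinant S ?w (\<lambda>i j. regular_trace_in B Z (u i \<otimes> u' j))"
      and u: "u \<in> {1..?w} \<rightarrow> carrier B" "u' \<in> {1..?w} \<rightarrow> carrier B"
      using gen unfolding gens_def by blast
    have M: "regular_trace_in B Z (u i \<otimes> u' j) = \<zero>" if "i \<in> {1..?w}" "j \<in> {1..?w}" for i j
      using Pi_mem [OF u(1) that(1)] Pi_mem [OF u(2) that(2)] by (simp add: regular_trace_in tr0)
    show ?thesis
      unfolding x using M w S.zero_closed
      by (intro S.determinant_zero_row [of _ _ 1]) (simp_all add: S.entries_closed_def)
  qed
  then have "gens \<subseteq> {\<zero>}" by blast
  moreover have "ideal {\<zero>} S" using S.zeroideal by simp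
  ultimately have MD: "MD B Z \<subseteq> {\<zero>}" unfolding MD_eq using S.genideal_minimal by blast
  have MDB: "x = \<zero>" if "x \<in> MDB" for x
    using that by (induction rule: ideal_prod.induct) (use MD in auto)
  have zM: "\<zero> \<in> MDB" using submodule_MDB by (simp add: submodule_of_def)
  have "reflexive_hull B Z MDB = {\<zero>}"
  proof (intro subset_antisym subsetI)
    fix b assume "b \<in> reflexive_hull B Z MDB"
    then obtain \<Phi> where b: "b \<in> carrier B"
      and eq: "\<And>\<phi>. \<phi> \<in> dual (carrier B) \<Longrightarrow> \<phi> b = \<Phi> (restrict \<phi> MDB)"
      by (auto simp: reflexive_hull_iff)
    have r: "restrict \<phi> MDB = (\<lambda>x\<in>MDB. \<zero>)" if "\<phi> \<in> dual (carrier B)" for \<phi>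
      using dual_zero [OF submodule_carrier that] MDB by (intro restrict_ext) auto
    have z0: "(\<lambda>x\<in>carrier B. \<zero>) \<in> dual (carrier B)" by (auto simp: dual_iff Z_carrier)
    \<comment> \<open>All functionals have the same restriction to the zero submodule, so each
      agrees at \<open>b\<close> with the zero functional.\<close>
    have \<phi>0: "\<phi> b = \<zero>" if "\<phi> \<in> dual (carrier B)" for \<phi>
      using eq [OF that] eq [OF z0] r [OF that] r [OF z0] b by simp
    have "bidual_map S (as_module B (carrier B)) b = bidual_map S (as_module B (carrier B)) \<zero>"
      unfolding bidual_map_eq
      by (intro restrict_ext) (rule trans [OF \<phi>0 dual_zero [OF submodule_carrier, symmetric]])
    then have "b = \<zero>"
      using reflexive_B b unfolding reflexive_module_def bij_betw_def
      by (auto simp: as_module_def dest: inj_onD)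
    then show "b \<in> {\<zero>}" by simp
  next
    fix b assume "b \<in> {\<zero>}"
    have "\<zero> \<in> reflexive_hull B Z MDB"
    proof (rule reflexive_hullI [OF submodule_MDB zero_closed S.one_closed])
      show "\<one> \<noteq> \<zero>" by (rule one_not_zero)
      show "\<one> \<otimes> \<zero> \<in> MDB" using zM by simp
      fix \<psi> assume "\<psi> \<in> dual MDB"
      then have "\<psi> \<zero> \<in> Z" using dualD(2) zM by blast
      then show "\<exists>q\<in>Z. \<psi> (\<one> \<otimes> \<zero>) = \<one> \<otimes> q" using Z_carrier by (intro bexI [of _ "\<psi> \<zero>"]) auto
    qed
    then show "b \<in> reflexive_hull B Z MDB" using \<open>b \<in> {\<zero>}\<close> by simp
  qed
  moreover have "\<zero> <# carrier B = {\<zero>}" "carrier B #> \<zero> = {\<zero>}"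
    by (auto simp: l_coset_def r_coset_def)
  ultimately show ?thesis
    unfolding ext_reflexive_hull_discriminant_def normal_element_def
    using discriminant_setting reflexive_B by simp
qed

end

theorem theorem0p2:
  fixes n :: nat and p :: "nat \<Rightarrow> nat \<Rightarrow> 'k::field"
  defines "A \<equiv> skew_polynomial_ring n p"
  assumes "n \<ge> 2"
    and "\<And>i j. i \<in> {1..n} \<Longrightarrow> j \<in> {1..n} \<Longrightarrow> p i j \<noteq> 0"
    and "\<And>i. i \<in> {1..n} \<Longrightarrow> p i i = 1"
    and "\<And>i j. i \<in> {1..n} \<Longrightarrow> j \<in> {1..n} \<Longrightarrow> p i j = inverse (p j i)"
    and "\<And>i j. i \<in> {1..n} \<Longrightarrow> j \<in> {1..n} \<Longrightarrow> \<exists>m>0. p i j ^ m = 1"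
  shows "\<exists>d. ext_reflexive_hull_discriminant A (center A) d"
proof -
  have torus: "quantum_torus n p"
    by (rule quantum_torus.intro [OF assms(3,6)])
  obtain h where "h \<in> ring_iso A (quantum_torus.qring n p)"
    using quantum_torus.skew_polynomial_ring_iso [OF torus] unfolding A_def by blast
  then have skew: "skew_ring n p A h"
    unfolding A_def
    by (intro skew_ring.intro skew_ring_axioms.intro torus quantum_torus.ring_skew_polynomial_ring)
  have "n \<ge> 1" using assms(2) by simp
  then show ?thesis
    using skew_ring.discriminant_rk_zero [OF skew] skew_ring.discriminant_rk_nonzero [OF skew] by blast
qed

end
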